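(* Let $x(t)$ move according to $\dot x=Ax+Bu(x)$ under the basic control $u(x)=-\mathrm{sign}\langle B,\frac{\partial\rho}{\partial x}(x)\rangle$, and let $\psi=-\frac{\partial\rho}{\partial x}(x)$. Then the compound vector $(x,\psi)$ satisfies the Hamiltonian system $$\dot x=Ax+B\,\mathrm{sign}\langle B,\psi\rangle,\qquad \dot\psi=-A^*\psi+\frac{\partial^2\rho}{\partial x^2}\,B\,\mathrm{sign}\Big\langle B,\frac{\partial\rho}{\partial x}\Big\rangle,$$ whose Hamiltonian is $$\mathcal{H}(x,\psi)=\langle Ax,\psi\rangle+|\langle B,\psi\rangle|-\Big|\Big\langle B,\frac{\partial\rho}{\partial x}(x)\Big\rangle\Big|.$$
   Context: Let $\omega_1,\dots,\omega_N>0$ be pairwise distinct. The state is $x=(x_1,y_1,\dots,x_N,y_N)^*\in\mathbb{R}^{2N}$, and $\dot x=Ax+Bu$ means $\dot x_i=y_i$, $\dot y_i=-\omega_i^2x_i+u$, $i=1,\dots,N$; so $A$ is block diagonal with blocks $\begin{pmatrix}0&1\\-\omega_i^2&0\end{pmatrix}$ and $B=(0,1,\dots,0,1)^*$. For $p=(\xi_1,\eta_1,\dots,\xi_N,\eta_N)\in\mathbb{R}^{2N}$ put $z_i=(\eta_i^2+\omega_i^{-2}\xi_i^2)^{1/2}$ and $$H(p)=\frac1{(2\pi)^N}\int_{(\mathbb{R}/2\pi\mathbb{Z})^N}\Big|\sum_{i=1}^N z_i\cos\varphi_i\Big|\,d\varphi_1\cdots d\varphi_N .$$ $H$ is a norm;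 $\rho(x)=\max_{H(p)\le1}\langle x,p\rangle$ is the dual norm; $\frac{\partial\rho}{\partial x}$ and $\frac{\partial^2\rho}{\partial x^2}$ are its gradient and Hessian, considered outside $x=0$. $\mathrm{sign}$ is the multivalued function $\mathrm{sign}(s)=\pm1$ for $s\gtrless0$, $\mathrm{sign}(0)=[-1,1]$; the differential equations with $\mathrm{sign}$ are understood as differential inclusions, with the value of $\mathrm{sign}$ at an indefinite point given by the actual value of the control. The Hamiltonian system with Hamiltonian $\mathcal{H}$ is $\dot x=\partial\mathcal{H}/\partial\psi$, $\dot\psi=-\partial\mathcal{H}/\partial x$. *)

theory Defs
  imports "HOL-Analysis.Analysis"
begin

text \<open>
  The phase space of N oscillators is \<open>(real \<times> real) ^ 'n\<close> with \<open>N = CARD('n)\<close>; the component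
  \<open>x $ i\<close> is the pair of the position and the velocity of the \<open>i\<close>-th oscillator. The same space,
  with its standard inner product, serves for the dual vectors.
\<close>

type_synonym 'n phase = "(real \<times> real) ^ 'n"

definition osc_A :: "('n \<Rightarrow> real) \<Rightarrow> 'n::finite phase \<Rightarrow> 'n phase" where
  "osc_A \<omega> x = (\<chi> i. (snd (x $ i), - (\<omega> i)\<^sup>2 * fst (x $ i)))"

definition osc_B :: "'n::finite phase" where
  "osc_B = (\<chi> i. (0, 1))"

definition amplitude :: "('n \<Rightarrow> real) \<Rightarrow> 'n::finite phase \<Rightarrow> 'n \<Rightarrow> real" where
  "amplitude \<omega> p i = sqrt ((snd (p $ i))\<^sup>2 + (fst (p $ i))\<^sup>2 / (\<omega> i)\<^sup>2)"

text \<open>The torus is represented by the cube \<open>[0, 2\<pi>]\<^sup>N\<close>.\<close>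

definition osc_H :: "('n \<Rightarrow> real) \<Rightarrow> 'n::finite phase \<Rightarrow> real" where
  "osc_H \<omega> p = 1 / (2 * pi) ^ CARD('n) *
     integral (cbox 0 (\<chi> i. 2 * pi))
       (\<lambda>\<phi> :: real ^ 'n. \<bar>\<Sum>i\<in>UNIV. amplitude \<omega> p i * cos (\<phi> $ i)\<bar>)"

definition osc_rho :: "('n \<Rightarrow> real) \<Rightarrow> 'n::finite phase \<Rightarrow> real" where
  "osc_rho \<omega> x = (SUP p \<in> {p. osc_H \<omega> p \<le> 1}. x \<bullet> p)"

definition gradient :: "('a::real_inner \<Rightarrow> real) \<Rightarrow> 'a \<Rightarrow> 'a" where
  "gradient f x = (THE g. GDERIV f x :> g)"

definition hessian :: "('a::real_inner \<Rightarrow> real) \<Rightarrow> 'a \<Rightarrow> 'a \<Rightarrow> 'a" where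
  "hessian f x = frechet_derivative (gradient f) (at x)"

definition Sign :: "real \<Rightarrow> real set" where
  "Sign s = (if s = 0 then {-1..1} else {sgn s})"

text \<open>
  Solution in the sense of Caratheodory on the interval \<open>I\<close>: \<open>x\<close> is absolutely continuous on compact
  subintervals, with derivative \<open>v t\<close> for almost every \<open>t\<close>.
\<close>

definition moves_with_velocity :: "real set \<Rightarrow> (real \<Rightarrow> 'a::euclidean_space) \<Rightarrow> (real \<Rightarrow> 'a) \<Rightarrow> bool" where
  "moves_with_velocity I x v \<longleftrightarrow>
     (\<forall>a\<in>I. \<forall>b\<in>I. a \<le> b \<longrightarrow>
        v absolutely_integrable_on {a..b} \<and> integral {a..b} v = x b - x a)"

text \<open>
  Motion under the basic control, away from the origin (where the gradient of \<open>osc_rho\<close> is not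
  defined). The function \<open>u\<close> records the actual value of the control; it is determined by \<open>x t\<close>
  except where \<open>osc_B \<bullet> gradient (osc_rho \<omega>) (x t) = 0\<close>.
\<close>

definition basic_motion ::
    "('n \<Rightarrow> real) \<Rightarrow> real set \<Rightarrow> (real \<Rightarrow> 'n::finite phase) \<Rightarrow> (real \<Rightarrow> real) \<Rightarrow> bool" where
  "basic_motion \<omega> I x u \<longleftrightarrow>
     (\<forall>t\<in>I. x t \<noteq> 0) \<and>
     (\<forall>t\<in>I. u t \<in> uminus ` Sign (osc_B \<bullet> gradient (osc_rho \<omega>) (x t))) \<and>
     moves_with_velocity I x (\<lambda>t. osc_A \<omega> (x t) + u t *\<^sub>R osc_B)"

definition osc_Hamiltonian :: "('n \<Rightarrow> real) \<Rightarrow> 'n::finite phase \<Rightarrow> 'n phase \<Rightarrow> real" where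
  "osc_Hamiltonian \<omega> x \<psi> =
     osc_A \<omega> x \<bullet> \<psi> + \<bar>osc_B \<bullet> \<psi>\<bar> - \<bar>osc_B \<bullet> gradient (osc_rho \<omega>) x\<bar>"

text \<open>
  Hamilton's equations for a Hamiltonian that need not be differentiable. The derivative is
  replaced by the Frechet subdifferential, for which the subdifferential of the absolute value
  is \<open>Sign\<close>. It is applied to \<open>h\<close> in the variable \<open>\<psi>\<close> and to \<open>- h\<close> in the variable \<open>x\<close>, because
  the absolute values occur in \<open>osc_Hamiltonian\<close> with the sign plus in \<open>\<psi>\<close> and minus in \<open>x\<close>. Where
  \<open>h\<close> has partial gradients, the two sets are the singletons of \<open>\<partial>h/\<partial>\<psi>\<close> and of \<open>- \<partial>h/\<partial>x\<close>.
\<close>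

definition subdiff :: "('a::real_inner \<Rightarrow> real) \<Rightarrow> 'a \<Rightarrow> 'a set" where
  "subdiff f x =
     {v. \<forall>e>0. \<forall>\<^sub>F y in at x. f y \<ge> f x + v \<bullet> (y - x) - e * norm (y - x)}"

definition hamilton_velocity :: "('a::real_inner \<Rightarrow> 'a \<Rightarrow> real) \<Rightarrow> 'a \<Rightarrow> 'a \<Rightarrow> 'a set" where
  "hamilton_velocity h x \<psi> = subdiff (\<lambda>q. h x q) \<psi>"

definition hamilton_force :: "('a::real_inner \<Rightarrow> 'a \<Rightarrow> real) \<Rightarrow> 'a \<Rightarrow> 'a \<Rightarrow> 'a set" where
  "hamilton_force h x \<psi> = subdiff (\<lambda>y. - h y \<psi>) x"

end

theory Submission
  imports Defs "HOL-Probability.Probability"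
begin

text \<open>
  The dual norm \<open>osc_rho\<close> is the gauge of the convex body whose support function is the mean modulus
  \<open>osc_H\<close> of a sum of waves with independent uniform phases. The body of the argument is the proof that
  \<open>osc_rho\<close> has a symmetric second derivative at every nonzero point and that its gradient is locally
  Lipschitz there. The rest is calculus. Since \<open>osc_H\<close> depends on the amplitudes only, \<open>osc_rho\<close> is invariant
  under the free motion, that is, \<open>osc_A y\<close> is orthogonal to the gradient at \<open>y\<close>; differentiating this identity gives
  \<open>hessian y (osc_A y) = - adjoint osc_A (gradient y)\<close> (\<open>hessian_osc_A\<close>), and the chain rule for
  absolutely continuous motions (\<open>moves_with_velocity_chain\<close>) yields the second Hamilton equation. The
  subdifferentials of the Hamiltonian are those of a differentiable function plus the absolute value of
  a differentiable function (\<open>subdiff_abs\<close>).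
  
  The second derivative of \<open>osc_rho\<close> is not obtained from a second derivative of \<open>osc_H\<close>, which need not
  exist: where exactly two amplitudes are nonzero and they are equal, the density at zero of the sum of
  waves has a logarithmic singularity, and the curvature of \<open>osc_H\<close> is infinite in some directions. What
  survives is an epigraphical second order expansion: the scaled Bregman distances of \<open>osc_H\<close> converge to
  a quadratic form on a subspace and to infinity off it. In the locale \<open>curved_norm\<close> this suffices for
  the differentiability of the maximizer \<open>supp\<close>, which is the gradient of the dual norm: limits of difference
  quotients minimize a quadratic functional, so they are determined and depend linearly on the direction
  (\<open>supp_has_derivative\<close>), and the positivity of the form gives the Lipschitz bound
  (\<open>supp_local_lipschitz\<close>).
  
  For the expansion, average first over the angle of an oscillator with nonzero amplitude, where the
  integral of the modulus is explicit and twice differentiable off a null set (\<open>gap_int_limit\<close>). Fatou's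
  lemma then gives the lower estimate at once (\<open>curvature_lower\<close>). The upper estimate requires that the set of angles
  near the singularities be negligible (\<open>negligible_max\<close>). For the largest amplitude there are three cases: it
  exceeds the sum of the others, and nothing is singular; or there are at least three nonzero amplitudes, and an
  integrable weight shows that the singular set is small (\<open>strip_perp_small\<close>); or there are exactly two
  nonzero amplitudes, which are equal, and every direction of finite curvature is, up to a multiple of the point,
  tangential (\<open>pair_directions\<close>).
\<close>

section \<open>Norms whose curvature may be infinite\<close>

text \<open>
  The excess of \<open>H\<close> over its linearization with gradient \<open>g p\<close>; it is nonnegative when \<open>H\<close> is convex.
\<close>

definition bregman :: "('a::real_inner \<Rightarrow> real) \<Rightarrow> ('a \<Rightarrow> 'a) \<Rightarrow> 'a \<Rightarrow> 'a \<Rightarrow> real" where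
  "bregman H g p v = H (p + v) - H p - g p \<bullet> v"

text \<open>
  \<open>H\<close> has at \<open>p\<close> the second order form \<open>Q\<close> with domain \<open>S\<close>: a quadratic form that is finite exactly on the
  subspace \<open>S\<close> and vanishes only along \<open>p\<close>. The last two clauses say that the scaled Bregman distances
  converge to \<open>Q / 2\<close> in the sense of epi-convergence. The lower estimate allows the base point and the
  direction to vary, and it excludes the directions outside \<open>S\<close>, where the curvature is infinite; the
  limit itself is only required along fixed directions in \<open>S\<close>.
\<close>

definition second_order_form ::
    "('a::real_inner \<Rightarrow> real) \<Rightarrow> ('a \<Rightarrow> 'a) \<Rightarrow> 'a \<Rightarrow> 'a set \<Rightarrow> ('a \<Rightarrow> 'a \<Rightarrow> real) \<Rightarrow> bool" where
  "second_order_form H g p S Q \<longleftrightarrow>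
     subspace S \<and>
     (\<forall>v\<in>S. \<forall>w\<in>S. Q v w = Q w v) \<and>
     (\<forall>u\<in>S. \<forall>v\<in>S. \<forall>w\<in>S. Q (u + v) w = Q u w + Q v w) \<and>
     (\<forall>c. \<forall>v\<in>S. \<forall>w\<in>S. Q (c *\<^sub>R v) w = c * Q v w) \<and>
     (\<forall>v\<in>S. Q v v \<le> 0 \<longrightarrow> (\<exists>c. v = c *\<^sub>R p)) \<and>
     (\<forall>P T V K v k. P \<longlonglongrightarrow> p \<longrightarrow> T \<longlonglongrightarrow> 0 \<longrightarrow> (\<forall>n. 0 < T n) \<longrightarrow> V \<longlonglongrightarrow> v \<longrightarrow> K \<longlonglongrightarrow> k \<longrightarrow>
        (\<forall>n. bregman H g (P n) (T n *\<^sub>R V n) \<le> K n * (T n)\<^sup>2) \<longrightarrow> v \<in> S \<and> Q v v \<le> 2 * k) \<and>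
     (\<forall>v\<in>S. \<forall>T. T \<longlonglongrightarrow> 0 \<longrightarrow> (\<forall>n. 0 < T n) \<longrightarrow>
        (\<lambda>n. bregman H g p (T n *\<^sub>R v) / (T n)\<^sup>2) \<longlonglongrightarrow> Q v v / 2)"

lemma second_order_form_lower:
  assumes "second_order_form H g p S Q" "P \<longlonglongrightarrow> p" "T \<longlonglongrightarrow> 0" "\<And>n. 0 < T n" "V \<longlonglongrightarrow> v" "K \<longlonglongrightarrow> k"
    and "\<And>n. bregman H g (P n) (T n *\<^sub>R V n) \<le> K n * (T n)\<^sup>2"
  shows "v \<in> S" "Q v v \<le> 2 * k"
proof -
  have *: "\<forall>P T V K v k. P \<longlonglongrightarrow> p \<longrightarrow> T \<longlonglongrightarrow> 0 \<longrightarrow> (\<forall>n. 0 < T n) \<longrightarrow> V \<longlonglongrightarrow> v \<longrightarrow> K \<longlonglongrightarrow> k \<longrightarrow>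
        (\<forall>n. bregman H g (P n) (T n *\<^sub>R V n) \<le> K n * (T n)\<^sup>2) \<longrightarrow> v \<in> S \<and> Q v v \<le> 2 * k"
    using assms(1) unfolding second_order_form_def by (elim conjE)
  show "v \<in> S" "Q v v \<le> 2 * k"
    using *[rule_format, of P T V v K k] assms(2-) by auto
qed

lemma second_order_form_facts:
  assumes "second_order_form H g p S Q"
  shows "subspace S"
    and "\<And>v w. v \<in> S \<Longrightarrow> w \<in> S \<Longrightarrow> Q v w = Q w v"
    and "\<And>u v w. u \<in> S \<Longrightarrow> v \<in> S \<Longrightarrow> w \<in> S \<Longrightarrow> Q (u + v) w = Q u w + Q v w"
    and "\<And>c v w. v \<in> S \<Longrightarrow> w \<in> S \<Longrightarrow> Q (c *\<^sub>R v) w = c * Q v w"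
    and "\<And>v. v \<in> S \<Longrightarrow> Q v v \<le> 0 \<Longrightarrow> \<exists>c. v = c *\<^sub>R p"
    and "\<And>v T. v \<in> S \<Longrightarrow> T \<longlonglongrightarrow> 0 \<Longrightarrow> (\<And>n. 0 < T n) \<Longrightarrow>
        (\<lambda>n. bregman H g p (T n *\<^sub>R v) / (T n)\<^sup>2) \<longlonglongrightarrow> Q v v / 2"
  using assms unfolding second_order_form_def by simp_all

text \<open>
  The support function of the unit ball of \<open>H\<close>.
\<close>

definition dual_norm :: "('a::real_inner \<Rightarrow> real) \<Rightarrow> 'a \<Rightarrow> real" where
  "dual_norm H x = (SUP p \<in> {p. H p \<le> 1}. x \<bullet> p)"

lemma tendsto_by_subsequences:
  fixes X :: "nat \<Rightarrow> 'b::metric_space"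
  assumes "\<And>r :: nat \<Rightarrow> nat. strict_mono r \<Longrightarrow> \<exists>s :: nat \<Rightarrow> nat. strict_mono s \<and> (\<lambda>n. X (r (s n))) \<longlonglongrightarrow> l"
  shows "X \<longlonglongrightarrow> l"
proof (rule ccontr)
  assume "\<not> ?thesis"
  then obtain e where e: "e > 0" "\<exists>\<^sub>F n in sequentially. e \<le> dist (X n) l"
    unfolding tendsto_iff not_all not_imp not_eventually not_less by blast
  then have "infinite {n. e \<le> dist (X n) l}"
    by (simp add: cofinite_eq_sequentially[symmetric] frequently_cofinite)
  from infinite_enumerate[OF this] obtain r :: "nat \<Rightarrow> nat"
    where r: "strict_mono r" "\<And>n. e \<le> dist (X (r n)) l"
    by auto
  obtain s where s: "(\<lambda>n. X (r (s n))) \<longlonglongrightarrow> l" using assms[OF r(1)] by blast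
  have "(\<lambda>n. dist (X (r (s n))) l) \<longlonglongrightarrow> 0" using tendsto_dist_iff[THEN iffD1, OF s] by simp
  then have "e \<le> 0" by (rule LIMSEQ_le_const) (use r(2) in auto)
  then show False using e by simp
qed

text \<open>
  A norm that is differentiable off the origin and has a second order form at every nonzero point. The
  dual norm then turns out to be twice differentiable off the origin, even where the curvature of \<open>H\<close>
  is infinite: such directions only contribute zero to the second derivative of the dual norm.
\<close>

locale curved_norm =
  fixes H :: "'a::euclidean_space \<Rightarrow> real" and g :: "'a \<Rightarrow> 'a"
  assumes H_add: "H (x + y) \<le> H x + H y"
    and H_scale: "H (c *\<^sub>R x) = \<bar>c\<bar> * H x"
    and H_pos: "x \<noteq> 0 \<Longrightarrow> 0 < H x"
    and H_deriv: "p \<noteq> 0 \<Longrightarrow> GDERIV H p :> g p"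
    and curved: "p \<noteq> 0 \<Longrightarrow> \<exists>S Q. second_order_form H g p S Q"
begin

abbreviation rho where "rho \<equiv> dual_norm H"

lemma H_zero [simp]: "H 0 = 0"
  using H_scale[of 0 0] by simp

lemma H_nonneg: "0 \<le> H x"
  using H_pos[of x] by (cases "x = 0") auto

lemma H_minus: "H (- x) = H x"
  using H_scale[of "-1" x] by simp

lemma H_bounded: "\<exists>C>0. \<forall>x. H x \<le> C * norm x"
proof -
  define C where "C = (\<Sum>b\<in>Basis. H b) + 1"
  have sumH: "H (sum f A) \<le> (\<Sum>b\<in>A. H (f b))" if "finite A" for f and A :: "'a set"
    using that by (induction A) (auto intro: order_trans[OF H_add])
  have "H x \<le> C * norm x" for x
  proof -
    have "H x = H (\<Sum>b\<in>Basis. (x \<bullet> b) *\<^sub>R b)" by (simp add: euclidean_representation)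
    also have "\<dots> \<le> (\<Sum>b\<in>Basis. \<bar>x \<bullet> b\<bar> * H b)"
      using sumH[of Basis "\<lambda>b. (x \<bullet> b) *\<^sub>R b"] by (simp add: H_scale)
    also have "\<dots> \<le> (\<Sum>b\<in>Basis. norm x * H b)"
      by (intro sum_mono mult_right_mono) (auto simp: Basis_le_norm H_nonneg)
    also have "\<dots> \<le> C * norm x" by (simp add: C_def sum_distrib_left algebra_simps)
    finally show ?thesis .
  qed
  moreover have "C > 0" unfolding C_def by (smt (verit) H_nonneg sum_nonneg)
  ultimately show ?thesis by blast
qed

lemma H_diff: "\<bar>H x - H y\<bar> \<le> H (x - y)"
  using H_add[of "x - y" y] H_add[of "y - x" x] H_minus[of "x - y"] by simp

lemma H_cont: "continuous_on UNIV H"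
proof -
  obtain C where C: "C > 0" "\<And>x. H x \<le> C * norm x" using H_bounded by blast
  have "C-lipschitz_on UNIV H"
    by (rule lipschitz_onI) (use C H_diff in \<open>auto simp: dist_norm intro: order_trans less_imp_le\<close>)
  then show ?thesis by (rule lipschitz_on_continuous_on)
qed

lemma H_lower: "\<exists>c>0. \<forall>x. c * norm x \<le> H x"
proof (cases "sphere 0 1 = ({} :: 'a set)")
  case True
  then have "x = 0" for x :: 'a
  proof -
    { assume "x \<noteq> 0" then have "x /\<^sub>R norm x \<in> sphere 0 1" by simp
      with True have False by blast }
    then show ?thesis by blast
  qed
  then show ?thesis by (metis H_zero mult_zero_right norm_zero order_refl zero_less_one)
next
  case False
  obtain m where m: "m \<in> sphere 0 (1::real)" "\<And>y. y \<in> sphere 0 1 \<Longrightarrow> H m \<le> H y"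
    using continuous_attains_inf[OF compact_sphere False continuous_on_subset[OF H_cont subset_UNIV]]
    by blast
  have "H m * norm x \<le> H x" for x
  proof (cases "x = 0")
    case nz: False
    then have "H m \<le> H (x /\<^sub>R norm x)" by (intro m(2)) simp
    then show ?thesis using nz by (simp add: H_scale field_simps)
  qed simp
  moreover have "H m > 0" using m(1) by (intro H_pos) auto
  ultimately show ?thesis by blast
qed

lemma compact_unit_ball: "compact {p. H p \<le> 1}"
proof -
  obtain c where c: "c > 0" "\<And>x. c * norm x \<le> H x" using H_lower by blast
  have "norm p \<le> 1 / c" if "H p \<le> 1" for p
    using c(2)[of p] that c(1) by (simp add: field_simps)
  then have "bounded {p. H p \<le> 1}" by (auto simp: bounded_iff)
  moreover have "closed {p. H p \<le> 1}"
    using closed_Collect_le[OF H_cont continuous_on_const, of 1] by simp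
  ultimately show ?thesis using compact_eq_bounded_closed by blast
qed

lemma maximizer_exists: "\<exists>p. H p \<le> 1 \<and> x \<bullet> p = rho x \<and> (\<forall>q. H q \<le> 1 \<longrightarrow> x \<bullet> q \<le> rho x)"
proof -
  have "\<exists>p\<in>{p. H p \<le> 1}. \<forall>q\<in>{p. H p \<le> 1}. x \<bullet> q \<le> x \<bullet> p"
  proof (rule continuous_attains_sup[OF compact_unit_ball])
    have "0 \<in> {p. H p \<le> 1}" by simp
    then show "{p. H p \<le> 1} \<noteq> {}" by blast
    show "continuous_on {p. H p \<le> 1} ((\<bullet>) x)" by (intro continuous_intros)
  qed
  then obtain p where p: "H p \<le> 1" "\<And>q. H q \<le> 1 \<Longrightarrow> x \<bullet> q \<le> x \<bullet> p" by auto
  have "rho x = x \<bullet> p" unfolding dual_norm_def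
    by (rule cSup_eq_maximum) (use p in auto)
  then show ?thesis using p by auto
qed

lemma rho_ineq: "x \<bullet> q \<le> rho x * H q"
proof (cases "q = 0")
  case False
  then have q: "H q > 0" by (rule H_pos)
  then have "H (q /\<^sub>R H q) \<le> 1" by (simp add: H_scale)
  then have "x \<bullet> (q /\<^sub>R H q) \<le> rho x" using maximizer_exists[of x] by blast
  then show ?thesis using q by (simp add: field_simps)
qed simp

lemma rho_pos: assumes "x \<noteq> 0" shows "0 < rho x"
proof -
  have "0 < x \<bullet> x" using assms by simp
  also have "x \<bullet> x \<le> rho x * H x" by (rule rho_ineq)
  finally show ?thesis using H_pos[OF assms] by (simp add: zero_less_mult_iff)
qed

text \<open>
  A point of the unit ball at which \<open>dual_norm H x\<close> is attained. It is unique for \<open>x \<noteq> 0\<close>.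
\<close>

definition supp :: "'a \<Rightarrow> 'a" where
  "supp x = (SOME p. H p \<le> 1 \<and> x \<bullet> p = rho x)"

lemma supp_le: "H (supp x) \<le> 1" and supp_inner: "x \<bullet> supp x = rho x"
proof -
  have "\<exists>p. H p \<le> 1 \<and> x \<bullet> p = rho x" using maximizer_exists by blast
  from someI_ex[OF this] show "H (supp x) \<le> 1" "x \<bullet> supp x = rho x"
    unfolding supp_def by auto
qed

lemma maximizer_norm:
  assumes "x \<noteq> 0" "H p \<le> 1" "x \<bullet> p = rho x" shows "H p = 1" "p \<noteq> 0"
proof -
  have "rho x \<le> rho x * H p" using rho_ineq[of x p] assms by simp
  then show "H p = 1" using assms(2) rho_pos[OF assms(1)] by simp
  then show "p \<noteq> 0" by auto
qed

lemma maximizer_gradient: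
  assumes "x \<noteq> 0" "H p \<le> 1" "x \<bullet> p = rho x" shows "x = rho x *\<^sub>R g p"
proof -
  have p: "H p = 1" "p \<noteq> 0" using maximizer_norm[OF assms] by auto
  define f where "f q = rho x * H q - x \<bullet> q" for q
  have d: "(f has_derivative (\<lambda>h. rho x * (h \<bullet> g p) - x \<bullet> h)) (at p)"
    unfolding f_def using H_deriv[OF p(2)] unfolding gderiv_def
    by (auto intro!: derivative_eq_intros)
  have min: "f p \<le> f q" for q
    using rho_ineq[of x q] assms(3) p(1) by (simp add: f_def)
  have "(\<lambda>h. rho x * (h \<bullet> g p) - x \<bullet> h) = (\<lambda>h. 0)"
    by (rule has_derivative_local_min[OF d]) (simp add: min)
  then have "rho x * (h \<bullet> g p) - x \<bullet> h = 0" for h by metis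
  then have "h \<bullet> (rho x *\<^sub>R g p - x) = 0" for h
    by (simp add: inner_diff_right inner_commute)
  then have "rho x *\<^sub>R g p - x = 0" using inner_eq_zero_iff by blast
  then show ?thesis by simp
qed

lemma g_inner_self: assumes "p \<noteq> 0" shows "g p \<bullet> p = H p"
proof -
  have "((\<lambda>t. H (p + t *\<^sub>R p)) has_derivative (\<lambda>h. (h *\<^sub>R p) \<bullet> g p)) (at 0)"
  proof (rule has_derivative_compose[where g = H])
    show "((\<lambda>t. p + t *\<^sub>R p) has_derivative (\<lambda>h. h *\<^sub>R p)) (at 0)"
      by (auto intro!: derivative_eq_intros)
    show "(H has_derivative (\<lambda>h. h \<bullet> g p)) (at (p + 0 *\<^sub>R p))"
      using H_deriv[OF assms] by (simp add: gderiv_def)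
  qed
  then have 1: "((\<lambda>t. H (p + t *\<^sub>R p)) has_field_derivative (p \<bullet> g p)) (at 0)"
    unfolding has_field_derivative_def by (simp add: mult.commute[of _ "p \<bullet> g p"])
  have "((\<lambda>t. (1 + t) * H p) has_field_derivative H p) (at 0)"
    by (auto intro!: derivative_eq_intros)
  moreover have "\<forall>\<^sub>F t in nhds (0::real). H (p + t *\<^sub>R p) = (1 + t) * H p"
  proof -
    have "\<forall>\<^sub>F t in nhds (0::real). t > -1" 
      using eventually_nhds_in_open[of "{-1<..}" "0::real"] by simp
    then show ?thesis
    proof (rule eventually_mono)
      fix t :: real assume "-1 < t"
      then show "H (p + t *\<^sub>R p) = (1 + t) * H p"
        using H_scale[of "1 + t" p] by (simp add: scaleR_left_distrib)
    qed
  qed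
  ultimately have "((\<lambda>t. H (p + t *\<^sub>R p)) has_field_derivative H p) (at 0)"
    using DERIV_cong_ev[OF refl, of "\<lambda>t. H (p + t *\<^sub>R p)" "\<lambda>t. (1 + t) * H p" 0 "H p" "H p"] by simp
  with 1 show ?thesis by (metis DERIV_unique inner_commute)
qed

lemma bregman_convex:
  assumes "0 \<le> s" "s \<le> 1" shows "bregman H g p (s *\<^sub>R v) \<le> s * bregman H g p v"
proof -
  have "p + s *\<^sub>R v = s *\<^sub>R (p + v) + (1 - s) *\<^sub>R p" by (simp add: algebra_simps)
  then have "H (p + s *\<^sub>R v) \<le> s * H (p + v) + (1 - s) * H p"
    using H_add[of "s *\<^sub>R (p + v)" "(1 - s) *\<^sub>R p"] assms by (simp add: H_scale)
  then show ?thesis by (simp add: bregman_def algebra_simps)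
qed

text \<open>
  Between two maximizers the Bregman distance vanishes, hence so does the second order form in the
  direction of their difference; the two points are then proportional.
\<close>

lemma maximizer_unique:
  assumes x: "x \<noteq> 0" and p: "H p \<le> 1" "x \<bullet> p = rho x" and q: "H q \<le> 1" "x \<bullet> q = rho x"
  shows "q = p"
proof -
  note hp = maximizer_norm[OF x p] note hq = maximizer_norm[OF x q]
  have xg: "x = rho x *\<^sub>R g p" by (rule maximizer_gradient[OF x p])
  obtain S Q where SQ: "second_order_form H g p S Q" using curved hp by blast
  define v where "v = q - p"
  have "rho x * (g p \<bullet> v) = (rho x *\<^sub>R g p) \<bullet> v" by simp
  also have "\<dots> = x \<bullet> v" by (simp only: xg[symmetric])
  also have "\<dots> = 0" using p q by (simp add: v_def inner_diff_right)
  finally have gv: "g p \<bullet> v = 0" using rho_pos[OF x] by simp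
  then have b0: "bregman H g p v = 0" using hp hq by (simp add: bregman_def v_def)
  define T where "T n = inverse (real (Suc n))" for n
  have T: "T \<longlonglongrightarrow> 0" "\<And>n. 0 < T n" "\<And>n. T n \<le> 1"
    using LIMSEQ_inverse_real_of_nat by (simp_all add: T_def[abs_def] inverse_le_1_iff)
  have "bregman H g p (T n *\<^sub>R v) \<le> 0 * (T n)\<^sup>2" for n
    using bregman_convex[of "T n" p v] T(2)[of n] T(3)[of n] b0 by simp
  from second_order_form_lower[OF SQ tendsto_const T(1) T(2) tendsto_const tendsto_const this]
  have "v \<in> S" "Q v v \<le> 0" by auto
  then obtain c where c: "v = c *\<^sub>R p" using second_order_form_facts(5)[OF SQ] by blast
  have "g p \<bullet> v = c" using c g_inner_self[OF hp(2)] hp by simp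
  then have "c = 0" using gv by simp
  then have "v = 0" using c by simp
  then show ?thesis by (simp add: v_def)
qed

lemma supp_facts:
  assumes "x \<noteq> 0"
  shows "H (supp x) = 1" "supp x \<noteq> 0" "x = rho x *\<^sub>R g (supp x)"
  using maximizer_norm[OF assms supp_le supp_inner] maximizer_gradient[OF assms supp_le supp_inner] by auto

lemma g_supp: assumes "x \<noteq> 0" shows "g (supp x) = x /\<^sub>R rho x"
proof -
  have "g (supp x) = (rho x *\<^sub>R g (supp x)) /\<^sub>R rho x" using rho_pos[OF assms] by simp
  then show ?thesis by (simp only: supp_facts(3)[OF assms, symmetric])
qed

lemma supp_bounded: "\<exists>C>0. \<forall>x. norm (supp x) \<le> C"
proof -
  have "bounded {p. H p \<le> 1}" using compact_unit_ball compact_imp_bounded by blast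
  then obtain C where "\<And>p. H p \<le> 1 \<Longrightarrow> norm p \<le> C" unfolding bounded_iff by blast
  then show ?thesis by (intro exI[of _ "max C 1"]) (auto simp: supp_le le_max_iff_disj)
qed

lemma rho_bounds: "supp x \<bullet> (y - x) \<le> rho y - rho x" "rho y - rho x \<le> supp y \<bullet> (y - x)"
proof -
  have *: "x \<bullet> supp y \<le> rho x" for x y using maximizer_exists[of x] supp_le[of y] by blast
  show "supp x \<bullet> (y - x) \<le> rho y - rho x" using *[of y x] supp_inner[of x]
    by (simp add: inner_diff_right inner_diff_left inner_commute)
  show "rho y - rho x \<le> supp y \<bullet> (y - x)" using *[of x y] supp_inner[of y]
    by (simp add: inner_diff_right inner_diff_left inner_commute)
qed

lemma rho_lipschitz: "\<exists>C>0. \<forall>x y. \<bar>rho x - rho y\<bar> \<le> C * norm (x - y)"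
proof -
  obtain C where C: "C > 0" "\<And>x. norm (supp x) \<le> C" using supp_bounded by blast
  have *: "rho y - rho x \<le> C * norm (y - x)" for x y
  proof -
    have "rho y - rho x \<le> supp y \<bullet> (y - x)" by (rule rho_bounds)
    also have "\<dots> \<le> norm (supp y) * norm (y - x)" by (rule norm_cauchy_schwarz)
    also have "\<dots> \<le> C * norm (y - x)" by (intro mult_right_mono C) auto
    finally show ?thesis .
  qed
  then have "\<bar>rho x - rho y\<bar> \<le> C * norm (x - y)" for x y
    using *[of x y] *[of y x] by (simp add: norm_minus_commute abs_le_iff)
  then show ?thesis using C by blast
qed

lemma rho_tendsto: "X \<longlonglongrightarrow> x \<Longrightarrow> (\<lambda>n. rho (X n)) \<longlonglongrightarrow> rho x"
proof -
  assume X: "X \<longlonglongrightarrow> x"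
  obtain C where C: "\<And>x y. \<bar>rho x - rho y\<bar> \<le> C * norm (x - y)" using rho_lipschitz by blast
  have "(\<lambda>n. C * norm (X n - x)) \<longlonglongrightarrow> C * norm (x - x)" by (intro tendsto_intros X)
  then have *: "(\<lambda>n. C * norm (X n - x)) \<longlonglongrightarrow> 0" by simp
  have "(\<lambda>n. rho (X n) - rho x) \<longlonglongrightarrow> 0"
  proof (rule Lim_null_comparison[OF _ *])
    show "\<forall>\<^sub>F n in sequentially. norm (rho (X n) - rho x) \<le> C * norm (X n - x)"
      by (simp add: C)
  qed
  then show ?thesis by (simp add: LIM_zero_iff)
qed

lemma supp_tendsto:
  assumes X: "X \<longlonglongrightarrow> x" and x: "x \<noteq> 0" shows "(\<lambda>n. supp (X n)) \<longlonglongrightarrow> supp x"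
proof (rule tendsto_by_subsequences)
  fix r :: "nat \<Rightarrow> nat" assume r: "strict_mono r"
  have "\<forall>n. supp (X (r n)) \<in> {p. H p \<le> 1}" by (simp add: supp_le)
  then obtain q s where q: "q \<in> {p. H p \<le> 1}" "strict_mono s" "((\<lambda>n. supp (X (r n))) \<circ> s) \<longlonglongrightarrow> q"
    by (rule seq_compactE[OF compact_imp_seq_compact[OF compact_unit_ball]])
  have qH: "H q \<le> 1" using q(1) by simp
  define Y where "Y = X \<circ> (r \<circ> s)"
  have Y: "Y \<longlonglongrightarrow> x" unfolding Y_def
    using X LIMSEQ_subseq_LIMSEQ strict_mono_o[OF r(1) q(2)] by blast
  have sY: "(\<lambda>n. supp (Y n)) \<longlonglongrightarrow> q" using q(3) by (simp add: Y_def o_def)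
  have "(\<lambda>n. Y n \<bullet> supp (Y n)) \<longlonglongrightarrow> x \<bullet> q" by (intro tendsto_intros Y sY)
  then have "(\<lambda>n. rho (Y n)) \<longlonglongrightarrow> x \<bullet> q" by (simp add: supp_inner)
  then have "x \<bullet> q = rho x" using rho_tendsto[OF Y] LIMSEQ_unique by blast
  then have "q = supp x" using maximizer_unique[OF x supp_le supp_inner qH] by blast
  then show "\<exists>s. strict_mono s \<and> (\<lambda>n. supp (X (r (s n)))) \<longlonglongrightarrow> supp x"
    using sY q(2) by (auto simp: Y_def)
qed

lemma rho_lower: "\<exists>D>0. \<forall>z. norm z \<le> D * rho z"
proof -
  obtain C where C: "C > 0" "\<And>x. H x \<le> C * norm x" using H_bounded by blast
  have "norm z \<le> C * rho z" for z
  proof (cases "z = 0")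
    case True
    then show ?thesis using supp_inner[of 0] by simp
  next
    case False
    have "norm z * norm z = z \<bullet> z" by (simp add: dot_square_norm power2_eq_square)
    also have "\<dots> \<le> rho z * H z" by (rule rho_ineq)
    also have "\<dots> \<le> rho z * (C * norm z)" using rho_pos[OF False] C(2) by (intro mult_left_mono) auto
    finally show ?thesis using False by (simp add: algebra_simps)
  qed
  then show ?thesis using C by blast
qed

lemma unit_diff_bound: "\<exists>E>0. \<forall>y z. y \<noteq> 0 \<longrightarrow> z \<noteq> 0 \<longrightarrow>
   norm (y /\<^sub>R rho y - z /\<^sub>R rho z) \<le> E / rho y * norm (y - z)"
proof -
  obtain C where C: "C > 0" "\<And>x y. \<bar>rho x - rho y\<bar> \<le> C * norm (x - y)" using rho_lipschitz by blast
  obtain D where D: "D > 0" "\<And>z. norm z \<le> D * rho z" using rho_lower by blast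
  have "norm (y /\<^sub>R rho y - z /\<^sub>R rho z) \<le> (1 + C * D) / rho y * norm (y - z)"
    if "y \<noteq> 0" "z \<noteq> 0" for y z
  proof -
    have p: "rho y > 0" "rho z > 0" using that rho_pos by auto
    have "y /\<^sub>R rho y - z /\<^sub>R rho z = (y - z) /\<^sub>R rho y + ((rho z - rho y) / (rho y * rho z)) *\<^sub>R z"
    proof -
      have "inverse (rho z) + (rho z - rho y) / (rho y * rho z) = inverse (rho y)"
        using p by (simp add: field_simps)
      then have "(inverse (rho z) + (rho z - rho y) / (rho y * rho z)) *\<^sub>R z = inverse (rho y) *\<^sub>R z" by simp
      then show ?thesis by (simp add: algebra_simps)
    qed
    also have "norm \<dots> \<le> norm (y - z) / rho y + \<bar>rho z - rho y\<bar> / (rho y * rho z) * norm z"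
      using p by (intro order_trans[OF norm_triangle_ineq]) (simp add: divide_inverse mult.commute abs_mult)
    also have "\<dots> \<le> norm (y - z) / rho y + (C * norm (y - z)) / (rho y * rho z) * (D * rho z)"
      using p C(1) D(1) C(2)[of z y] D(2)[of z]
      by (intro add_left_mono mult_mono divide_right_mono) (auto simp: norm_minus_commute)
    also have "\<dots> = (1 + C * D) / rho y * norm (y - z)" using p by (simp add: field_simps)
    finally show ?thesis .
  qed
  moreover have "1 + C * D > 0" using C(1) D(1) by (simp add: pos_add_strict)
  ultimately show ?thesis by blast
qed

lemma g_supp_tendsto:
  assumes "X \<longlonglongrightarrow> x" "x \<noteq> 0" "\<And>n. X n \<noteq> 0" shows "(\<lambda>n. g (supp (X n))) \<longlonglongrightarrow> g (supp x)"
proof -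
  have "(\<lambda>n. X n /\<^sub>R rho (X n)) \<longlonglongrightarrow> x /\<^sub>R rho x"
    by (intro tendsto_intros rho_tendsto assms) (use rho_pos[OF assms(2)] in simp)
  then show ?thesis using assms by (simp add: g_supp)
qed

lemma supp_inner_le: assumes "x \<noteq> 0" shows "g (supp x) \<bullet> (supp y - supp x) \<le> 0"
proof -
  have "x \<bullet> supp y \<le> rho x" using maximizer_exists[of x] supp_le[of y] by blast
  then have "x \<bullet> (supp y - supp x) \<le> 0" using supp_inner[of x] by (simp add: inner_diff_right)
  then show ?thesis using rho_pos[OF assms] by (simp add: g_supp[OF assms] mult_le_0_iff)
qed

text \<open>
  The maximizer is locally Lipschitz: otherwise, normalized differences of maximizers would converge to a
  direction of zero curvature that is tangent to the unit sphere. This is where the lower estimate is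
  needed with a moving base point.
\<close>

lemma supp_local_lipschitz:
  assumes x: "x \<noteq> 0"
  shows "\<exists>r>0. \<exists>L>0. \<forall>y\<in>ball x r. \<forall>z\<in>ball x r. norm (supp y - supp z) \<le> L * norm (y - z)"
proof (rule ccontr)
  assume neg: "\<not> ?thesis"
  have "\<exists>y z. y \<in> ball x (norm x / real (Suc n)) \<and> z \<in> ball x (norm x / real (Suc n)) \<and>
      real (Suc n) * norm (y - z) < norm (supp y - supp z)" for n
  proof (rule ccontr)
    assume "\<not> ?thesis"
    then have "\<forall>y\<in>ball x (norm x / real (Suc n)). \<forall>z\<in>ball x (norm x / real (Suc n)).
      norm (supp y - supp z) \<le> real (Suc n) * norm (y - z)" by (meson not_less)
    moreover have "norm x / real (Suc n) > 0" "real (Suc n) > 0" using x by auto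
    ultimately show False using neg by blast
  qed
  then obtain X Y where XY: "\<And>n. X n \<in> ball x (norm x / real (Suc n))"
      "\<And>n. Y n \<in> ball x (norm x / real (Suc n))"
      "\<And>n. real (Suc n) * norm (X n - Y n) < norm (supp (X n) - supp (Y n))"
    by metis
  have nz: "z \<noteq> 0" if "z \<in> ball x (norm x / real (Suc n))" for z n
  proof
    assume "z = 0"
    then have "norm x < norm x / real (Suc n)" using that by (simp add: dist_norm)
    also have "\<dots> \<le> norm x" using x by (simp add: field_simps)
    finally show False by simp
  qed
  have X0: "X n \<noteq> 0" and Y0: "Y n \<noteq> 0" for n using nz XY by blast+
  have lim: "Z \<longlonglongrightarrow> x" if "\<And>n. Z n \<in> ball x (norm x / real (Suc n))" for Z
  proof (rule LIM_zero_cancel, rule Lim_null_comparison)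
    show "(\<lambda>n. norm x / real (Suc n)) \<longlonglongrightarrow> 0"
      using tendsto_mult_right_zero[OF LIMSEQ_inverse_real_of_nat, of "norm x"] by (simp add: divide_inverse)
    show "\<forall>\<^sub>F n in sequentially. norm (Z n - x) \<le> norm x / real (Suc n)"
      using that by (intro always_eventually allI) (simp add: dist_norm norm_minus_commute less_imp_le)
  qed
  define P where "P n = supp (X n)" for n
  define T where "T n = norm (supp (Y n) - P n)" for n
  define V where "V n = (supp (Y n) - P n) /\<^sub>R T n" for n
  have Tpos: "T n > 0" for n
    using XY(3)[of n] by (smt (verit) T_def P_def norm_minus_commute mult_nonneg_nonneg norm_ge_zero of_nat_0_le_iff)
  have TV: "T n *\<^sub>R V n = supp (Y n) - P n" for n using Tpos[of n] by (simp add: V_def)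
  have "V n \<in> sphere 0 1" for n using Tpos[of n] by (simp add: V_def T_def)
  then obtain v s where v: "v \<in> sphere 0 1" "strict_mono s" "(V \<circ> s) \<longlonglongrightarrow> v"
    using seq_compactE[OF compact_imp_seq_compact[OF compact_sphere[of 0 1]], of V] by metis
  have Xs: "(X \<circ> s) \<longlonglongrightarrow> x" and Ys: "(Y \<circ> s) \<longlonglongrightarrow> x"
    using LIMSEQ_subseq_LIMSEQ[OF lim[OF XY(1)] v(2)] LIMSEQ_subseq_LIMSEQ[OF lim[OF XY(2)] v(2)] by auto
  have Ps: "(P \<circ> s) \<longlonglongrightarrow> supp x" using supp_tendsto[OF Xs x] by (simp add: P_def o_def)
  have Ts: "(T \<circ> s) \<longlonglongrightarrow> 0"
  proof -
    have "(\<lambda>n. norm (supp ((Y \<circ> s) n) - supp ((X \<circ> s) n))) \<longlonglongrightarrow> norm (supp x - supp x)"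
      by (intro tendsto_intros supp_tendsto Xs Ys x)
    then show ?thesis by (simp add: T_def P_def o_def)
  qed
  obtain E where E: "E > 0" "\<And>y z. y \<noteq> 0 \<Longrightarrow> z \<noteq> 0 \<Longrightarrow>
      norm (y /\<^sub>R rho y - z /\<^sub>R rho z) \<le> E / rho y * norm (y - z)" using unit_diff_bound by blast
  define K where "K n = E / rho (Y n) / real (Suc n)" for n
  have Ks: "(K \<circ> s) \<longlonglongrightarrow> 0"
  proof -
    have "(\<lambda>n. inverse (real (Suc (s n)))) \<longlonglongrightarrow> 0"
      using LIMSEQ_subseq_LIMSEQ[OF LIMSEQ_inverse_real_of_nat v(2)] by (simp add: o_def)
    then have "(\<lambda>n. E / rho ((Y \<circ> s) n) * inverse (real (Suc (s n)))) \<longlonglongrightarrow> E / rho x * 0"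
      by (intro tendsto_intros rho_tendsto Ys) (use rho_pos[OF x] in auto)
    then show ?thesis by (simp add: K_def o_def divide_inverse)
  qed
  have breg: "bregman H g (P n) (T n *\<^sub>R V n) = - (g (P n) \<bullet> (supp (Y n) - P n))" for n
    unfolding TV using supp_facts(1)[OF X0] supp_facts(1)[OF Y0] by (simp add: bregman_def P_def)
  have Kb: "bregman H g (P n) (T n *\<^sub>R V n) \<le> K n * (T n)\<^sup>2" for n
  proof -
    have "bregman H g (P n) (T n *\<^sub>R V n) \<le> (g (supp (Y n)) - g (P n)) \<bullet> (supp (Y n) - P n)"
      unfolding breg using supp_inner_le[OF Y0, of n "X n"]
      by (simp add: P_def inner_diff_left inner_diff_right)
    also have "\<dots> \<le> norm (g (supp (Y n)) - g (P n)) * T n" unfolding T_def by (rule norm_cauchy_schwarz)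
    also have "\<dots> \<le> (E / rho (Y n) * norm (Y n - X n)) * T n"
      unfolding P_def using Tpos[of n] E(2)[OF Y0 X0] by (intro mult_right_mono) (auto simp: g_supp X0 Y0)
    also have "\<dots> \<le> (E / rho (Y n) * (T n / real (Suc n))) * T n"
    proof (intro mult_right_mono mult_left_mono)
      show "norm (Y n - X n) \<le> T n / real (Suc n)"
        using XY(3)[of n] by (simp add: T_def P_def norm_minus_commute pos_le_divide_eq mult.commute less_imp_le del: of_nat_Suc)
    qed (use E(1) rho_pos[OF Y0[of n]] Tpos[of n] in auto)
    also have "\<dots> = K n * (T n)\<^sup>2" by (simp add: K_def power2_eq_square)
    finally show ?thesis .
  qed
  obtain S Q where SQ: "second_order_form H g (supp x) S Q" using curved supp_facts(2)[OF x] by blast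
  have "bregman H g ((P \<circ> s) n) ((T \<circ> s) n *\<^sub>R (V \<circ> s) n) \<le> (K \<circ> s) n * ((T \<circ> s) n)\<^sup>2" for n
    using Kb by simp
  from second_order_form_lower[OF SQ Ps Ts _ v(3) Ks this] Tpos
  have "v \<in> S" "Q v v \<le> 0" by auto
  then obtain c where c: "v = c *\<^sub>R supp x" using second_order_form_facts(5)[OF SQ] by blast
  have "(\<lambda>n. g ((P \<circ> s) n) \<bullet> (V \<circ> s) n) \<longlonglongrightarrow> g (supp x) \<bullet> v"
    using g_supp_tendsto[OF Xs x] X0 by (intro tendsto_intros v) (simp add: P_def o_def)
  moreover have "(\<lambda>n. g ((P \<circ> s) n) \<bullet> (V \<circ> s) n) \<longlonglongrightarrow> 0"
  proof (rule Lim_null_comparison)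
    have "(\<lambda>n. (K \<circ> s) n * (T \<circ> s) n) \<longlonglongrightarrow> 0 * 0" by (intro tendsto_intros Ks Ts)
    then show "(\<lambda>n. (K \<circ> s) n * (T \<circ> s) n) \<longlonglongrightarrow> 0" by simp
    have "norm (g (P n) \<bullet> V n) \<le> K n * T n" for n
    proof -
      have e: "g (P n) \<bullet> (supp (Y n) - P n) = T n * (g (P n) \<bullet> V n)" by (simp add: TV[symmetric])
      have "g (P n) \<bullet> V n \<le> 0"
        using supp_inner_le[OF X0, of n "Y n"] Tpos[of n] unfolding P_def[symmetric] e
        by (simp add: mult_le_0_iff)
      moreover have "T n * (- (g (P n) \<bullet> V n)) \<le> T n * (K n * T n)"
        using Kb[of n] unfolding breg e by (simp add: power2_eq_square algebra_simps)
      then have "- (g (P n) \<bullet> V n) \<le> K n * T n" using Tpos[of n] by (rule mult_left_le_imp_le)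
      ultimately show ?thesis by simp
    qed
    then show "\<forall>\<^sub>F n in sequentially. norm (g ((P \<circ> s) n) \<bullet> (V \<circ> s) n) \<le> (K \<circ> s) n * (T \<circ> s) n"
      by simp
  qed
  ultimately have "g (supp x) \<bullet> v = 0" by (rule LIMSEQ_unique)
  then have "c = 0" using c g_inner_self[OF supp_facts(2)[OF x]] supp_facts(1)[OF x] by simp
  then show False using c v(1) by simp
qed

lemma rho_GDERIV: assumes x: "x \<noteq> 0" shows "GDERIV rho x :> supp x"
proof -
  obtain r L where rL: "r > 0" "L > 0"
    "\<And>y z. y \<in> ball x r \<Longrightarrow> z \<in> ball x r \<Longrightarrow> norm (supp y - supp z) \<le> L * norm (y - z)"
    using supp_local_lipschitz[OF x] by blast
  have b: "norm (rho y - rho x - (y - x) \<bullet> supp x) \<le> L * norm (y - x) * norm (y - x)" if "y \<in> ball x r" for y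
  proof -
    have "rho y - rho x - (y - x) \<bullet> supp x \<le> (supp y - supp x) \<bullet> (y - x)"
      using rho_bounds(2)[of y x] by (simp add: inner_diff_left inner_diff_right inner_commute)
    also have "\<dots> \<le> norm (supp y - supp x) * norm (y - x)" by (rule norm_cauchy_schwarz)
    also have "\<dots> \<le> L * norm (y - x) * norm (y - x)" using rL that by (intro mult_right_mono) auto
    finally show ?thesis using rho_bounds(1)[of x y] by (simp add: inner_commute)
  qed
  have "(rho has_derivative (\<lambda>h. h \<bullet> supp x)) (at x)"
    unfolding has_derivative_at_alt
  proof (intro conjI allI impI)
    show "bounded_linear (\<lambda>h. h \<bullet> supp x)" by (rule bounded_linear_inner_left)
    fix e :: real assume e: "e > 0"
    show "\<exists>d>0. \<forall>y. norm (y - x) < d \<longrightarrow> norm (rho y - rho x - (y - x) \<bullet> supp x) \<le> e * norm (y - x)"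
    proof (intro exI[of _ "min r (e / L)"] conjI allI impI)
      show "min r (e / L) > 0" using rL e by simp
      fix y assume "norm (y - x) < min r (e / L)"
      then have y: "y \<in> ball x r" "L * norm (y - x) \<le> e"
        using rL by (auto simp: dist_norm norm_minus_commute field_simps)
      show "norm (rho y - rho x - (y - x) \<bullet> supp x) \<le> e * norm (y - x)"
        using b[OF y(1)] mult_right_mono[OF y(2), of "norm (y - x)"] by simp
    qed
  qed
  then show ?thesis by (simp add: gderiv_def)
qed

text \<open>
  The linear relation that the derivative of the maximizer at \<open>x\<close> satisfies: \<open>v\<close> is tangent to the unit
  sphere at \<open>supp x\<close>, and the curvature form turns it into the tangential part of \<open>w\<close>.
\<close>

definition deriv_rel :: "'a \<Rightarrow> 'a set \<Rightarrow> ('a \<Rightarrow> 'a \<Rightarrow> real) \<Rightarrow> 'a \<Rightarrow> 'a \<Rightarrow> bool" where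
  "deriv_rel x S Q w v \<longleftrightarrow> v \<in> S \<and> g (supp x) \<bullet> v = 0 \<and>
     (\<forall>z\<in>S. (w - (supp x \<bullet> w) *\<^sub>R g (supp x)) \<bullet> z = rho x * Q v z)"

text \<open>
  The limit of difference quotients is identified by comparing the maximizer with the competitors
  \<open>supp x + T n *\<^sub>R z\<close>: the limit minimizes a quadratic functional over \<open>S\<close>.
\<close>

lemma deriv_rel_limit:
  assumes x: "x \<noteq> 0" and SQ: "second_order_form H g (supp x) S Q"
    and T: "T \<longlonglongrightarrow> 0" "\<And>n. 0 < T n" and W: "W \<longlonglongrightarrow> w"
    and nz: "\<And>n. x + T n *\<^sub>R W n \<noteq> 0"
    and V: "(\<lambda>n. (supp (x + T n *\<^sub>R W n) - supp x) /\<^sub>R T n) \<longlonglongrightarrow> v"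
  shows "deriv_rel x S Q w v"
proof -
  define p0 where "p0 = supp x"
  define g0 where "g0 = g p0"
  define X where "X n = x + T n *\<^sub>R W n" for n
  define V' where "V' n = (supp (X n) - p0) /\<^sub>R T n" for n
  have V': "V' \<longlonglongrightarrow> v" using V by (simp add: V'_def[abs_def] X_def p0_def)
  have sX: "supp (X n) = p0 + T n *\<^sub>R V' n" for n using T(2)[of n] by (simp add: V'_def)
  have X: "X \<longlonglongrightarrow> x"
  proof -
    have "(\<lambda>n. x + T n *\<^sub>R W n) \<longlonglongrightarrow> x + 0 *\<^sub>R w" by (intro tendsto_intros T W)
    then show ?thesis by (simp add: X_def[abs_def])
  qed
  have Xnz: "X n \<noteq> 0" for n using nz by (simp add: X_def)
  have H1: "H p0 = 1" "H (p0 + T n *\<^sub>R V' n) = 1" for n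
    using supp_facts(1)[OF x] supp_facts(1)[OF Xnz, of n] by (simp_all add: p0_def sX)
  have r0: "rho x > 0" "rho (X n) > 0" for n using rho_pos x Xnz by auto
  define k where "k = p0 \<bullet> w"
  have kap: "(\<lambda>n. (rho (X n) - rho x) / T n) \<longlonglongrightarrow> k"
  proof (rule tendsto_sandwich)
    show "\<forall>\<^sub>F n in sequentially. p0 \<bullet> W n \<le> (rho (X n) - rho x) / T n"
      using rho_bounds(1)[of x "X _"] T(2) by (simp add: X_def p0_def field_simps)
    show "\<forall>\<^sub>F n in sequentially. (rho (X n) - rho x) / T n \<le> supp (X n) \<bullet> W n"
      using rho_bounds(2)[of "X _" x] T(2) by (simp add: X_def field_simps)
    show "(\<lambda>n. p0 \<bullet> W n) \<longlonglongrightarrow> k" unfolding k_def by (intro tendsto_intros W)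
    show "(\<lambda>n. supp (X n) \<bullet> W n) \<longlonglongrightarrow> k" unfolding k_def p0_def by (intro tendsto_intros W supp_tendsto X x)
  qed
  have x0: "x = rho x *\<^sub>R g0" using supp_facts(3)[OF x] by (simp add: g0_def p0_def)
  define G where "G n = ((rho (X n) - rho x) / T n) *\<^sub>R g0 - W n" for n
  define K where "K z n = bregman H g p0 (T n *\<^sub>R z) / (T n)\<^sup>2 +
      G n \<bullet> (z - V' n) / rho (X n)" for z n
  have Kb: "bregman H g p0 (T n *\<^sub>R V' n) \<le> K z n * (T n)\<^sup>2" for z n
  proof -
    have "X n \<bullet> (p0 + T n *\<^sub>R z) \<le> rho (X n) * H (p0 + T n *\<^sub>R z)" by (rule rho_ineq)
    moreover have "X n \<bullet> (p0 + T n *\<^sub>R V' n) = rho (X n) * H (p0 + T n *\<^sub>R V' n)"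
      using supp_inner[of "X n"] H1(2) by (simp add: sX)
    ultimately have "X n \<bullet> (T n *\<^sub>R (z - V' n)) \<le> rho (X n) * (H (p0 + T n *\<^sub>R z) - H (p0 + T n *\<^sub>R V' n))"
      by (simp add: inner_add_right inner_diff_right algebra_simps)
    also have "H (p0 + T n *\<^sub>R z) - H (p0 + T n *\<^sub>R V' n) =
        bregman H g p0 (T n *\<^sub>R z) - bregman H g p0 (T n *\<^sub>R V' n) + T n * (g0 \<bullet> (z - V' n))"
      by (simp add: bregman_def g0_def inner_diff_right algebra_simps)
    finally have "rho (X n) * bregman H g p0 (T n *\<^sub>R V' n) \<le>
        rho (X n) * bregman H g p0 (T n *\<^sub>R z) + T n * ((rho (X n) *\<^sub>R g0 - X n) \<bullet> (z - V' n))"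
      by (simp add: inner_diff_left algebra_simps)
    also have "rho (X n) *\<^sub>R g0 - X n = (rho (X n) - rho x) *\<^sub>R g0 - T n *\<^sub>R W n"
      by (subst X_def, subst x0) (simp add: algebra_simps X_def)
    also have "\<dots> = T n *\<^sub>R G n"
      using T(2)[of n] by (simp add: G_def scaleR_diff_right)
    finally have "bregman H g p0 (T n *\<^sub>R V' n) \<le> bregman H g p0 (T n *\<^sub>R z) +
        T n * T n * (G n \<bullet> (z - V' n)) / rho (X n)"
      using r0(2)[of n] by (simp add: field_simps)
    also have "\<dots> = K z n * (T n)\<^sup>2"
      using T(2)[of n] by (simp add: K_def field_simps power2_eq_square)
    finally show ?thesis .
  qed
  have Klim: "K z \<longlonglongrightarrow> Q z z / 2 + (k *\<^sub>R g0 - w) \<bullet> (z - v) / rho x" if "z \<in> S" for z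
  proof -
    have 1: "(\<lambda>n. bregman H g p0 (T n *\<^sub>R z) / (T n)\<^sup>2) \<longlonglongrightarrow> Q z z / 2"
      using second_order_form_facts(6)[OF SQ that T] by (simp add: p0_def)
    have 2: "(\<lambda>n. G n \<bullet> (z - V' n) / rho (X n)) \<longlonglongrightarrow> (k *\<^sub>R g0 - w) \<bullet> (z - v) / rho x"
      unfolding G_def using r0(1) by (intro tendsto_intros kap W V' rho_tendsto X) auto
    show ?thesis unfolding K_def[abs_def] by (rule tendsto_add[OF 1 2])
  qed
  have sub: "subspace S" using second_order_form_facts(1)[OF SQ] .
  have main: "v \<in> S \<and> Q v v \<le> Q z z + 2 * ((k *\<^sub>R g0 - w) \<bullet> (z - v) / rho x)" if "z \<in> S" for z
    using second_order_form_lower[OF SQ tendsto_const T V' Klim[OF that]] Kb[of _ z]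
    by (simp add: p0_def)
  have vS: "v \<in> S" using main[OF subspace_0[OF sub]] by blast
  \<comment> \<open>The variation of the minimizer along \<open>z\<close> gives the Euler equation.\<close>
  have ortho: "(w - k *\<^sub>R g0) \<bullet> z = rho x * Q v z" if z: "z \<in> S" for z
  proof -
    define B where "B = 2 * Q v z + 2 * ((k *\<^sub>R g0 - w) \<bullet> z / rho x)"
    have ineq: "0 \<le> s * B + s\<^sup>2 * Q z z" for s :: real
    proof -
      have sz: "s *\<^sub>R z \<in> S" using sub z by (rule subspace_scale)
      have vsz: "v + s *\<^sub>R z \<in> S" using sub vS sz by (rule subspace_add)
      have "Q (v + s *\<^sub>R z) (v + s *\<^sub>R z) = Q v (v + s *\<^sub>R z) + s * Q z (v + s *\<^sub>R z)"
        using second_order_form_facts(3)[OF SQ vS sz vsz] second_order_form_facts(4)[OF SQ z vsz] by simp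
      also have "Q v (v + s *\<^sub>R z) = Q v v + s * Q z v"
        using second_order_form_facts(2)[OF SQ vS vsz] second_order_form_facts(3)[OF SQ vS sz vS]
          second_order_form_facts(4)[OF SQ z vS] by simp
      also have "Q z (v + s *\<^sub>R z) = Q v z + s * Q z z"
        using second_order_form_facts(2)[OF SQ z vsz] second_order_form_facts(3)[OF SQ vS sz z]
          second_order_form_facts(4)[OF SQ z z] by simp
      also have "Q z v = Q v z" using second_order_form_facts(2)[OF SQ z vS] .
      finally have e: "Q (v + s *\<^sub>R z) (v + s *\<^sub>R z) = Q v v + s * Q v z + s * (Q v z + s * Q z z)" .
      show ?thesis using main[OF vsz] unfolding e
        by (simp add: B_def power2_eq_square algebra_simps)
    qed
    have "B = 0"
    proof (rule ccontr)
      assume "B \<noteq> 0"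
      define M where "M = \<bar>Q z z\<bar> + 1"
      have M: "M > 0" "Q z z \<le> M" by (auto simp: M_def)
      define s where "s = - B / (2 * M)"
      have "0 \<le> s * B + s\<^sup>2 * Q z z" by (rule ineq)
      also have "\<dots> \<le> s * B + s\<^sup>2 * M" using M by (intro add_left_mono mult_left_mono) auto
      also have "\<dots> = - (B\<^sup>2) / (4 * M)"
        using M(1) by (simp add: s_def field_simps power2_eq_square)
      also have "\<dots> < 0" using \<open>B \<noteq> 0\<close> M by (intro divide_neg_pos) auto
      finally show False by simp
    qed
    then show ?thesis using r0(1) by (simp add: B_def inner_diff_left field_simps)
  qed
  have "g0 \<bullet> v = 0"
  proof (rule antisym)
    show "g0 \<bullet> v \<le> 0"
    proof (rule LIMSEQ_le_const2)
      show "(\<lambda>n. g0 \<bullet> V' n) \<longlonglongrightarrow> g0 \<bullet> v" by (intro tendsto_intros V')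
      have "g0 \<bullet> V' n \<le> 0" for n
        using supp_inner_le[OF x, of "X n"] T(2)[of n]
        by (simp add: V'_def g0_def p0_def mult_nonneg_nonpos)
      then show "\<exists>N. \<forall>n\<ge>N. g0 \<bullet> V' n \<le> 0" by blast
    qed
    have lim: "(\<lambda>n. - (g0 \<bullet> V' n) - K 0 n * T n) \<longlonglongrightarrow>
        - (g0 \<bullet> v) - (Q 0 0 / 2 + (k *\<^sub>R g0 - w) \<bullet> (0 - v) / rho x) * 0"
      by (intro tendsto_intros V' Klim T subspace_0[OF sub])
    have "- (g0 \<bullet> V' n) \<le> K 0 n * T n" for n
    proof -
      have "T n * - (g0 \<bullet> V' n) \<le> T n * (K 0 n * T n)"
        using Kb[of n 0] H1 by (simp add: bregman_def g0_def power2_eq_square mult.commute mult.left_commute)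
      then show ?thesis using T(2)[of n] by (rule mult_left_le_imp_le)
    qed
    then have "- (g0 \<bullet> v) - (Q 0 0 / 2 + (k *\<^sub>R g0 - w) \<bullet> (0 - v) / rho x) * 0 \<le> 0"
      by (intro LIMSEQ_le_const2[OF lim]) auto
    then show "0 \<le> g0 \<bullet> v" by simp
  qed
  then show ?thesis using vS ortho by (simp add: deriv_rel_def g0_def p0_def k_def)
qed

lemma deriv_rel_unique:
  assumes x: "x \<noteq> 0" and SQ: "second_order_form H g (supp x) S Q"
    and v: "deriv_rel x S Q w v" "deriv_rel x S Q w v'"
  shows "v = v'"
proof -
  have sub: "subspace S" using second_order_form_facts(1)[OF SQ] .
  have S: "v \<in> S" "v' \<in> S" "- v' \<in> S" using v sub by (auto simp: deriv_rel_def subspace_neg)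
  define d where "d = v + (-1) *\<^sub>R v'"
  have d: "d \<in> S" unfolding d_def by (intro subspace_add[OF sub] subspace_scale[OF sub] S)
  have "rho x * Q v d = rho x * Q v' d" using v d by (metis deriv_rel_def)
  then have "Q v d = Q v' d" using rho_pos[OF x] by simp
  moreover have "Q d d = Q v d + (-1) * Q v' d"
    using second_order_form_facts(3)[OF SQ S(1) subspace_scale[OF sub S(2), of "-1"] d]
      second_order_form_facts(4)[OF SQ S(2) d, of "-1"] unfolding d_def[symmetric] by simp
  ultimately have "Q d d \<le> 0" by simp
  then obtain c where c: "d = c *\<^sub>R supp x" using second_order_form_facts(5)[OF SQ d] by blast
  have "g (supp x) \<bullet> d = 0" using v by (simp add: d_def deriv_rel_def inner_diff_right)
  then have "c = 0" using c g_inner_self[OF supp_facts(2)[OF x]] supp_facts(1)[OF x] by simp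
  then show ?thesis using c by (simp add: d_def)
qed

lemma deriv_rel_linear:
  assumes SQ: "second_order_form H g (supp x) S Q"
    and v: "deriv_rel x S Q w v" "deriv_rel x S Q w' v'"
  shows "deriv_rel x S Q (a *\<^sub>R w + b *\<^sub>R w') (a *\<^sub>R v + b *\<^sub>R v')"
proof -
  have sub: "subspace S" using second_order_form_facts(1)[OF SQ] .
  have S: "v \<in> S" "v' \<in> S" using v by (auto simp: deriv_rel_def)
  have S2: "a *\<^sub>R v \<in> S" "b *\<^sub>R v' \<in> S" using S sub by (auto intro: subspace_scale)
  have Q: "Q (a *\<^sub>R v + b *\<^sub>R v') z = a * Q v z + b * Q v' z" if "z \<in> S" for z
    using second_order_form_facts(3)[OF SQ S2 that] second_order_form_facts(4)[OF SQ S(1) that]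
      second_order_form_facts(4)[OF SQ S(2) that] by simp
  have z: "(w - (supp x \<bullet> w) *\<^sub>R g (supp x)) \<bullet> z = rho x * Q v z"
      "(w' - (supp x \<bullet> w') *\<^sub>R g (supp x)) \<bullet> z = rho x * Q v' z" if "z \<in> S" for z
    using v that by (auto simp: deriv_rel_def)
  have "(a *\<^sub>R w + b *\<^sub>R w' - (supp x \<bullet> (a *\<^sub>R w + b *\<^sub>R w')) *\<^sub>R g (supp x)) \<bullet> z
      = a * ((w - (supp x \<bullet> w) *\<^sub>R g (supp x)) \<bullet> z) + b * ((w' - (supp x \<bullet> w') *\<^sub>R g (supp x)) \<bullet> z)" for z
    by (simp add: inner_add_left inner_add_right inner_diff_left algebra_simps)
  then show ?thesis using v subspace_add[OF sub S2] z
    by (simp add: deriv_rel_def inner_add_right Q algebra_simps)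
qed

text \<open>Difference quotients of the maximizer stay in a compact set, so they have a limit.\<close>

lemma quotient_subsequence:
  assumes x: "x \<noteq> 0" and SQ: "second_order_form H g (supp x) S Q"
    and T: "T \<longlonglongrightarrow> 0" "\<And>n. 0 < T n" and W: "W \<longlonglongrightarrow> w"
  shows "\<exists>(s :: nat \<Rightarrow> nat) v. strict_mono s \<and> deriv_rel x S Q w v \<and>
    (\<lambda>n. (supp (x + T (s n) *\<^sub>R W (s n)) - supp x) /\<^sub>R T (s n)) \<longlonglongrightarrow> v"
proof -
  obtain r L where rL: "r > 0" "L > 0"
    "\<And>y z. y \<in> ball x r \<Longrightarrow> z \<in> ball x r \<Longrightarrow> norm (supp y - supp z) \<le> L * norm (y - z)"
    using supp_local_lipschitz[OF x] by blast
  have X: "(\<lambda>n. x + T n *\<^sub>R W n) \<longlonglongrightarrow> x"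
  proof -
    have "(\<lambda>n. x + T n *\<^sub>R W n) \<longlonglongrightarrow> x + 0 *\<^sub>R w" by (intro tendsto_intros T W)
    then show ?thesis by simp
  qed
  have "\<forall>\<^sub>F n in sequentially. x + T n *\<^sub>R W n \<in> ball x (min r (norm x))"
    using topological_tendstoD[OF X open_ball, of x "min r (norm x)"] rL x by simp
  then obtain N where N: "\<And>n. n \<ge> N \<Longrightarrow> x + T n *\<^sub>R W n \<in> ball x (min r (norm x))"
    unfolding eventually_sequentially by blast
  have nz: "x + T n *\<^sub>R W n \<noteq> 0" if "n \<ge> N" for n
  proof
    assume "x + T n *\<^sub>R W n = 0"
    then show False using N[OF that] by (simp add: dist_norm)
  qed
  obtain D where D: "\<And>n. norm (W n) \<le> D"
    using convergent_imp_Bseq[of W] W unfolding Bseq_def convergent_def by blast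
  define V where "V n = (supp (x + T (n + N) *\<^sub>R W (n + N)) - supp x) /\<^sub>R T (n + N)" for n
  have "V n \<in> cball 0 (L * D)" for n
  proof -
    have "norm (supp (x + T (n + N) *\<^sub>R W (n + N)) - supp x) \<le> L * norm (x + T (n + N) *\<^sub>R W (n + N) - x)"
      using N[of "n + N"] rL by (intro rL(3)) auto
    also have "\<dots> = T (n + N) * (L * norm (W (n + N)))" using T(2)[of "n + N"] by simp
    also have "\<dots> \<le> T (n + N) * (L * D)" using T(2)[of "n + N"] rL D[of "n + N"]
      by (intro mult_left_mono) (auto intro: less_imp_le)
    finally have "norm (supp (x + T (n + N) *\<^sub>R W (n + N)) - supp x) \<le> T (n + N) * (L * D)" .
    then have "norm (supp (x + T (n + N) *\<^sub>R W (n + N)) - supp x) / T (n + N) \<le> L * D"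
      using T(2)[of "n + N"] by (simp only: pos_divide_le_eq mult.commute)
    moreover have "norm (V n) = norm (supp (x + T (n + N) *\<^sub>R W (n + N)) - supp x) / T (n + N)"
      using T(2)[of "n + N"] by (simp add: V_def divide_inverse mult.commute)
    ultimately show ?thesis by simp
  qed
  then obtain v s where v: "strict_mono s" "(V \<circ> s) \<longlonglongrightarrow> v"
    using seq_compactE[OF compact_imp_seq_compact[OF compact_cball[of 0 "L * D"]], of V] by metis
  define s' where "s' n = s n + N" for n
  have s': "strict_mono s'" using v(1) by (simp add: s'_def strict_mono_def)
  have lim: "(\<lambda>n. (supp (x + (T \<circ> s') n *\<^sub>R (W \<circ> s') n) - supp x) /\<^sub>R (T \<circ> s') n) \<longlonglongrightarrow> v"
    using v(2) by (simp add: V_def[abs_def] s'_def o_def)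
  have "deriv_rel x S Q w v"
  proof (rule deriv_rel_limit[OF x SQ _ _ _ _ lim])
    show "(T \<circ> s') \<longlonglongrightarrow> 0" "(W \<circ> s') \<longlonglongrightarrow> w" using LIMSEQ_subseq_LIMSEQ[OF _ s'] T W by blast+
    show "0 < (T \<circ> s') n" "x + (T \<circ> s') n *\<^sub>R (W \<circ> s') n \<noteq> 0" for n
      using T(2) nz[of "s' n"] by (auto simp: s'_def)
  qed
  then show ?thesis using s' lim by (intro exI[of _ s'] exI[of _ v]) (simp add: o_def)
qed

text \<open>
  The derivative is symmetric because \<open>Q\<close> is.
\<close>

theorem supp_has_derivative:
  assumes x: "x \<noteq> 0"
  shows "\<exists>L. (supp has_derivative L) (at x) \<and> (\<forall>w w'. L w \<bullet> w' = w \<bullet> L w')"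
proof -
  obtain S Q where SQ: "second_order_form H g (supp x) S Q" using curved supp_facts(2)[OF x] by blast
  have ex: "\<exists>v. deriv_rel x S Q w v" for w
    using quotient_subsequence[OF x SQ LIMSEQ_inverse_real_of_nat _ tendsto_const[of w]] by auto
  define L where "L w = (SOME v. deriv_rel x S Q w v)" for w
  have L: "deriv_rel x S Q w (L w)" for w unfolding L_def using ex by (rule someI_ex)
  have Leq: "L w = v" if "deriv_rel x S Q w v" for w v using deriv_rel_unique[OF x SQ L that] .
  have lin: "linear L"
  proof (rule linearI)
    show "L (a + b) = L a + L b" for a b
      using Leq[OF deriv_rel_linear[OF SQ L L, of 1 a 1 b]] by simp
    show "L (c *\<^sub>R a) = c *\<^sub>R L a" for c a
      using Leq[OF deriv_rel_linear[OF SQ L L, of c a 0 0]] by simp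
  qed
  have sym: "L w \<bullet> w' = w \<bullet> L w'" for w w'
  proof -
    have S: "L w \<in> S" "L w' \<in> S" using L by (auto simp: deriv_rel_def)
    have t: "g (supp x) \<bullet> L w = 0" for w using L by (auto simp: deriv_rel_def)
    have "w \<bullet> L w' = (w - (supp x \<bullet> w) *\<^sub>R g (supp x)) \<bullet> L w'" by (simp add: inner_diff_left t)
    also have "\<dots> = rho x * Q (L w) (L w')" using L[of w] S by (auto simp: deriv_rel_def)
    also have "\<dots> = rho x * Q (L w') (L w)" using second_order_form_facts(2)[OF SQ S] by simp
    also have "\<dots> = (w' - (supp x \<bullet> w') *\<^sub>R g (supp x)) \<bullet> L w" using L[of w'] S by (auto simp: deriv_rel_def)
    also have "\<dots> = w' \<bullet> L w" by (simp add: inner_diff_left t)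
    finally show ?thesis by (simp add: inner_commute)
  qed
  have "(supp has_derivative L) (at x)"
    unfolding has_derivative_iff_norm
  proof (intro conjI)
    show "bounded_linear L" using lin linear_conv_bounded_linear by blast
    show "((\<lambda>y. norm (supp y - supp x - L (y - x)) / norm (y - x)) \<longlongrightarrow> 0) (at x)"
      unfolding tendsto_at_iff_sequentially
    proof (intro allI impI)
      fix X assume Xi: "\<forall>i. X i \<in> UNIV - {x}" and Xl: "X \<longlonglongrightarrow> x"
      define T where "T n = norm (X n - x)" for n
      define W where "W n = (X n - x) /\<^sub>R T n" for n
      have Tp: "T n > 0" for n using Xi by (simp add: T_def)
      have XT: "X n = x + T n *\<^sub>R W n" for n using Tp[of n] by (simp add: W_def)
      have T0: "T \<longlonglongrightarrow> 0" unfolding T_def[abs_def] using Xl by (simp add: LIM_zero tendsto_norm_zero)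
      have Ws: "W n \<in> sphere 0 1" for n using Tp[of n] by (simp add: W_def T_def)
      show "((\<lambda>y. norm (supp y - supp x - L (y - x)) / norm (y - x)) \<circ> X) \<longlonglongrightarrow> 0"
      proof (rule tendsto_by_subsequences)
        fix r :: "nat \<Rightarrow> nat" assume r: "strict_mono r"
        have "\<forall>n. (W \<circ> r) n \<in> sphere 0 1" using Ws by simp
        then obtain w s where w: "strict_mono s" "((W \<circ> r) \<circ> s) \<longlonglongrightarrow> w"
          using seq_compactE[OF compact_imp_seq_compact[OF compact_sphere[of 0 1]], of "W \<circ> r"] by metis
        define T' where "T' = T \<circ> (r \<circ> s)"
        define W' where "W' = W \<circ> (r \<circ> s)"
        have T': "T' \<longlonglongrightarrow> 0" "\<And>n. 0 < T' n" unfolding T'_def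
          using LIMSEQ_subseq_LIMSEQ[OF T0 strict_mono_o[OF r w(1)]] Tp by auto
        have W': "W' \<longlonglongrightarrow> w" using w(2) by (simp add: W'_def o_assoc)
        obtain s' v where s': "strict_mono s'" "deriv_rel x S Q w v"
          "(\<lambda>n. (supp (x + T' (s' n) *\<^sub>R W' (s' n)) - supp x) /\<^sub>R T' (s' n)) \<longlonglongrightarrow> v"
          using quotient_subsequence[OF x SQ T' W'] by blast
        have v: "v = L w" using Leq[OF s'(2)] by simp
        have "(\<lambda>n. L (W' (s' n))) \<longlonglongrightarrow> L w"
          using bounded_linear.tendsto[OF lin[unfolded linear_conv_bounded_linear]
              LIMSEQ_subseq_LIMSEQ[OF W' s'(1)]] by (simp add: o_def)
        then have "(\<lambda>n. norm ((supp (x + T' (s' n) *\<^sub>R W' (s' n)) - supp x) /\<^sub>R T' (s' n) - L (W' (s' n)))) \<longlonglongrightarrow> norm (v - L w)"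
          using s'(3) by (intro tendsto_intros)
        moreover have "norm ((supp (x + T' n *\<^sub>R W' n) - supp x) /\<^sub>R T' n - L (W' n)) =
            norm (supp (X ((r \<circ> s) n)) - supp x - L (X ((r \<circ> s) n) - x)) / norm (X ((r \<circ> s) n) - x)" for n
        proof -
          have e: "X ((r \<circ> s) n) = x + T' n *\<^sub>R W' n" using XT by (simp add: T'_def W'_def)
          have nt: "norm (X ((r \<circ> s) n) - x) = T' n" by (simp add: T'_def T_def)
          have l: "L (X ((r \<circ> s) n) - x) = T' n *\<^sub>R L (W' n)" unfolding e using linear_scale[OF lin] by simp
          have "(supp (x + T' n *\<^sub>R W' n) - supp x) /\<^sub>R T' n - L (W' n)
              = (supp (x + T' n *\<^sub>R W' n) - supp x - T' n *\<^sub>R L (W' n)) /\<^sub>R T' n"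
            using T'(2)[of n] by (simp add: scaleR_diff_right)
          then show ?thesis unfolding l nt unfolding e using T'(2)[of n] by (simp add: divide_inverse mult.commute)
        qed
        ultimately have "(\<lambda>n. ((\<lambda>y. norm (supp y - supp x - L (y - x)) / norm (y - x)) \<circ> X) (r ((s \<circ> s') n))) \<longlonglongrightarrow> 0"
          by (simp add: v o_def)
        then show "\<exists>s. strict_mono s \<and> (\<lambda>n. ((\<lambda>y. norm (supp y - supp x - L (y - x)) / norm (y - x)) \<circ> X) (r (s n))) \<longlonglongrightarrow> 0"
          using strict_mono_o[OF w(1) s'(1)] by blast
      qed
    qed
  qed
  then show ?thesis using sym by blast
qed

end

section \<open>Caratheodory motions and subdifferentials\<close>

lemma lipschitz_derivative_bound:
  fixes f :: "'a::real_normed_vector \<Rightarrow> 'b::real_normed_vector"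
  assumes der: "(f has_derivative D) (at y)" and r: "0 < r"
    and lip: "\<And>z. z \<in> ball y r \<Longrightarrow> norm (f z - f y) \<le> L * norm (z - y)"
  shows "norm (D h) \<le> L * norm h"
proof (cases "h = 0")
  case True
  then show ?thesis using linear_0[OF has_derivative_linear[OF der]] by simp
next
  case h: False
  have "norm (D h) \<le> L * norm h + e * norm h" if e: "e > 0" for e
  proof -
    obtain d where d: "d > 0" "\<And>z. norm (z - y) < d \<Longrightarrow> norm (f z - f y - D (z - y)) \<le> e * norm (z - y)"
      using der e unfolding has_derivative_at_alt by blast
    define s where "s = min d r / (2 * norm h)"
    have s: "s > 0" "s * norm h < d" "s * norm h < r" using d r h by (auto simp: s_def field_simps)
    have n: "norm (y + s *\<^sub>R h - y) = s * norm h" using s by simp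
    have D: "D (s *\<^sub>R h) = s *\<^sub>R D h" using linear_scale[OF has_derivative_linear[OF der]] .
    have "norm (f (y + s *\<^sub>R h) - f y - D (s *\<^sub>R h)) \<le> e * (s * norm h)" using d(2)[of "y + s *\<^sub>R h"] s n by simp
    moreover have "norm (f (y + s *\<^sub>R h) - f y) \<le> L * (s * norm h)"
      using lip[of "y + s *\<^sub>R h"] s n by (simp add: dist_norm)
    moreover have "norm (D (s *\<^sub>R h)) \<le> norm (f (y + s *\<^sub>R h) - f y) + norm (f (y + s *\<^sub>R h) - f y - D (s *\<^sub>R h))"
      using norm_triangle_sub[of "D (s *\<^sub>R h)" "f (y + s *\<^sub>R h) - f y"] by (simp add: norm_minus_commute)
    ultimately have "s * norm (D h) \<le> s * (L * norm h + e * norm h)"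
      using s by (simp add: D algebra_simps)
    then show ?thesis using s(1) by (rule mult_left_le_imp_le)
  qed
  then have "norm (D h) \<le> L * norm h + e" if "e > 0" for e
    using that h by (metis divide_pos_pos nonzero_eq_divide_eq norm_eq_zero zero_less_norm_iff)
  then show ?thesis by (rule field_le_epsilon)
qed

text \<open>
  The chain rule for Caratheodory motions. Henstock's lemma compares the increments of the motion with
  the velocity at the tags, so pointwise differentiability of \<open>f\<close> suffices.
\<close>

lemma moves_with_velocity_chain:
  fixes x :: "real \<Rightarrow> 'a::euclidean_space" and f :: "'a \<Rightarrow> 'b::euclidean_space"
  assumes I: "is_interval I" and mv: "moves_with_velocity I x v"
    and bnd: "\<And>a b. a \<in> I \<Longrightarrow> b \<in> I \<Longrightarrow> a \<le> b \<Longrightarrow> \<exists>C. \<forall>t\<in>{a..b}. norm (v t) \<le> C"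
    and der: "\<And>t. t \<in> I \<Longrightarrow> (f has_derivative D (x t)) (at (x t))"
    and Dbnd: "\<And>a b. a \<in> I \<Longrightarrow> b \<in> I \<Longrightarrow> a \<le> b \<Longrightarrow> \<exists>L. \<forall>t\<in>{a..b}. \<forall>h. norm (D (x t) h) \<le> L * norm h"
  shows "moves_with_velocity I (\<lambda>t. f (x t)) (\<lambda>t. D (x t) (v t))"
  unfolding moves_with_velocity_def
proof (intro ballI impI)
  fix a b assume ab: "a \<in> I" "b \<in> I" "a \<le> b"
  have sub: "t \<in> I" if "t \<in> {a..b}" for t
    using I ab that unfolding is_interval_1 by (metis atLeastAtMost_iff)
  obtain C0 where C0: "\<And>t. t \<in> {a..b} \<Longrightarrow> norm (v t) \<le> C0" using bnd[OF ab] by blast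
  obtain L0 where L0: "\<And>t h. t \<in> {a..b} \<Longrightarrow> norm (D (x t) h) \<le> L0 * norm h" using Dbnd[OF ab] by blast
  define C where "C = max C0 1"
  define L where "L = max L0 1"
  have C: "C > 0" "\<And>t. t \<in> {a..b} \<Longrightarrow> norm (v t) \<le> C" using C0 by (fastforce simp: C_def)+
  have L: "L > 0" "\<And>t h. t \<in> {a..b} \<Longrightarrow> norm (D (x t) h) \<le> L * norm h"
  proof -
    show "L > 0" by (simp add: L_def)
    fix t h assume "t \<in> {a..b}"
    then have "norm (D (x t) h) \<le> L0 * norm h" by (rule L0)
    also have "\<dots> \<le> L * norm h" by (intro mult_right_mono) (auto simp: L_def)
    finally show "norm (D (x t) h) \<le> L * norm h" .
  qed
  have int: "v integrable_on {s..t}" "integral {s..t} v = x t - x s" if "s \<in> {a..b}" "t \<in> {a..b}" "s \<le> t" for s t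
    using mv[unfolded moves_with_velocity_def] sub[OF that(1)] sub[OF that(2)] that(3)
      set_lebesgue_integral_eq_integral(1)[of "{s..t}" v] by auto
  have lip: "norm (x t - x s) \<le> C * \<bar>t - s\<bar>" if st: "s \<in> {a..b}" "t \<in> {a..b}" for s t
  proof -
    have *: "norm (x t - x s) \<le> C * (t - s)" if st: "s \<in> {a..b}" "t \<in> {a..b}" "s \<le> t" for s t
    proof -
      have "(v has_integral (x t - x s)) (cbox s t)"
        using int[OF st] by (simp add: has_integral_iff)
      then have "norm (x t - x s) \<le> C * measure lborel (cbox s t)"
        by (rule has_integral_bound[rotated]) (use C st in auto)
      then show ?thesis using st by simp
    qed
    show ?thesis
    proof (cases "s \<le> t")
      case False
      then show ?thesis using *[OF st(2,1)] by (simp add: norm_minus_commute)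
    qed (use *[OF st] in simp)
  qed
  have main: "((\<lambda>t. D (x t) (v t)) has_integral (f (x b) - f (x a))) {a..b}"
  proof (cases "a = b")
    case True
    then show ?thesis by (simp add: has_integral_refl)
  next
    case False
    then have ltab: "a < b" using ab by simp
    show ?thesis
      unfolding has_integral_factor_content_real
    proof (intro allI impI)
      fix e :: real assume e: "e > 0"
      define e1 where "e1 = e / (2 * C)"
      define e2 where "e2 = e * (b - a) / (2 * L)"
      have e12: "e1 > 0" "e2 > 0" using e C L ltab by (auto simp: e1_def e2_def)
      have vint: "v integrable_on cbox a b" using int(1)[of a b] ab by simp
      obtain \<gamma> where \<gamma>: "gauge \<gamma>"
        "\<And>p. \<lbrakk>p tagged_partial_division_of (cbox a b); \<gamma> fine p\<rbrakk> \<Longrightarrow> sum (\<lambda>(x,k). norm(measure lborel k *\<^sub>R v x - integral k v)) p < e2"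
        by (rule Henstock_lemma[OF vint e12(2)]) blast
      have "\<exists>d>0. \<forall>s\<in>{a..b}. \<bar>s - t\<bar> < d \<longrightarrow> norm (f (x s) - f (x t) - D (x t) (x s - x t)) \<le> e1 * (C * \<bar>s - t\<bar>)"
        if t: "t \<in> {a..b}" for t
      proof -
        obtain d where d: "d > 0" "\<And>z. norm (z - x t) < d \<Longrightarrow> norm (f z - f (x t) - D (x t) (z - x t)) \<le> e1 * norm (z - x t)"
          using der[OF sub[OF t]] e12(1) unfolding has_derivative_at_alt by blast
        show ?thesis
        proof (intro exI[of _ "d / C"] conjI ballI impI)
          show "d / C > 0" using d C by simp
          fix s assume s: "s \<in> {a..b}" "\<bar>s - t\<bar> < d / C"
          have l: "norm (x s - x t) \<le> C * \<bar>s - t\<bar>" by (rule lip[OF t s(1)])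
          also have "\<dots> < d" using s(2) C by (simp add: field_simps)
          finally have "norm (f (x s) - f (x t) - D (x t) (x s - x t)) \<le> e1 * norm (x s - x t)" by (rule d(2))
          also have "\<dots> \<le> e1 * (C * \<bar>s - t\<bar>)" using l e12 by (intro mult_left_mono) auto
          finally show "norm (f (x s) - f (x t) - D (x t) (x s - x t)) \<le> e1 * (C * \<bar>s - t\<bar>)" .
        qed
      qed
      then have "\<forall>t. \<exists>d>0. t \<in> {a..b} \<longrightarrow> (\<forall>s\<in>{a..b}. \<bar>s - t\<bar> < d \<longrightarrow> norm (f (x s) - f (x t) - D (x t) (x s - x t)) \<le> e1 * (C * \<bar>s - t\<bar>))"
        by (metis zero_less_one)
      then obtain d where d: "\<And>t. 0 < d t"
        "\<And>t s. t \<in> {a..b} \<Longrightarrow> s \<in> {a..b} \<Longrightarrow> \<bar>s - t\<bar> < d t \<Longrightarrow> norm (f (x s) - f (x t) - D (x t) (x s - x t)) \<le> e1 * (C * \<bar>s - t\<bar>)"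
        by metis
      show "\<exists>\<gamma>. gauge \<gamma> \<and> (\<forall>p. p tagged_division_of {a..b} \<and> \<gamma> fine p \<longrightarrow>
          norm ((\<Sum>(t, k)\<in>p. measure lborel k *\<^sub>R D (x t) (v t)) - (f (x b) - f (x a))) \<le> e * measure lborel {a..b})"
      proof (intro exI[of _ "\<lambda>t. \<gamma> t \<inter> ball t (d t)"] conjI allI impI)
        show "gauge (\<lambda>t. \<gamma> t \<inter> ball t (d t))"
          using \<gamma>(1) gauge_ball_dependent[of d] d(1) by (intro gauge_Int) auto
        fix p assume p: "p tagged_division_of {a..b} \<and> (\<lambda>t. \<gamma> t \<inter> ball t (d t)) fine p"
        then have ptag: "p tagged_division_of {a..b}" and fine1: "\<gamma> fine p" and fine2: "(\<lambda>t. ball t (d t)) fine p"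
          by (auto simp: fine_Int)
        have fin: "finite p" using ptag by blast
        have hen: "sum (\<lambda>(t,k). norm (measure lborel k *\<^sub>R v t - integral k v)) p < e2"
          using \<gamma>(2)[OF _ fine1] ptag by (simp add: tagged_division_of_def)
        have tele: "f (x b) - f (x a) = (\<Sum>(t,k)\<in>p. f (x (Sup k)) - f (x (Inf k)))" "b - a = (\<Sum>(t,k)\<in>p. Sup k - Inf k)"
          using additive_tagged_division_1[OF ab(3) ptag, of "\<lambda>t. f (x t)"]
            additive_tagged_division_1[OF ab(3) ptag, of "\<lambda>t. t"] by auto
        have piece: "norm (measure lborel k *\<^sub>R D (x t) (v t) - (f (x (Sup k)) - f (x (Inf k))))
           \<le> L * norm (measure lborel k *\<^sub>R v t - integral k v) + e1 * C * (Sup k - Inf k)" if tk: "(t, k) \<in> p" for t k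
        proof -
          obtain u w where k: "k = cbox u w" "t \<in> k" "k \<subseteq> {a..b}"
            using tagged_division_ofD(2,3,4)[OF ptag tk] by blast
          have uw: "u \<le> t" "t \<le> w" "Sup k = w" "Inf k = u" "measure lborel k = w - u"
            using k by auto
          have uwab: "u \<in> {a..b}" "w \<in> {a..b}" "t \<in> {a..b}" using k uw by auto
          have ball: "\<bar>u - t\<bar> < d t" "\<bar>w - t\<bar> < d t"
          proof -
            have "u \<in> k" "w \<in> k" using k uw by auto
            then have "u \<in> ball t (d t)" "w \<in> ball t (d t)" using fineD[OF fine2 tk] by blast+
            then show "\<bar>u - t\<bar> < d t" "\<bar>w - t\<bar> < d t" by (auto simp: dist_real_def abs_minus_commute)
          qed
          have lin: "linear (D (x t))" using has_derivative_linear[OF der[OF sub[OF uwab(3)]]] .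
          define \<alpha> where "\<alpha> = f (x w) - f (x t) - D (x t) (x w - x t)"
          define \<beta> where "\<beta> = f (x u) - f (x t) - D (x t) (x u - x t)"
          have al: "norm \<alpha> \<le> e1 * (C * (w - t))" unfolding \<alpha>_def using d(2)[OF uwab(3) uwab(2) ball(2)] uw by simp
          have be: "norm \<beta> \<le> e1 * (C * (t - u))" unfolding \<beta>_def using d(2)[OF uwab(3) uwab(1) ball(1)] uw by simp
          have ik: "integral k v = x w - x u" using int(2)[OF uwab(1,2)] uw k by simp
          have "measure lborel k *\<^sub>R D (x t) (v t) - (f (x w) - f (x u)) = D (x t) (measure lborel k *\<^sub>R v t - integral k v) - \<alpha> + \<beta>"
            unfolding ik \<alpha>_def \<beta>_def by (simp add: linear_diff[OF lin] linear_add[OF lin] linear_scale[OF lin] algebra_simps)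
          also have "norm \<dots> \<le> norm (D (x t) (measure lborel k *\<^sub>R v t - integral k v)) + norm \<alpha> + norm \<beta>"
            by (meson norm_triangle_ineq norm_triangle_ineq4 add_right_mono order_trans)
          also have "\<dots> \<le> L * norm (measure lborel k *\<^sub>R v t - integral k v) + e1 * (C * (w - t)) + e1 * (C * (t - u))"
            by (intro add_mono al be L(2) uwab)
          also have "\<dots> = L * norm (measure lborel k *\<^sub>R v t - integral k v) + e1 * C * (w - u)"
            by (simp add: algebra_simps)
          finally show ?thesis unfolding uw(3,4) .
        qed
        have "norm ((\<Sum>(t, k)\<in>p. measure lborel k *\<^sub>R D (x t) (v t)) - (f (x b) - f (x a)))
           = norm (\<Sum>(t, k)\<in>p. measure lborel k *\<^sub>R D (x t) (v t) - (f (x (Sup k)) - f (x (Inf k))))"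
          unfolding tele(1) by (simp add: sum_subtractf split_beta')
        also have "\<dots> \<le> (\<Sum>(t, k)\<in>p. L * norm (measure lborel k *\<^sub>R v t - integral k v) + e1 * C * (Sup k - Inf k))"
          by (rule sum_norm_le) (use piece in auto)
        also have "\<dots> = L * (\<Sum>(t, k)\<in>p. norm (measure lborel k *\<^sub>R v t - integral k v)) + e1 * C * (b - a)"
          unfolding tele(2) by (simp add: sum.distrib sum_distrib_left split_beta')
        also have "\<dots> \<le> L * e2 + e1 * C * (b - a)" using hen L by (intro add_right_mono mult_left_mono) auto
        also have "\<dots> = e * (b - a)" using L(1) C(1) by (simp add: e1_def e2_def field_simps)
        finally show "norm ((\<Sum>(t, k)\<in>p. measure lborel k *\<^sub>R D (x t) (v t)) - (f (x b) - f (x a))) \<le> e * measure lborel {a..b}"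
          using ab by simp
      qed
    qed
  qed
  have "(\<lambda>t. D (x t) (v t)) absolutely_integrable_on {a..b}"
  proof (rule absolutely_integrable_integrable_bound)
    show "norm (D (x t) (v t)) \<le> L * C" if "t \<in> {a..b}" for t
      using L(2)[OF that, of "v t"] mult_left_mono[OF C(2)[OF that], of L] L(1) by linarith
    show "(\<lambda>t. D (x t) (v t)) integrable_on {a..b}" using main by blast
    show "(\<lambda>t. L * C) integrable_on {a..b}" by (rule integrable_const_ivl)
  qed
  then show "(\<lambda>t. D (x t) (v t)) absolutely_integrable_on {a..b} \<and>
      integral {a..b} (\<lambda>t. D (x t) (v t)) = f (x b) - f (x a)"
    using main by (simp add: integral_unique)
qed

lemma moves_with_velocity_continuous:
  fixes x :: "real \<Rightarrow> 'a::euclidean_space"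
  assumes mv: "moves_with_velocity I x v" and ab: "a \<in> I" "b \<in> I" "a \<le> b" and sub: "{a..b} \<subseteq> I"
  shows "continuous_on {a..b} x"
proof -
  have int: "v integrable_on {a..b}" and eq: "\<And>t. t \<in> {a..b} \<Longrightarrow> x t = x a + integral {a..t} v"
    using mv[unfolded moves_with_velocity_def] ab sub set_lebesgue_integral_eq_integral(1)[of "{a..b}" v] by auto
  have "continuous_on {a..b} (\<lambda>t. x a + integral {a..t} v)"
    by (intro continuous_intros indefinite_integral_continuous_1 int)
  then show ?thesis by (rule continuous_on_eq) (rule eq[symmetric])
qed

lemma moves_with_velocity_cong:
  assumes "moves_with_velocity I x v" "is_interval I"
    and "\<And>t. t \<in> I \<Longrightarrow> x t = x' t" "\<And>t. t \<in> I \<Longrightarrow> v t = v' t"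
  shows "moves_with_velocity I x' v'"
  unfolding moves_with_velocity_def
proof (intro ballI impI)
  fix a b assume ab: "a \<in> I" "b \<in> I" "a \<le> b"
  have sub: "t \<in> I" if "t \<in> {a..b}" for t
    using assms(2) ab that unfolding is_interval_1 by (metis atLeastAtMost_iff)
  have "v absolutely_integrable_on {a..b} \<and> integral {a..b} v = x b - x a"
    using assms(1) ab by (simp add: moves_with_velocity_def)
  moreover have "v absolutely_integrable_on {a..b} \<longleftrightarrow> v' absolutely_integrable_on {a..b}"
    by (rule set_integrable_cong) (use assms(4) sub in auto)
  moreover have "integral {a..b} v = integral {a..b} v'"
    by (rule Henstock_Kurzweil_Integration.integral_cong) (use assms(4) sub in auto)
  ultimately show "v' absolutely_integrable_on {a..b} \<and> integral {a..b} v' = x' b - x' a"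
    using assms(3)[OF ab(1)] assms(3)[OF ab(2)] by simp
qed

lemma GDERIV_unique:
  assumes "GDERIV f x :> a" "GDERIV f x :> b" shows "a = b"
proof -
  have "(\<lambda>h. h \<bullet> a) = (\<lambda>h. h \<bullet> b)"
    using assms unfolding gderiv_def by (rule has_derivative_unique)
  then have "(a - b) \<bullet> a = (a - b) \<bullet> b" by metis
  then have "(a - b) \<bullet> (a - b) = 0" by (simp add: inner_diff_right)
  then show ?thesis by simp
qed

lemma gradient_eq: "GDERIV f x :> a \<Longrightarrow> gradient f x = a"
  unfolding gradient_def by (rule the_equality) (auto intro: GDERIV_unique)

lemma GDERIV_eventually:
  assumes "GDERIV f x :> a" "0 < e"
  shows "\<forall>\<^sub>F y in at x. \<bar>f y - f x - (y - x) \<bullet> a\<bar> \<le> e * norm (y - x)"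
proof -
  obtain d where "d > 0" "\<And>y. norm (y - x) < d \<Longrightarrow> norm (f y - f x - (y - x) \<bullet> a) \<le> e * norm (y - x)"
    using assms unfolding gderiv_def has_derivative_at_alt by blast
  then show ?thesis unfolding eventually_at by (intro exI[of _ d]) (auto simp: dist_norm)
qed

lemma GDERIV_abs:
  assumes "GDERIV \<phi> x :> w" "\<phi> x \<noteq> 0" shows "GDERIV (\<lambda>y. \<bar>\<phi> y\<bar>) x :> sgn (\<phi> x) *\<^sub>R w"
proof -
  have "((\<lambda>z. \<bar>z\<bar>) has_real_derivative sgn a) (at a)" if "a \<noteq> 0" for a :: real
  proof (cases "a > 0")
    case True
    have "((\<lambda>z. \<bar>z\<bar>) has_real_derivative 1) (at a)"
      by (rule has_field_derivative_transform_within_open[of "\<lambda>z. z" 1 a "{0<..}"]) (use True in auto)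
    then show ?thesis using True by simp
  next
    case False
    have "((\<lambda>z. \<bar>z\<bar>) has_real_derivative - 1) (at a)"
      by (rule has_field_derivative_transform_within_open[of "\<lambda>z. - z" "- 1" a "{..<0}"])
        (use False that in \<open>auto intro!: derivative_eq_intros\<close>)
    then show ?thesis using False that by simp
  qed
  from GDERIV_DERIV_compose[OF assms(1) this[OF assms(2)]] show ?thesis .
qed

text \<open>
  The sum rule needed here is exact, because the first summand and the function under the absolute value
  are differentiable.
\<close>

lemma subdiff_abs:
  fixes k \<phi> :: "'a::real_inner \<Rightarrow> real"
  assumes k: "GDERIV k x :> m" and \<phi>: "GDERIV \<phi> x :> w"
  shows "subdiff (\<lambda>y. k y + \<bar>\<phi> y\<bar>) x = {m + s *\<^sub>R w | s. s \<in> Sign (\<phi> x)}"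
proof (intro equalityI subsetI)
  fix v assume "v \<in> {m + s *\<^sub>R w | s. s \<in> Sign (\<phi> x)}"
  then obtain s where s: "v = m + s *\<^sub>R w" "s \<in> Sign (\<phi> x)" by blast
  have s1: "\<bar>s\<bar> \<le> 1" "s * \<phi> x = \<bar>\<phi> x\<bar>"
    using s(2) by (auto simp: Sign_def sgn_if abs_if split: if_splits)
  have "\<forall>\<^sub>F y in at x. k x + \<bar>\<phi> x\<bar> + v \<bullet> (y - x) - e * norm (y - x) \<le> k y + \<bar>\<phi> y\<bar>" if e: "e > 0" for e
  proof -
    have e2: "e / 2 > 0" using e by simp
    show ?thesis using GDERIV_eventually[OF k e2] GDERIV_eventually[OF \<phi> e2]
    proof eventually_elim
      case (elim y)
      have "s * \<phi> y \<le> \<bar>\<phi> y\<bar>"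
      proof -
        have "s * \<phi> y \<le> \<bar>s\<bar> * \<bar>\<phi> y\<bar>" by (metis abs_ge_self abs_mult)
        also have "\<dots> \<le> 1 * \<bar>\<phi> y\<bar>" using s1 by (intro mult_right_mono) auto
        finally show ?thesis by simp
      qed
      moreover have "s * (\<phi> x + (y - x) \<bullet> w) - e / 2 * norm (y - x) \<le> s * \<phi> y"
      proof -
        have "\<bar>s * (\<phi> y - \<phi> x - (y - x) \<bullet> w)\<bar> \<le> 1 * (e / 2 * norm (y - x))"
          unfolding abs_mult using s1 elim(2) by (intro mult_mono) auto
        then have "- (s * (\<phi> y - \<phi> x - (y - x) \<bullet> w)) \<le> e / 2 * norm (y - x)" by linarith
        then show ?thesis by (simp add: right_diff_distrib distrib_left)
      qed
      moreover have "v \<bullet> (y - x) = (y - x) \<bullet> m + s * ((y - x) \<bullet> w)"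
        by (simp add: s(1) inner_commute[of _ "y - x"] inner_add_right)
      moreover have "s * (\<phi> x + (y - x) \<bullet> w) = \<bar>\<phi> x\<bar> + s * ((y - x) \<bullet> w)" using s1(2) by (simp add: distrib_left)
      moreover have "k x + (y - x) \<bullet> m - e / 2 * norm (y - x) \<le> k y" using elim(1) by linarith
      moreover have "e * norm (y - x) = e / 2 * norm (y - x) + e / 2 * norm (y - x)" by simp
      ultimately show ?case by linarith
    qed
  qed
  then show "v \<in> subdiff (\<lambda>y. k y + \<bar>\<phi> y\<bar>) x" by (simp add: subdiff_def)
next
  fix v assume v: "v \<in> subdiff (\<lambda>y. k y + \<bar>\<phi> y\<bar>) x"
  have dir: "(v - m) \<bullet> h \<le> (if \<phi> x = 0 then \<bar>w \<bullet> h\<bar> else sgn (\<phi> x) * (w \<bullet> h))" for h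
  proof (cases "h = 0")
    case True then show ?thesis by simp
  next
    case h: False
    define R where "R = (if \<phi> x = 0 then \<bar>w \<bullet> h\<bar> else sgn (\<phi> x) * (w \<bullet> h))"
    have near: "(v - m) \<bullet> h \<le> R + 3 * e * norm h" if e: "e > 0" for e
    proof -
      have phi: "\<forall>\<^sub>F y in at x. \<bar>\<phi> y\<bar> - \<bar>\<phi> x\<bar> \<le> (if \<phi> x = 0 then \<bar>w \<bullet> (y - x)\<bar> else sgn (\<phi> x) * (w \<bullet> (y - x))) + e * norm (y - x)"
      proof (cases "\<phi> x = 0")
        case True
        show ?thesis using GDERIV_eventually[OF \<phi> e]
        proof eventually_elim
          case (elim y)
          then show ?case unfolding inner_commute[of "y - x" w] using True by simp
        qed
      next
        case False
        show ?thesis using GDERIV_eventually[OF GDERIV_abs[OF \<phi> False] e]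
        proof eventually_elim
          case (elim y)
          have "(y - x) \<bullet> (sgn (\<phi> x) *\<^sub>R w) = sgn (\<phi> x) * (w \<bullet> (y - x))" by (simp add: inner_commute)
          then show ?case using elim False by (simp only: if_False)
        qed
      qed
      have "\<forall>\<^sub>F y in at x. k x + \<bar>\<phi> x\<bar> + v \<bullet> (y - x) - e * norm (y - x) \<le> k y + \<bar>\<phi> y\<bar>"
        using v e by (simp add: subdiff_def)
      with phi GDERIV_eventually[OF k e]
      have "\<forall>\<^sub>F y in at x. (v - m) \<bullet> (y - x) \<le> (if \<phi> x = 0 then \<bar>w \<bullet> (y - x)\<bar> else sgn (\<phi> x) * (w \<bullet> (y - x))) + 3 * e * norm (y - x)"
      proof eventually_elim
        case (elim y)
        have "(v - m) \<bullet> (y - x) = v \<bullet> (y - x) - (y - x) \<bullet> m" by (simp add: inner_diff_left inner_commute)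
        moreover have "3 * e * norm (y - x) = e * norm (y - x) + e * norm (y - x) + e * norm (y - x)" by simp
        moreover have "k y \<le> k x + (y - x) \<bullet> m + e * norm (y - x)" using elim(2) by linarith
        ultimately show ?case using elim(1,3) by linarith
      qed
      then obtain d where d: "d > 0" "\<And>y. y \<noteq> x \<Longrightarrow> dist y x < d \<Longrightarrow>
         (v - m) \<bullet> (y - x) \<le> (if \<phi> x = 0 then \<bar>w \<bullet> (y - x)\<bar> else sgn (\<phi> x) * (w \<bullet> (y - x))) + 3 * e * norm (y - x)"
        unfolding eventually_at by blast
      define t where "t = d / (2 * norm h)"
      have t: "t > 0" "t * norm h < d" using d(1) h by (auto simp: t_def)
      have "t * ((v - m) \<bullet> h) \<le> t * (R + 3 * e * norm h)"
        using d(2)[of "x + t *\<^sub>R h"] t h by (simp add: dist_norm R_def abs_mult algebra_simps split: if_splits)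
      then show ?thesis using t(1) by (rule mult_left_le_imp_le)
    qed
    have "(v - m) \<bullet> h \<le> R + e" if "e > 0" for e
      using near[of "e / (3 * norm h)"] that h by simp
    then show ?thesis unfolding R_def[symmetric] by (rule field_le_epsilon)
  qed
  show "v \<in> {m + s *\<^sub>R w | s. s \<in> Sign (\<phi> x)}"
  proof (cases "\<phi> x = 0")
    case False
    define d where "d = v - m - sgn (\<phi> x) *\<^sub>R w"
    have "d \<bullet> d \<le> 0" using dir[of d] False by (simp add: d_def inner_diff_left)
    then have "d = 0" by (metis inner_eq_zero_iff inner_ge_zero order_antisym)
    then have "v = m + sgn (\<phi> x) *\<^sub>R w" unfolding d_def by (simp add: algebra_simps)
    then show ?thesis using False by (auto simp: Sign_def)
  next
    case True
    have dir0: "(v - m) \<bullet> h \<le> \<bar>w \<bullet> h\<bar>" for h using dir[of h] True by simp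
    define s where "s = (if w = 0 then 0 else ((v - m) \<bullet> w) / (w \<bullet> w))"
    define d where "d = v - m - s *\<^sub>R w"
    have dw: "w \<bullet> d = 0"
      by (cases "w = 0") (auto simp: d_def s_def inner_diff_right inner_commute)
    have "d \<bullet> d = (v - m) \<bullet> d" using dw by (simp add: d_def inner_diff_left)
    also have "\<dots> \<le> 0" using dir0[of d] dw by simp
    finally have "d = 0" by (metis inner_eq_zero_iff inner_ge_zero order_antisym)
    then have vs: "v = m + s *\<^sub>R w" unfolding d_def by (simp add: algebra_simps)
    have "\<bar>s\<bar> \<le> 1"
    proof (cases "w = 0")
      case False
      then have ww: "w \<bullet> w > 0" by simp
      have "\<bar>(v - m) \<bullet> w\<bar> \<le> w \<bullet> w" using dir0[of w] dir0[of "- w"] ww by (simp add: abs_le_iff)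
      then show ?thesis using False ww by (simp add: s_def abs_divide)
    qed (simp add: s_def)
    then show ?thesis using vs True by (auto simp: Sign_def abs_le_iff)
  qed
qed

section \<open>Averages over one angle\<close>

text \<open>
  The uniform probability measure on the interval from \<open>0\<close> to \<open>2 * pi\<close>, which represents the circle.
\<close>

definition circ :: "real measure" where
  "circ = uniform_measure lborel {0..2 * pi}"

lemma sets_circ [simp, measurable_cong]: "sets circ = sets borel"
  and space_circ [simp]: "space circ = UNIV"
  by (simp_all add: circ_def)

lemma prob_space_circ: "prob_space circ"
  unfolding circ_def by (rule prob_space_uniform_measure) auto

interpretation circ: prob_space circ by (rule prob_space_circ)

lemma nn_integral_circ:
  assumes [measurable]: "f \<in> borel_measurable borel"
  shows "(\<integral>\<^sup>+y. f y \<partial>circ) = ennreal (1 / (2 * pi)) * (\<integral>\<^sup>+y. f y * indicator {0..2 * pi} y \<partial>lborel)"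
proof -
  have "(\<integral>\<^sup>+y. f y \<partial>circ) = (\<integral>\<^sup>+y. f y * indicator {0..2 * pi} y \<partial>lborel) / ennreal (2 * pi)"
    unfolding circ_def by (subst nn_integral_uniform_measure) auto
  also have "\<dots> = ennreal (1 / (2 * pi)) * (\<integral>\<^sup>+y. f y * indicator {0..2 * pi} y \<partial>lborel)"
  proof -
    have "inverse (ennreal (2 * pi)) = ennreal (inverse (2 * pi))" by (rule inverse_ennreal) simp
    then show ?thesis by (simp only: inverse_eq_divide divide_ennreal_def mult.commute)
  qed
  finally show ?thesis .
qed

lemma circ_shift:
  fixes f :: "real \<Rightarrow> ennreal"
  assumes [measurable]: "f \<in> borel_measurable borel" and per: "\<And>y. f (y + 2 * pi) = f y"
    and th: "0 \<le> \<theta>" "\<theta> \<le> 2 * pi"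
  shows "(\<integral>\<^sup>+y. f (y + \<theta>) \<partial>circ) = (\<integral>\<^sup>+y. f y \<partial>circ)"
proof -
  have "(\<integral>\<^sup>+y. f (y + \<theta>) * indicator {0..2 * pi} y \<partial>lborel)
      = (\<integral>\<^sup>+y. f y * indicator {\<theta>..2 * pi + \<theta>} y \<partial>lborel)"
  proof -
    have "(\<integral>\<^sup>+y. f y * indicator {\<theta>..2 * pi + \<theta>} y \<partial>lborel)
      = ennreal \<bar>1\<bar> * (\<integral>\<^sup>+y. f (\<theta> + 1 * y) * indicator {\<theta>..2 * pi + \<theta>} (\<theta> + 1 * y) \<partial>lborel)"
      by (rule nn_integral_real_affine) auto
    also have "\<dots> = (\<integral>\<^sup>+y. f (y + \<theta>) * indicator {0..2 * pi} y \<partial>lborel)"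
      by (simp, intro nn_integral_cong) (auto simp: add.commute indicator_def)
    finally show ?thesis by simp
  qed
  also have "\<dots> = (\<integral>\<^sup>+y. f y * indicator {\<theta>..2 * pi} y + f y * indicator {2 * pi<..2 * pi + \<theta>} y \<partial>lborel)"
    using th by (intro nn_integral_cong) (auto simp: indicator_def)
  also have "\<dots> = (\<integral>\<^sup>+y. f y * indicator {\<theta>..2 * pi} y \<partial>lborel) + (\<integral>\<^sup>+y. f y * indicator {2 * pi<..2 * pi + \<theta>} y \<partial>lborel)"
    by (rule nn_integral_add) auto
  also have "(\<integral>\<^sup>+y. f y * indicator {2 * pi<..2 * pi + \<theta>} y \<partial>lborel)
      = ennreal \<bar>1\<bar> * (\<integral>\<^sup>+y. f (2 * pi + 1 * y) * indicator {2 * pi<..2 * pi + \<theta>} (2 * pi + 1 * y) \<partial>lborel)"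
    by (rule nn_integral_real_affine) auto
  also have "\<dots> = (\<integral>\<^sup>+y. f y * indicator {0<..\<theta>} y \<partial>lborel)"
    using per by (simp, intro nn_integral_cong) (auto simp: add.commute indicator_def)
  also have "(\<integral>\<^sup>+y. f y * indicator {\<theta>..2 * pi} y \<partial>lborel) + \<dots>
      = (\<integral>\<^sup>+y. f y * indicator {\<theta>..2 * pi} y + f y * indicator {0<..\<theta>} y \<partial>lborel)"
    by (rule nn_integral_add[symmetric]) auto
  also have "\<dots> = (\<integral>\<^sup>+y. f y * indicator {0..2 * pi} y \<partial>lborel)"
  proof (rule nn_integral_cong_AE)
    show "AE y in lborel. f y * indicator {\<theta>..2 * pi} y + f y * indicator {0<..\<theta>} y = f y * indicator {0..2 * pi} y"
      using AE_lborel_singleton[of 0] AE_lborel_singleton[of \<theta>]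
      by eventually_elim (use th in \<open>auto simp: indicator_def\<close>)
  qed
  finally show ?thesis by (simp add: nn_integral_circ)
qed

lemma polar: obtains \<theta> where "0 \<le> \<theta>" "\<theta> \<le> 2 * pi"
  "\<eta> = sqrt (\<eta>\<^sup>2 + \<zeta>\<^sup>2) * cos \<theta>" "\<zeta> = sqrt (\<eta>\<^sup>2 + \<zeta>\<^sup>2) * sin \<theta>"
proof (cases "\<eta>\<^sup>2 + \<zeta>\<^sup>2 = 0")
  case True
  then show ?thesis using that[of 0] by (simp add: sum_power2_eq_zero_iff)
next
  case False
  define r where "r = sqrt (\<eta>\<^sup>2 + \<zeta>\<^sup>2)"
  have "\<eta>\<^sup>2 + \<zeta>\<^sup>2 > 0" using False by (smt (verit) zero_le_power2)
  then have r: "r > 0" "r\<^sup>2 = \<eta>\<^sup>2 + \<zeta>\<^sup>2" by (auto simp: r_def)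
  have "(\<eta> / r)\<^sup>2 + (\<zeta> / r)\<^sup>2 = (\<eta>\<^sup>2 + \<zeta>\<^sup>2) / r\<^sup>2"
    by (simp only: power_divide add_divide_distrib)
  also have "\<dots> = 1" using r by (simp only: r(2)[symmetric]) simp
  finally have "(\<eta> / r)\<^sup>2 + (\<zeta> / r)\<^sup>2 = 1" .
  then obtain t where "0 \<le> t" "t < 2 * pi" "\<eta> / r = cos t" "\<zeta> / r = sin t" by (rule sincos_total_2pi)
  then show ?thesis using that[of t] r unfolding r_def[symmetric] by (auto simp: field_simps)
qed

text \<open>
  Every pair of coefficients can be rotated to \<open>(r, 0)\<close>. The two arguments of \<open>G\<close> are a harmonic wave and,
  up to sign, its derivative in the angle.
\<close>

lemma circ_rotate:
  fixes G :: "real \<Rightarrow> real \<Rightarrow> ennreal"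
  assumes G: "(\<lambda>(a, b). G a b) \<in> borel_measurable (borel \<Otimes>\<^sub>M borel)"
  shows "(\<integral>\<^sup>+y. G (\<eta> * cos y + \<zeta> * sin y) (\<eta> * sin y - \<zeta> * cos y) \<partial>circ)
    = (\<integral>\<^sup>+y. G (sqrt (\<eta>\<^sup>2 + \<zeta>\<^sup>2) * cos y) (sqrt (\<eta>\<^sup>2 + \<zeta>\<^sup>2) * sin y) \<partial>circ)"
proof -
  define r where "r = sqrt (\<eta>\<^sup>2 + \<zeta>\<^sup>2)"
  obtain \<theta> where th: "0 \<le> \<theta>" "\<theta> \<le> 2 * pi" "\<eta> = r * cos \<theta>" "\<zeta> = r * sin \<theta>"
    using polar[of \<eta> \<zeta>] unfolding r_def by blast
  define f where "f y = G (\<eta> * cos y + \<zeta> * sin y) (\<eta> * sin y - \<zeta> * cos y)" for y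
  have f: "f y = G (r * cos (y - \<theta>)) (r * sin (y - \<theta>))" for y
    unfolding f_def th(3,4) by (simp add: cos_diff sin_diff algebra_simps)
  have [measurable]: "f \<in> borel_measurable borel"
    unfolding f_def[abs_def] using measurable_compose[OF _ G, of "\<lambda>y. (\<eta> * cos y + \<zeta> * sin y, \<eta> * sin y - \<zeta> * cos y)" borel]
    by simp
  have "f (y + 2 * pi) = f y" for y by (simp add: f_def)
  from circ_shift[of f \<theta>, OF _ this th(1,2)] have "(\<integral>\<^sup>+y. f (y + \<theta>) \<partial>circ) = (\<integral>\<^sup>+y. f y \<partial>circ)" by simp
  moreover have "f (y + \<theta>) = G (r * cos y) (r * sin y)" for y by (simp add: f)
  ultimately show ?thesis by (simp add: f_def r_def)
qed

text \<open>
  The change of variables \<open>u = \<eta> * cos y + \<zeta> * sin y\<close>; the two monotone halves of the wave contribute equally.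
\<close>

lemma circ_substitution:
  fixes F :: "real \<Rightarrow> real"
  assumes [measurable]: "F \<in> borel_measurable borel"
  shows "(\<integral>\<^sup>+y. ennreal (F (\<eta> * cos y + \<zeta> * sin y)) * ennreal \<bar>\<eta> * sin y - \<zeta> * cos y\<bar> \<partial>circ)
    = ennreal (1 / pi) * (\<integral>\<^sup>+u. ennreal (F u) * indicator {- sqrt (\<eta>\<^sup>2 + \<zeta>\<^sup>2)..sqrt (\<eta>\<^sup>2 + \<zeta>\<^sup>2)} u \<partial>lborel)"
proof -
  define r where "r = sqrt (\<eta>\<^sup>2 + \<zeta>\<^sup>2)"
  have r0: "r \<ge> 0" by (simp add: r_def)
  let ?I = "\<integral>\<^sup>+u. ennreal (F u) * indicator {- r..r} u \<partial>lborel"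
  have "(\<integral>\<^sup>+y. ennreal (F (\<eta> * cos y + \<zeta> * sin y)) * ennreal \<bar>\<eta> * sin y - \<zeta> * cos y\<bar> \<partial>circ)
    = (\<integral>\<^sup>+y. ennreal (F (r * cos y)) * ennreal \<bar>r * sin y\<bar> \<partial>circ)"
    unfolding r_def by (rule circ_rotate[where G = "\<lambda>a b. ennreal (F a) * ennreal \<bar>b\<bar>"]) measurable
  also have "\<dots> = ennreal (1 / (2 * pi)) * (\<integral>\<^sup>+y. ennreal (F (r * cos y)) * ennreal \<bar>r * sin y\<bar> * indicator {0..2 * pi} y \<partial>lborel)"
    by (rule nn_integral_circ) measurable
  also have "(\<integral>\<^sup>+y. ennreal (F (r * cos y)) * ennreal \<bar>r * sin y\<bar> * indicator {0..2 * pi} y \<partial>lborel)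
     = (\<integral>\<^sup>+y. ennreal (F (r * cos y) * (r * sin y) * indicator {0..pi} y)
          + ennreal (F (r * cos y) * (- (r * sin y)) * indicator {pi..2 * pi} y) \<partial>lborel)"
  proof (rule nn_integral_cong_AE)
    show "AE y in lborel. ennreal (F (r * cos y)) * ennreal \<bar>r * sin y\<bar> * indicator {0..2 * pi} y
        = ennreal (F (r * cos y) * (r * sin y) * indicator {0..pi} y)
          + ennreal (F (r * cos y) * (- (r * sin y)) * indicator {pi..2 * pi} y)"
      using AE_lborel_singleton[of pi]
    proof eventually_elim
      fix y assume y: "y \<noteq> pi"
      consider "0 \<le> y \<and> y < pi" | "pi < y \<and> y \<le> 2 * pi" | "y < 0 \<or> y > 2 * pi" using y by linarith
      then show "ennreal (F (r * cos y)) * ennreal \<bar>r * sin y\<bar> * indicator {0..2 * pi} y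
        = ennreal (F (r * cos y) * (r * sin y) * indicator {0..pi} y)
          + ennreal (F (r * cos y) * (- (r * sin y)) * indicator {pi..2 * pi} y)"
      proof cases
        case 1
        then have "r * sin y \<ge> 0" using r0 by (intro mult_nonneg_nonneg sin_ge_zero) auto
        then show ?thesis using 1 by (simp add: ennreal_mult'')
      next
        case 2
        then have "sin y \<le> 0" using sin_le_zero[of y] by (cases "y = 2 * pi") auto
        then have n: "- (r * sin y) \<ge> 0" using r0 by (simp add: mult_nonneg_nonpos)
        then have "\<bar>r * sin y\<bar> = - (r * sin y)" by linarith
        then show ?thesis using 2 ennreal_mult''[OF n, of "F (r * cos y)"] by simp
      next
        case 3
        then show ?thesis using pi_gt_zero by (auto simp: indicator_def)
      qed
    qed
  qed
  also have "\<dots> = (\<integral>\<^sup>+y. ennreal (F (r * cos y) * (r * sin y) * indicator {0..pi} y) \<partial>lborel)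
     + (\<integral>\<^sup>+y. ennreal (F (r * cos y) * (- (r * sin y)) * indicator {pi..2 * pi} y) \<partial>lborel)"
    by (rule nn_integral_add) measurable
  also have "(\<integral>\<^sup>+y. ennreal (F (r * cos y) * (r * sin y) * indicator {0..pi} y) \<partial>lborel) = ?I"
  proof -
    have "(\<integral>\<^sup>+x. (F (- x)) * indicator {- r * cos 0..- r * cos pi} x \<partial>lborel) =
        (\<integral>\<^sup>+x. F (- (- r * cos x)) * (r * sin x) * indicator {0..pi} x \<partial>lborel)"
    proof (rule nn_integral_substitution)
      show "set_borel_measurable borel {- r * cos 0..- r * cos pi} (\<lambda>x. F (- x))"
        unfolding set_borel_measurable_def by measurable
      show "((\<lambda>x. - r * cos x) has_real_derivative r * sin x) (at x)" for x
        by (auto intro!: derivative_eq_intros)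
      show "continuous_on {0..pi} (\<lambda>x. r * sin x)" by (intro continuous_intros)
      show "0 \<le> r * sin x" if "x \<in> {0..pi}" for x using that r0 by (intro mult_nonneg_nonneg sin_ge_zero) auto
    qed simp
    also have "(\<integral>\<^sup>+x. (F (- x)) * indicator {- r * cos 0..- r * cos pi} x \<partial>lborel) =
       (\<integral>\<^sup>+x. ennreal (F (0 + (-1) * x)) * indicator {- r..r} (0 + (-1) * x) \<partial>lborel)"
      by (intro nn_integral_cong) (auto simp: indicator_def)
    also have "\<dots> = ?I" using nn_integral_real_affine[of "\<lambda>u. ennreal (F u) * indicator {- r..r} u" "-1" 0] by simp
    finally show ?thesis by simp
  qed
  also have "(\<integral>\<^sup>+y. ennreal (F (r * cos y) * (- (r * sin y)) * indicator {pi..2 * pi} y) \<partial>lborel) = ?I"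
  proof -
    have "(\<integral>\<^sup>+x. F x * indicator {r * cos pi..r * cos (2 * pi)} x \<partial>lborel) =
        (\<integral>\<^sup>+x. F (r * cos x) * (- (r * sin x)) * indicator {pi..2 * pi} x \<partial>lborel)"
    proof (rule nn_integral_substitution)
      show "set_borel_measurable borel {r * cos pi..r * cos (2 * pi)} F"
        unfolding set_borel_measurable_def by measurable
      show "((\<lambda>x. r * cos x) has_real_derivative - (r * sin x)) (at x)" for x
        by (auto intro!: derivative_eq_intros)
      show "continuous_on {pi..2 * pi} (\<lambda>x. - (r * sin x))" by (intro continuous_intros)
      show "0 \<le> - (r * sin x)" if "x \<in> {pi..2 * pi}" for x
        using that r0 sin_le_zero[of x] by (cases "x = 2 * pi") (auto simp: mult_nonneg_nonpos)
    qed simp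
    also have "(\<integral>\<^sup>+x. F x * indicator {r * cos pi..r * cos (2 * pi)} x \<partial>lborel) = ?I"
      by (intro nn_integral_cong) (auto simp: indicator_def)
    finally show ?thesis by simp
  qed
  also have "ennreal (1 / (2 * pi)) * (?I + ?I) = ennreal (1 / pi) * ?I"
  proof -
    have "?I + ?I = 2 * ?I" by (simp add: mult_2)
    then have "ennreal (1 / (2 * pi)) * (?I + ?I) = (ennreal (1 / (2 * pi)) * ennreal 2) * ?I"
      by (simp add: mult.assoc)
    also have "ennreal (1 / (2 * pi)) * ennreal 2 = ennreal (1 / pi)"
      by (subst ennreal_mult[symmetric]) auto
    finally show ?thesis .
  qed
  finally show ?thesis by (simp add: r_def)
qed

text \<open>
  The weight \<open>\<bar>\<eta> * sin y - \<zeta> * cos y\<bar>\<close> makes the strip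
  \<open>\<bar>c + \<eta> * cos y + \<zeta> * sin y\<bar> \<le> \<tau>\<close> have measure of order \<open>\<tau>\<close>, uniformly in \<open>c\<close>.
\<close>

lemma circ_strip:
  assumes "0 \<le> \<tau>"
  shows "(\<integral>\<^sup>+y. indicator {y. \<bar>c + (\<eta> * cos y + \<zeta> * sin y)\<bar> \<le> \<tau>} y * ennreal \<bar>\<eta> * sin y - \<zeta> * cos y\<bar> \<partial>circ)
    \<le> ennreal \<tau>"
proof -
  define F :: "real \<Rightarrow> real" where "F = indicator {u. \<bar>c + u\<bar> \<le> \<tau>}"
  have [measurable]: "F \<in> borel_measurable borel" unfolding F_def by measurable
  have "(\<integral>\<^sup>+y. indicator {y. \<bar>c + (\<eta> * cos y + \<zeta> * sin y)\<bar> \<le> \<tau>} y * ennreal \<bar>\<eta> * sin y - \<zeta> * cos y\<bar> \<partial>circ)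
    = (\<integral>\<^sup>+y. ennreal (F (\<eta> * cos y + \<zeta> * sin y)) * ennreal \<bar>\<eta> * sin y - \<zeta> * cos y\<bar> \<partial>circ)"
    by (intro nn_integral_cong) (simp add: F_def indicator_def)
  also have "\<dots> = ennreal (1 / pi) * (\<integral>\<^sup>+u. ennreal (F u) * indicator {- sqrt (\<eta>\<^sup>2 + \<zeta>\<^sup>2)..sqrt (\<eta>\<^sup>2 + \<zeta>\<^sup>2)} u \<partial>lborel)"
    by (rule circ_substitution) simp
  also have "\<dots> \<le> ennreal (1 / pi) * (\<integral>\<^sup>+u. indicator {- c - \<tau>..- c + \<tau>} u \<partial>lborel)"
    by (intro mult_left_mono nn_integral_mono) (auto simp: F_def indicator_def)
  also have "\<dots> = ennreal (1 / pi) * ennreal (2 * \<tau>)" using assms by simp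
  also have "\<dots> = ennreal (1 / pi * (2 * \<tau>))" using assms by (intro ennreal_mult[symmetric]) auto
  also have "\<dots> \<le> ennreal \<tau>"
  proof (rule ennreal_leI)
    have "2 * \<tau> \<le> pi * \<tau>" using pi_ge_two assms by (intro mult_right_mono) auto
    then show "1 / pi * (2 * \<tau>) \<le> \<tau>" by (simp add: field_simps)
  qed
  finally show ?thesis .
qed

lemma circ_AE_perp:
  assumes "\<eta>\<^sup>2 + \<zeta>\<^sup>2 > 0" shows "AE y in circ. \<eta> * sin y - \<zeta> * cos y \<noteq> 0"
proof -
  have "(\<integral>\<^sup>+y. indicator {y. \<bar>0 + (- \<zeta> * cos y + \<eta> * sin y)\<bar> \<le> 0} y * ennreal \<bar>- \<zeta> * sin y - \<eta> * cos y\<bar> \<partial>circ) \<le> ennreal 0"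
    by (rule circ_strip) simp
  then have "(\<integral>\<^sup>+y. indicator {y. \<bar>0 + (- \<zeta> * cos y + \<eta> * sin y)\<bar> \<le> 0} y * ennreal \<bar>- \<zeta> * sin y - \<eta> * cos y\<bar> \<partial>circ) = 0"
    by simp
  then have "AE y in circ. indicator {y. \<bar>0 + (- \<zeta> * cos y + \<eta> * sin y)\<bar> \<le> 0} y * ennreal \<bar>- \<zeta> * sin y - \<eta> * cos y\<bar> = 0"
    by (subst (asm) nn_integral_0_iff_AE) measurable
  then show ?thesis
  proof eventually_elim
    fix y
    assume 1: "indicator {y. \<bar>0 + (- \<zeta> * cos y + \<eta> * sin y)\<bar> \<le> 0} y * ennreal \<bar>- \<zeta> * sin y - \<eta> * cos y\<bar> = 0"
    have "(\<eta> * sin y - \<zeta> * cos y)\<^sup>2 + (- \<zeta> * sin y - \<eta> * cos y)\<^sup>2 = (\<eta>\<^sup>2 + \<zeta>\<^sup>2) * ((sin y)\<^sup>2 + (cos y)\<^sup>2)"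
      unfolding power2_eq_square by algebra
    then have 2: "(\<eta> * sin y - \<zeta> * cos y)\<^sup>2 + (- \<zeta> * sin y - \<eta> * cos y)\<^sup>2 = \<eta>\<^sup>2 + \<zeta>\<^sup>2" by simp
    show "\<eta> * sin y - \<zeta> * cos y \<noteq> 0"
    proof
      assume 0: "\<eta> * sin y - \<zeta> * cos y = 0"
      then have "ennreal \<bar>- \<zeta> * sin y - \<eta> * cos y\<bar> = 0" using 1 by (simp add: indicator_def add.commute)
      then have "- \<zeta> * sin y - \<eta> * cos y = 0" by simp
      then show False using 0 2 assms by simp
    qed
  qed
qed

lemma circ_AE_affine:
  assumes "\<eta>\<^sup>2 + \<zeta>\<^sup>2 > 0" shows "AE y in circ. c + (\<eta> * cos y + \<zeta> * sin y) \<noteq> 0"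
proof -
  have "(\<integral>\<^sup>+y. indicator {y. \<bar>c + (\<eta> * cos y + \<zeta> * sin y)\<bar> \<le> 0} y * ennreal \<bar>\<eta> * sin y - \<zeta> * cos y\<bar> \<partial>circ) \<le> ennreal 0"
    by (rule circ_strip) simp
  then have "(\<integral>\<^sup>+y. indicator {y. \<bar>c + (\<eta> * cos y + \<zeta> * sin y)\<bar> \<le> 0} y * ennreal \<bar>\<eta> * sin y - \<zeta> * cos y\<bar> \<partial>circ) = 0"
    by simp
  then have "AE y in circ. indicator {y. \<bar>c + (\<eta> * cos y + \<zeta> * sin y)\<bar> \<le> 0} y * ennreal \<bar>\<eta> * sin y - \<zeta> * cos y\<bar> = 0"
    by (subst (asm) nn_integral_0_iff_AE) measurable
  with circ_AE_perp[OF assms] show ?thesis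
    by eventually_elim (auto simp: indicator_def split: if_splits)
qed

lemma nn_integral_abs_powr:
  assumes "r \<ge> 0"
  shows "(\<integral>\<^sup>+u. ennreal (\<bar>u\<bar> powr (- 3 / 4)) * indicator {- r..r} u \<partial>lborel) < \<infinity>"
proof -
  let ?F = "\<lambda>u :: real. ennreal (\<bar>u\<bar> powr (- 3 / 4))"
  have 1: "(\<integral>\<^sup>+u. ?F u * indicator {0..r} u \<partial>lborel) < \<infinity>"
  proof -
    have "((\<lambda>x. \<bar>x\<bar> powr (- 3 / 4)) has_integral (r powr (- 3 / 4 + 1) / (- 3 / 4 + 1))) {0..r}"
    proof (rule has_integral_eq)
      show "((\<lambda>x. x powr (- 3 / 4)) has_integral (r powr (- 3 / 4 + 1) / (- 3 / 4 + 1))) {0..r}"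
        by (rule has_integral_powr_from_0) (use assms in auto)
    qed simp
    then have "(\<integral>\<^sup>+x. indicator {0..r} x * \<bar>x\<bar> powr (- 3 / 4) \<partial>lborel) = ennreal (r powr (- 3 / 4 + 1) / (- 3 / 4 + 1))"
      by (rule nn_integral_has_integral_lebesgue[rotated]) simp
    moreover have "(\<integral>\<^sup>+x. indicator {0..r} x * \<bar>x\<bar> powr (- 3 / 4) \<partial>lborel) = (\<integral>\<^sup>+u. ?F u * indicator {0..r} u \<partial>lborel)"
      by (intro nn_integral_cong) (auto simp: indicator_def)
    ultimately show ?thesis by (metis ennreal_less_top infinity_ennreal_def)
  qed
  have 2: "(\<integral>\<^sup>+u. ?F u * indicator {- r..0} u \<partial>lborel) = (\<integral>\<^sup>+u. ?F u * indicator {0..r} u \<partial>lborel)"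
  proof -
    have "(\<integral>\<^sup>+u. ?F u * indicator {0..r} u \<partial>lborel)
        = ennreal \<bar>-1\<bar> * (\<integral>\<^sup>+u. ?F (0 + (-1) * u) * indicator {0..r} (0 + (-1) * u) \<partial>lborel)"
      by (rule nn_integral_real_affine) auto
    also have "\<dots> = (\<integral>\<^sup>+u. ?F u * indicator {- r..0} u \<partial>lborel)"
      by (simp, intro nn_integral_cong) (auto simp: indicator_def)
    finally show ?thesis by simp
  qed
  have "(\<integral>\<^sup>+u. ?F u * indicator {- r..r} u \<partial>lborel)
      \<le> (\<integral>\<^sup>+u. ?F u * indicator {0..r} u + ?F u * indicator {- r..0} u \<partial>lborel)"
    by (intro nn_integral_mono) (auto simp: indicator_def)
  also have "\<dots> = (\<integral>\<^sup>+u. ?F u * indicator {0..r} u \<partial>lborel) + (\<integral>\<^sup>+u. ?F u * indicator {- r..0} u \<partial>lborel)"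
    by (rule nn_integral_add) measurable
  also have "\<dots> < \<infinity>" using 1 2 by simp
  finally show ?thesis .
qed

text \<open>
  Where the wave is large, it serves as the weight in the change of variables that makes its derivative
  the new variable.
\<close>

lemma circ_perp_powr:
  assumes "\<eta>\<^sup>2 + \<zeta>\<^sup>2 > 0"
  shows "(\<integral>\<^sup>+y. ennreal (\<bar>\<eta> * sin y - \<zeta> * cos y\<bar> powr (- 3 / 4)) \<partial>circ) < \<infinity>"
proof -
  define r where "r = sqrt (\<eta>\<^sup>2 + \<zeta>\<^sup>2)"
  have r: "r > 0" using assms by (simp add: r_def)
  let ?F = "\<lambda>u :: real. \<bar>u\<bar> powr (- 3 / 4)"
  have "(\<integral>\<^sup>+y. ennreal (?F (\<eta> * sin y - \<zeta> * cos y)) \<partial>circ) = (\<integral>\<^sup>+y. ennreal (?F (r * sin y)) \<partial>circ)"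
    unfolding r_def by (rule circ_rotate[where G = "\<lambda>a b. ennreal (?F b)"]) measurable
  also have "\<dots> \<le> (\<integral>\<^sup>+y. ennreal (2 / r) * (ennreal (?F (0 * cos y + r * sin y)) * ennreal \<bar>0 * sin y - r * cos y\<bar>)
      + ennreal ((r / 2) powr (- 3 / 4)) \<partial>circ)"
  proof (rule nn_integral_mono)
    fix y :: real
    have "?F (r * sin y) \<le> 2 / r * (?F (r * sin y) * \<bar>r * cos y\<bar>) + (r / 2) powr (- 3 / 4)"
    proof (cases "r / 2 \<le> \<bar>r * cos y\<bar>")
      case True
      then have "?F (r * sin y) * 1 \<le> ?F (r * sin y) * (2 / r * \<bar>r * cos y\<bar>)"
        using r by (intro mult_left_mono) (auto simp: field_simps)
      then show ?thesis by (smt (verit) mult.left_commute mult.right_neutral powr_ge_zero)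
    next
      case False
      have "\<bar>cos y\<bar> < 1 / 2" using False r by (simp add: abs_mult)
      then have "\<bar>cos y\<bar>\<^sup>2 < (1 / 2)\<^sup>2" by (intro power_strict_mono) auto
      then have "(1 / 2)\<^sup>2 \<le> (sin y)\<^sup>2" using sin_cos_squared_add[of y] by (simp add: power2_eq_square)
      then have "1 / 2 \<le> \<bar>sin y\<bar>" by (metis abs_le_square_iff abs_of_nonneg zero_le_divide_1_iff zero_le_numeral)
      then have "r / 2 \<le> \<bar>r * sin y\<bar>" using r by (simp add: abs_mult)
      then have "?F (r * sin y) \<le> (r / 2) powr (- 3 / 4)" using r by (intro powr_mono2') auto
      then show ?thesis using r by (smt (verit) divide_nonneg_nonneg mult_nonneg_nonneg powr_ge_zero)
    qed
    then have "ennreal (?F (r * sin y)) \<le> ennreal (2 / r * (?F (r * sin y) * \<bar>r * cos y\<bar>) + (r / 2) powr (- 3 / 4))"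
      by (rule ennreal_leI)
    also have "\<dots> = ennreal (2 / r) * (ennreal (?F (r * sin y)) * ennreal \<bar>r * cos y\<bar>) + ennreal ((r / 2) powr (- 3 / 4))"
      using r by (subst ennreal_plus, simp, simp, subst ennreal_mult, simp, simp, subst ennreal_mult) auto
    finally show "ennreal (?F (r * sin y)) \<le> ennreal (2 / r) * (ennreal (?F (0 * cos y + r * sin y)) * ennreal \<bar>0 * sin y - r * cos y\<bar>)
      + ennreal ((r / 2) powr (- 3 / 4))" by simp
  qed
  also have "\<dots> = ennreal (2 / r) * (\<integral>\<^sup>+y. ennreal (?F (0 * cos y + r * sin y)) * ennreal \<bar>0 * sin y - r * cos y\<bar> \<partial>circ)
      + ennreal ((r / 2) powr (- 3 / 4))"
    using circ.emeasure_space_1 by (simp add: nn_integral_add nn_integral_cmult del: mult_zero_left)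
  also have "\<dots> = ennreal (2 / r) * (ennreal (1 / pi) *
      (\<integral>\<^sup>+u. ennreal (?F u) * indicator {- sqrt (0\<^sup>2 + r\<^sup>2)..sqrt (0\<^sup>2 + r\<^sup>2)} u \<partial>lborel)) + ennreal ((r / 2) powr (- 3 / 4))"
    by (subst circ_substitution) simp_all
  also have "\<dots> < \<infinity>"
    using nn_integral_abs_powr[of r] r by (simp add: ennreal_mult_less_top)
  finally show ?thesis .
qed

lemma circ_singular_aux:
  assumes r: "r > 0" and z: "X + \<alpha> \<noteq> 0"
  shows "(\<integral>\<^sup>+y. ennreal ((X + \<alpha> * cos y + \<beta> * sin y)\<^sup>2 / \<bar>r * sin y\<bar>) \<partial>circ) = \<infinity>"
proof -
  let ?h = "\<lambda>y. X + \<alpha> * cos y + \<beta> * sin y"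
  define m where "m = \<bar>X + \<alpha>\<bar> / 2"
  have m: "m > 0" using z by (simp add: m_def)
  have "isCont ?h 0" by (intro continuous_intros)
  then have "\<forall>\<^sub>F y in at 0. dist (?h y) (?h 0) < m" using m by (simp add: isCont_def tendsto_iff)
  then obtain d0 where d0: "d0 > 0" "\<And>y. y \<noteq> 0 \<Longrightarrow> dist y 0 < d0 \<Longrightarrow> dist (?h y) (?h 0) < m"
    by (auto simp: eventually_at)
  define d where "d = min (d0 / 2) 1"
  have d: "d > 0" "d \<le> 1" "d < d0" using d0 by (auto simp: d_def)
  have lower: "m\<^sup>2 / r * inverse y \<le> (?h y)\<^sup>2 / \<bar>r * sin y\<bar>" if y: "0 < y" "y \<le> d" for y
  proof -
    have "dist (?h y) (?h 0) < m" using y d by (intro d0(2)) (auto simp: dist_norm)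
    then have "\<bar>?h y\<bar> \<ge> m" unfolding m_def dist_norm by (simp add: abs_if split: if_splits)
    then have 1: "m\<^sup>2 \<le> (?h y)\<^sup>2" using m by (simp add: abs_le_square_iff[symmetric])
    have s: "0 < sin y" using y d pi_gt3 by (intro sin_gt_zero) auto
    have "sin y \<le> y" using y by (simp add: sin_x_le_x)
    then have "\<bar>r * sin y\<bar> \<le> r * y" "\<bar>r * sin y\<bar> > 0" using r s by (auto simp: abs_mult)
    then have "m\<^sup>2 / (r * y) \<le> (?h y)\<^sup>2 / \<bar>r * sin y\<bar>" using 1 by (intro frac_le) auto
    then show ?thesis by (simp add: divide_inverse)
  qed
  have big: "ennreal K \<le> (\<integral>\<^sup>+y. ennreal ((?h y)\<^sup>2 / \<bar>r * sin y\<bar>) \<partial>circ)" if K: "K > 0" for K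
  proof -
    define M where "M = K * (2 * pi) * r / m\<^sup>2"
    have M: "M > 0" using K r m by (simp add: M_def)
    \<comment> \<open>The integral of \<open>1 / y\<close> from \<open>e\<close> to \<open>d\<close> is then \<open>M\<close>.\<close>
    define e where "e = d * exp (- M)"
    have e: "0 < e" "e \<le> d" using d M by (auto simp: e_def)
    have fin: "(\<integral>\<^sup>+y. ennreal (m\<^sup>2 / r * inverse y) * indicator {e..d} y \<partial>lborel) = ennreal (m\<^sup>2 / r * ln d - m\<^sup>2 / r * ln e)"
      by (rule nn_integral_FTC_Icc) (use e r in \<open>auto intro!: derivative_eq_intros simp: divide_inverse\<close>)
    have "ln e = ln d - M" using d by (simp add: e_def ln_mult)
    then have "m\<^sup>2 / r * ln d - m\<^sup>2 / r * ln e = m\<^sup>2 / r * M" by (simp only: right_diff_distrib)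
    also have "\<dots> = K * (2 * pi)" using r m by (simp add: M_def)
    finally have fin2: "(\<integral>\<^sup>+y. ennreal (m\<^sup>2 / r * inverse y) * indicator {e..d} y \<partial>lborel) = ennreal (K * (2 * pi))"
      using fin by simp
    have "ennreal K = ennreal (1 / (2 * pi)) * ennreal (K * (2 * pi))"
      using K by (subst ennreal_mult[symmetric]) auto
    also have "\<dots> \<le> ennreal (1 / (2 * pi)) * (\<integral>\<^sup>+y. ennreal ((?h y)\<^sup>2 / \<bar>r * sin y\<bar>) * indicator {0..2 * pi} y \<partial>lborel)"
      unfolding fin2[symmetric]
    proof (intro mult_left_mono nn_integral_mono)
      fix y :: real
      show "ennreal (m\<^sup>2 / r * inverse y) * indicator {e..d} y \<le> ennreal ((?h y)\<^sup>2 / \<bar>r * sin y\<bar>) * indicator {0..2 * pi} y"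
      proof (cases "y \<in> {e..d}")
        case True
        then have "y \<in> {0..2 * pi}" using e d pi_gt3 by auto
        then show ?thesis using True lower[of y] e by (simp add: ennreal_leI)
      qed simp
    qed simp
    also have "\<dots> = (\<integral>\<^sup>+y. ennreal ((?h y)\<^sup>2 / \<bar>r * sin y\<bar>) \<partial>circ)"
      by (rule nn_integral_circ[symmetric]) measurable
    finally show ?thesis .
  qed
  have *: "ennreal (real n + 1) \<le> (\<integral>\<^sup>+y. ennreal ((?h y)\<^sup>2 / \<bar>r * sin y\<bar>) \<partial>circ)" for n
    by (rule big) simp
  show ?thesis
  proof (rule ccontr)
    assume "\<not> ?thesis"
    then obtain n :: nat where "(\<integral>\<^sup>+y. ennreal ((?h y)\<^sup>2 / \<bar>r * sin y\<bar>) \<partial>circ) < of_nat n"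
      by (metis ennreal_Ex_less_of_nat infinity_ennreal_def less_top)
    also have "of_nat n \<le> ennreal (real n + 1)" by (metis add_increasing2 ennreal_leI ennreal_of_nat_eq_real_of_nat order_refl zero_le_one)
    finally show False using *[of n] by simp
  qed
qed

text \<open>
  The function \<open>1 / \<bar>sin y\<bar>\<close> is not integrable, so a finite integral forces the numerator to vanish at the two
  zeros of the denominator.
\<close>

lemma circ_singular:
  assumes r: "\<eta>\<^sup>2 + \<zeta>\<^sup>2 > 0"
    and fin: "(\<integral>\<^sup>+y. ennreal ((X + \<alpha> * cos y + \<beta> * sin y)\<^sup>2 / \<bar>\<eta> * sin y - \<zeta> * cos y\<bar>) \<partial>circ) < \<infinity>"
  shows "X = 0" "\<alpha> * \<eta> + \<beta> * \<zeta> = 0"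
proof -
  have key: "X + (\<alpha> * \<eta> + \<beta> * \<zeta>) / sqrt (\<eta>\<^sup>2 + \<zeta>\<^sup>2) = 0"
    if r: "\<eta>\<^sup>2 + \<zeta>\<^sup>2 > 0"
      and fin: "(\<integral>\<^sup>+y. ennreal ((X + \<alpha> * cos y + \<beta> * sin y)\<^sup>2 / \<bar>\<eta> * sin y - \<zeta> * cos y\<bar>) \<partial>circ) < \<infinity>"
    for \<eta> \<zeta>
  proof (rule ccontr)
    define r where "r = sqrt (\<eta>\<^sup>2 + \<zeta>\<^sup>2)"
    have r0: "r > 0" "\<eta>\<^sup>2 + \<zeta>\<^sup>2 = r * r" using that by (auto simp: r_def)
    define \<alpha>' where "\<alpha>' = (\<alpha> * \<eta> + \<beta> * \<zeta>) / r"
    define \<beta>' where "\<beta>' = (\<beta> * \<eta> - \<alpha> * \<zeta>) / r"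
    assume "X + (\<alpha> * \<eta> + \<beta> * \<zeta>) / sqrt (\<eta>\<^sup>2 + \<zeta>\<^sup>2) \<noteq> 0"
    then have nz: "X + \<alpha>' \<noteq> 0" by (simp add: \<alpha>'_def r_def)
    define G :: "real \<Rightarrow> real \<Rightarrow> ennreal" where "G a b = ennreal ((X + \<alpha>' * (a / r) + \<beta>' * (b / r))\<^sup>2 / \<bar>b\<bar>)" for a b
    have e: "\<alpha>' * ((\<eta> * c + \<zeta> * s) / r) + \<beta>' * ((\<eta> * s - \<zeta> * c) / r) = \<alpha> * c + \<beta> * s" for c s
    proof -
      have "\<alpha>' * ((\<eta> * c + \<zeta> * s) / r) + \<beta>' * ((\<eta> * s - \<zeta> * c) / r)
        = ((\<alpha> * \<eta> + \<beta> * \<zeta>) * (\<eta> * c + \<zeta> * s) + (\<beta> * \<eta> - \<alpha> * \<zeta>) * (\<eta> * s - \<zeta> * c)) / (r * r)"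
        by (simp add: \<alpha>'_def \<beta>'_def flip: add_divide_distrib)
      also have "(\<alpha> * \<eta> + \<beta> * \<zeta>) * (\<eta> * c + \<zeta> * s) + (\<beta> * \<eta> - \<alpha> * \<zeta>) * (\<eta> * s - \<zeta> * c)
         = (\<alpha> * c + \<beta> * s) * (\<eta>\<^sup>2 + \<zeta>\<^sup>2)" by (simp add: power2_eq_square algebra_simps)
      finally show ?thesis using r0 by simp
    qed
    have "(\<integral>\<^sup>+y. G (\<eta> * cos y + \<zeta> * sin y) (\<eta> * sin y - \<zeta> * cos y) \<partial>circ) = (\<integral>\<^sup>+y. G (r * cos y) (r * sin y) \<partial>circ)"
      unfolding r_def by (rule circ_rotate) (unfold G_def, measurable)
    also have "\<dots> = (\<integral>\<^sup>+y. ennreal ((X + \<alpha>' * cos y + \<beta>' * sin y)\<^sup>2 / \<bar>r * sin y\<bar>) \<partial>circ)"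
      using r0(1) by (simp add: G_def)
    also have "\<dots> = \<infinity>" by (rule circ_singular_aux[OF r0(1) nz])
    also have "(\<integral>\<^sup>+y. G (\<eta> * cos y + \<zeta> * sin y) (\<eta> * sin y - \<zeta> * cos y) \<partial>circ)
      = (\<integral>\<^sup>+y. ennreal ((X + \<alpha> * cos y + \<beta> * sin y)\<^sup>2 / \<bar>\<eta> * sin y - \<zeta> * cos y\<bar>) \<partial>circ)"
      by (intro nn_integral_cong) (simp only: G_def add.assoc e)
    finally show False using fin by simp
  qed
  have 1: "X + (\<alpha> * \<eta> + \<beta> * \<zeta>) / sqrt (\<eta>\<^sup>2 + \<zeta>\<^sup>2) = 0" by (rule key[OF r fin])
  have "(\<integral>\<^sup>+y. ennreal ((X + \<alpha> * cos y + \<beta> * sin y)\<^sup>2 / \<bar>- \<eta> * sin y - - \<zeta> * cos y\<bar>) \<partial>circ) < \<infinity>"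
  proof -
    have "\<bar>- \<eta> * sin y - - \<zeta> * cos y\<bar> = \<bar>\<eta> * sin y - \<zeta> * cos y\<bar>" for y by simp
    then show ?thesis using fin by simp
  qed
  then have 2: "X + (\<alpha> * - \<eta> + \<beta> * - \<zeta>) / sqrt ((- \<eta>)\<^sup>2 + (- \<zeta>)\<^sup>2) = 0" using r by (intro key) auto
  define q where "q = (\<alpha> * \<eta> + \<beta> * \<zeta>) / sqrt (\<eta>\<^sup>2 + \<zeta>\<^sup>2)"
  have "(\<alpha> * - \<eta> + \<beta> * - \<zeta>) / sqrt ((- \<eta>)\<^sup>2 + (- \<zeta>)\<^sup>2) = - q"
    by (simp add: q_def divide_inverse algebra_simps)
  then have "X + q = 0" "X - q = 0" using 1 2 by (auto simp: q_def)
  then have "X = 0" "q = 0" by auto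
  then show "X = 0" "\<alpha> * \<eta> + \<beta> * \<zeta> = 0" using r by (auto simp: q_def)
qed

text \<open>The average of \<open>\<bar>c + \<eta> cos y + \<zeta> sin y\<bar>\<close> in closed form.\<close>

lemma circ_abs_integral:
  assumes c: "\<bar>c\<bar> < r" and r: "r = sqrt (\<eta>\<^sup>2 + \<zeta>\<^sup>2)"
  shows "(\<integral>y. \<bar>c + (\<eta> * cos y + \<zeta> * sin y)\<bar> \<partial>circ)
    = 2 / pi * (c * arcsin (c / r) + sqrt (r\<^sup>2 - c\<^sup>2))"
proof -
  \<comment> \<open>The zeros of \<open>c + r * cos y\<close> are \<open>\<alpha>\<close> and \<open>2 * pi - \<alpha>\<close>.\<close>
  define \<alpha> where "\<alpha> = arccos (- c / r)"
  have r0: "r > 0" using c by linarith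
  have cr: "-1 < - c / r" "- c / r < 1" using c r0 by (auto simp: field_simps)
  have al: "0 < \<alpha>" "\<alpha> < pi" unfolding \<alpha>_def using arccos_lt_bounded[OF cr] by auto
  have cosal: "cos \<alpha> = - c / r" unfolding \<alpha>_def using cr by (intro cos_arccos) auto
  have sinal: "r * sin \<alpha> = sqrt (r\<^sup>2 - c\<^sup>2)"
  proof -
    have "sin \<alpha> \<ge> 0" using al by (intro sin_ge_zero) auto
    then have "0 \<le> r * sin \<alpha>" using r0 by simp
    moreover have "(r * sin \<alpha>)\<^sup>2 = r\<^sup>2 - c\<^sup>2"
      using r0 by (simp add: power_mult_distrib sin_squared_eq cosal power_divide right_diff_distrib)
    ultimately show ?thesis by (metis real_sqrt_unique)
  qed
  have alas: "\<alpha> = pi / 2 + arcsin (c / r)"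
  proof -
    have "arcsin (- c / r) = - arcsin (c / r)" using arcsin_minus[of "c / r"] cr by simp
    then show ?thesis unfolding \<alpha>_def using arccos_arcsin_eq[of "- c / r"] cr by simp
  qed
  have pos: "c + r * cos y \<ge> 0 \<longleftrightarrow> cos \<alpha> \<le> cos y" for y
  proof -
    have "cos \<alpha> \<le> cos y \<longleftrightarrow> - c \<le> r * cos y" using r0 unfolding cosal by (subst pos_divide_le_eq) (auto simp: mult.commute)
    then show ?thesis by linarith
  qed
  have int: "((\<lambda>y. c + r * cos y) has_integral (c * b + r * sin b) - (c * a + r * sin a)) {a..b}" if "a \<le> b" for a b
    by (rule fundamental_theorem_of_calculus[OF that])
      (auto intro!: derivative_eq_intros simp flip: has_real_derivative_iff_has_vector_derivative)
  have int': "((\<lambda>y. - (c + r * cos y)) has_integral - ((c * b + r * sin b) - (c * a + r * sin a))) {a..b}" if "a \<le> b" for a b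
    using int[OF that] by (rule has_integral_neg)
  have p1: "((\<lambda>y. \<bar>c + r * cos y\<bar>) has_integral (c * \<alpha> + r * sin \<alpha>) - (c * 0 + r * sin 0)) {0..\<alpha>}"
  proof (rule has_integral_eq[OF _ int])
    show "c + r * cos y = \<bar>c + r * cos y\<bar>" if "y \<in> {0..\<alpha>}" for y
      using pos[of y] cos_monotone_0_pi_le[of y \<alpha>] that al by simp
  qed (use al in simp)
  have p2: "((\<lambda>y. \<bar>c + r * cos y\<bar>) has_integral - ((c * (2 * pi - \<alpha>) + r * sin (2 * pi - \<alpha>)) - (c * \<alpha> + r * sin \<alpha>))) {\<alpha>..2 * pi - \<alpha>}"
  proof (rule has_integral_eq[OF _ int'])
    show "- (c + r * cos y) = \<bar>c + r * cos y\<bar>" if y: "y \<in> {\<alpha>..2 * pi - \<alpha>}" for y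
    proof -
      have "cos y \<le> cos \<alpha>"
      proof (cases "y \<le> pi")
        case True
        then show ?thesis using y al by (intro cos_monotone_0_pi_le) auto
      next
        case False
        have "cos y = cos (2 * pi - y)" by (simp add: cos_diff)
        also have "\<dots> \<le> cos \<alpha>" using y al False by (intro cos_monotone_0_pi_le) auto
        finally show ?thesis .
      qed
      then have "c + r * cos y \<le> 0" using r0 by (simp add: cosal field_simps)
      then show ?thesis by simp
    qed
  qed (use al in simp)
  have p3: "((\<lambda>y. \<bar>c + r * cos y\<bar>) has_integral (c * (2 * pi) + r * sin (2 * pi)) - (c * (2 * pi - \<alpha>) + r * sin (2 * pi - \<alpha>))) {2 * pi - \<alpha>..2 * pi}"
  proof (rule has_integral_eq[OF _ int])
    show "c + r * cos y = \<bar>c + r * cos y\<bar>" if y: "y \<in> {2 * pi - \<alpha>..2 * pi}" for y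
    proof -
      have "cos \<alpha> \<le> cos (2 * pi - y)" using y al by (intro cos_monotone_0_pi_le) auto
      also have "\<dots> = cos y" by (simp add: cos_diff)
      finally show ?thesis using pos[of y] by simp
    qed
  qed (use al in simp)
  have "((\<lambda>y. \<bar>c + r * cos y\<bar>) has_integral
      ((c * \<alpha> + r * sin \<alpha>) - (c * 0 + r * sin 0)) + - ((c * (2 * pi - \<alpha>) + r * sin (2 * pi - \<alpha>)) - (c * \<alpha> + r * sin \<alpha>))) {0..2 * pi - \<alpha>}"
    by (rule has_integral_combine[OF _ _ p1 p2]) (use al in auto)
  then have "((\<lambda>y. \<bar>c + r * cos y\<bar>) has_integral
      (((c * \<alpha> + r * sin \<alpha>) - (c * 0 + r * sin 0)) + - ((c * (2 * pi - \<alpha>) + r * sin (2 * pi - \<alpha>)) - (c * \<alpha> + r * sin \<alpha>)))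
      + ((c * (2 * pi) + r * sin (2 * pi)) - (c * (2 * pi - \<alpha>) + r * sin (2 * pi - \<alpha>)))) {0..2 * pi}"
    by (rule has_integral_combine[rotated 2, OF _ p3]) (use al in auto)
  moreover have "(((c * \<alpha> + r * sin \<alpha>) - (c * 0 + r * sin 0)) + - ((c * (2 * pi - \<alpha>) + r * sin (2 * pi - \<alpha>)) - (c * \<alpha> + r * sin \<alpha>)))
      + ((c * (2 * pi) + r * sin (2 * pi)) - (c * (2 * pi - \<alpha>) + r * sin (2 * pi - \<alpha>)))
     = 4 * (c * arcsin (c / r) + sqrt (r\<^sup>2 - c\<^sup>2))"
  proof -
    have "sin (2 * pi - \<alpha>) = - sin \<alpha>" by (simp add: sin_diff)
    moreover have "c * \<alpha> = c * (pi / 2) + c * arcsin (c / r)" by (simp add: alas algebra_simps)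
    ultimately show ?thesis using sinal by (simp add: algebra_simps)
  qed
  ultimately have I: "((\<lambda>y. \<bar>c + r * cos y\<bar>) has_integral 4 * (c * arcsin (c / r) + sqrt (r\<^sup>2 - c\<^sup>2))) {0..2 * pi}"
    by simp
  have "(\<integral>\<^sup>+y. ennreal \<bar>c + (\<eta> * cos y + \<zeta> * sin y)\<bar> \<partial>circ) = (\<integral>\<^sup>+y. ennreal \<bar>c + r * cos y\<bar> \<partial>circ)"
    unfolding r by (rule circ_rotate[where G = "\<lambda>a b. ennreal \<bar>c + a\<bar>"]) measurable
  also have "\<dots> = ennreal (1 / (2 * pi)) * (\<integral>\<^sup>+y. ennreal \<bar>c + r * cos y\<bar> * indicator {0..2 * pi} y \<partial>lborel)"
    by (rule nn_integral_circ) measurable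
  also have "(\<integral>\<^sup>+y. ennreal \<bar>c + r * cos y\<bar> * indicator {0..2 * pi} y \<partial>lborel)
      = (\<integral>\<^sup>+y. indicator {0..2 * pi} y * \<bar>c + r * cos y\<bar> \<partial>lborel)"
    by (intro nn_integral_cong) (simp add: indicator_def)
  also have "\<dots> = ennreal (4 * (c * arcsin (c / r) + sqrt (r\<^sup>2 - c\<^sup>2)))"
    by (rule nn_integral_has_integral_lebesgue[OF _ I]) simp
  also have "ennreal (1 / (2 * pi)) * \<dots> = ennreal (1 / (2 * pi) * (4 * (c * arcsin (c / r) + sqrt (r\<^sup>2 - c\<^sup>2))))"
    using has_integral_nonneg[OF I] by (intro ennreal_mult[symmetric]) auto
  finally have n: "(\<integral>\<^sup>+y. ennreal \<bar>c + (\<eta> * cos y + \<zeta> * sin y)\<bar> \<partial>circ) =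
      ennreal (1 / (2 * pi) * (4 * (c * arcsin (c / r) + sqrt (r\<^sup>2 - c\<^sup>2))))" .
  have "(\<integral>y. \<bar>c + (\<eta> * cos y + \<zeta> * sin y)\<bar> \<partial>circ) = 1 / (2 * pi) * (4 * (c * arcsin (c / r) + sqrt (r\<^sup>2 - c\<^sup>2)))"
    using n has_integral_nonneg[OF I] by (subst integral_eq_nn_integral) auto
  then show ?thesis by (simp add: algebra_simps add_divide_distrib)
qed

section \<open>Second order expansion of the average over one angle\<close>

text \<open>
  The defect of linearity of the absolute value at \<open>a\<close>. It vanishes unless \<open>b\<close> can change the sign of \<open>a\<close>.
\<close>

definition gap :: "real \<Rightarrow> real \<Rightarrow> real" where
  "gap a b = \<bar>a + b\<bar> - \<bar>a\<bar> - sgn a * b"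

lemma gap_nonneg: "0 \<le> gap a b"
  by (auto simp: gap_def sgn_if abs_if)

lemma gap_le: "gap a b \<le> 2 * \<bar>b\<bar>"
  by (auto simp: gap_def sgn_if abs_if)

lemma gap_eq_0: "\<bar>b\<bar> < \<bar>a\<bar> \<Longrightarrow> gap a b = 0"
  by (auto simp: gap_def sgn_if abs_if split: if_splits)

lemma gap_measurable [measurable (raw)]:
  assumes [measurable]: "f \<in> borel_measurable M" "h \<in> borel_measurable M"
  shows "(\<lambda>x. gap (f x) (h x)) \<in> borel_measurable M"
  unfolding gap_def by measurable

text \<open>
  A constant plus a harmonic wave. The constant collects the contribution of all other angles.
\<close>

definition wave :: "real \<Rightarrow> real \<Rightarrow> real \<Rightarrow> real \<Rightarrow> real" where
  "wave c \<eta> \<zeta> y = c + (\<eta> * cos y + \<zeta> * sin y)"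

lemma wave_measurable [measurable]: "wave c \<eta> \<zeta> \<in> borel_measurable borel"
  unfolding wave_def[abs_def] by measurable

lemma wave_bound: "\<bar>wave c \<eta> \<zeta> y\<bar> \<le> \<bar>c\<bar> + \<bar>\<eta>\<bar> + \<bar>\<zeta>\<bar>"
proof -
  have "\<bar>wave c \<eta> \<zeta> y\<bar> \<le> \<bar>c\<bar> + (\<bar>\<eta> * cos y\<bar> + \<bar>\<zeta> * sin y\<bar>)"
    unfolding wave_def by linarith
  also have "\<bar>\<eta> * cos y\<bar> \<le> \<bar>\<eta>\<bar>" by (simp add: abs_mult mult_left_le)
  also have "\<bar>\<zeta> * sin y\<bar> \<le> \<bar>\<zeta>\<bar>" by (simp add: abs_mult mult_left_le)
  finally show ?thesis by simp
qed

lemma wave_add: "wave c \<eta> \<zeta> y + t * wave \<gamma> \<eta>' \<zeta>' y = wave (c + t * \<gamma>) (\<eta> + t * \<eta>') (\<zeta> + t * \<zeta>') y"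
  by (simp add: wave_def algebra_simps)

lemma integrable_circ_bounded:
  fixes f :: "real \<Rightarrow> real"
  assumes "f \<in> borel_measurable borel" "\<And>y. \<bar>f y\<bar> \<le> B" shows "integrable circ f"
  by (rule circ.integrable_const_bound[where B = B]) (use assms in \<open>auto simp: measurable_cong_sets[OF sets_circ refl]\<close>)

text \<open>
  The average of \<open>\<bar>wave c \<eta> \<zeta>\<bar>\<close> for \<open>c\<^sup>2 < \<eta>\<^sup>2 + \<zeta>\<^sup>2\<close>, followed by its second and first derivatives in the direction
  \<open>(\<gamma>, \<eta>', \<zeta>')\<close>.
\<close>

definition avg_abs :: "real \<Rightarrow> real \<Rightarrow> real \<Rightarrow> real" where
  "avg_abs c \<eta> \<zeta> = 2 / pi * (c * arcsin (c / sqrt (\<eta>\<^sup>2 + \<zeta>\<^sup>2)) + sqrt (\<eta>\<^sup>2 + \<zeta>\<^sup>2 - c\<^sup>2))"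

definition curv :: "real \<Rightarrow> real \<Rightarrow> real \<Rightarrow> real \<Rightarrow> real \<Rightarrow> real \<Rightarrow> real" where
  "curv c \<eta> \<zeta> \<gamma> \<eta>' \<zeta>' =
     2 / pi * ((\<gamma> - c * (\<eta> * \<eta>' + \<zeta> * \<zeta>') / (\<eta>\<^sup>2 + \<zeta>\<^sup>2))\<^sup>2 / sqrt (\<eta>\<^sup>2 + \<zeta>\<^sup>2 - c\<^sup>2)
       + (\<eta> * \<zeta>' - \<zeta> * \<eta>')\<^sup>2 * sqrt (\<eta>\<^sup>2 + \<zeta>\<^sup>2 - c\<^sup>2) / (\<eta>\<^sup>2 + \<zeta>\<^sup>2)\<^sup>2)"

definition slope :: "real \<Rightarrow> real \<Rightarrow> real \<Rightarrow> real \<Rightarrow> real \<Rightarrow> real \<Rightarrow> real" where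
  "slope c \<eta> \<zeta> \<gamma> \<eta>' \<zeta>' =
     2 / pi * (\<gamma> * arcsin (c / sqrt (\<eta>\<^sup>2 + \<zeta>\<^sup>2))
       + (\<eta> * \<eta>' + \<zeta> * \<zeta>') * sqrt (\<eta>\<^sup>2 + \<zeta>\<^sup>2 - c\<^sup>2) / (\<eta>\<^sup>2 + \<zeta>\<^sup>2))"

lemma avg_abs_eq:
  assumes "c\<^sup>2 < \<eta>\<^sup>2 + \<zeta>\<^sup>2" shows "(\<integral>y. \<bar>wave c \<eta> \<zeta> y\<bar> \<partial>circ) = avg_abs c \<eta> \<zeta>"
proof -
  have "\<bar>c\<bar> < sqrt (\<eta>\<^sup>2 + \<zeta>\<^sup>2)" using real_sqrt_less_mono[OF assms] by simp
  from circ_abs_integral[OF this refl] show ?thesis by (simp add: wave_def avg_abs_def)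
qed

lemma arcsin_quot_deriv:
  assumes "C s ^ 2 < R s" "(C has_real_derivative \<gamma>) (at s)" "(R has_real_derivative R') (at s)"
  shows "((\<lambda>s. arcsin (C s / sqrt (R s))) has_real_derivative
    ((\<gamma> - C s * R' / (2 * R s)) / sqrt (R s - (C s)\<^sup>2))) (at s)"
proof -
  have R: "R s > 0" using assms(1) by (meson le_less_trans zero_le_power2)
  have b: "(C s / sqrt (R s))\<^sup>2 < 1" using assms(1) R by (simp add: power_divide)
  then have b': "\<bar>C s / sqrt (R s)\<bar> < 1" by (simp add: abs_square_less_1)
  have dq: "((\<lambda>s. C s / sqrt (R s)) has_real_derivative
      (\<gamma> * sqrt (R s) - C s * (R' * (inverse (sqrt (R s)) / 2))) / (sqrt (R s) * sqrt (R s))) (at s)"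
    using R by (auto intro!: derivative_eq_intros assms(2,3))
  have lt: "-1 < C s / sqrt (R s)" "C s / sqrt (R s) < 1"
    using b' unfolding abs_less_iff by linarith+
    have "((\<lambda>s. arcsin (C s / sqrt (R s))) has_real_derivative
     inverse (sqrt (1 - (C s / sqrt (R s))\<^sup>2)) * ((\<gamma> * sqrt (R s) - C s * (R' * (inverse (sqrt (R s)) / 2))) / (sqrt (R s) * sqrt (R s)))) (at s)"
    by (rule DERIV_chain2[where f = arcsin and g = "\<lambda>s. C s / sqrt (R s)", OF DERIV_arcsin[OF lt] dq])
  moreover
  have "inverse (sqrt (1 - (C s / sqrt (R s))\<^sup>2)) * ((\<gamma> * sqrt (R s) - C s * (R' * (inverse (sqrt (R s)) / 2))) / (sqrt (R s) * sqrt (R s)))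
    = (\<gamma> - C s * R' / (2 * R s)) / sqrt (R s - (C s)\<^sup>2)"
  proof -
    define q where "q = sqrt (R s)"
    have q: "q > 0" "q * q = R s" using R by (auto simp: q_def)
    have "1 - (C s / q)\<^sup>2 = (R s - (C s)\<^sup>2) / (q * q)" using q R by (simp add: power_divide power2_eq_square diff_divide_distrib)
    then have e1: "sqrt (1 - (C s / q)\<^sup>2) = sqrt (R s - (C s)\<^sup>2) / q" using q(1) by (simp add: real_sqrt_divide)
    have e2: "(\<gamma> * q - C s * (R' * (inverse q / 2))) / (q * q) = (\<gamma> - C s * R' / (2 * (q * q))) / q"
      using q(1) by (simp add: field_simps)
    have "inverse (S / q) * (N / q) = N / S" for S N :: real
      using q(1) by (simp add: divide_inverse)
    then show ?thesis unfolding q_def[symmetric] e1 e2 by (simp only: q(2))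
  qed
  ultimately show ?thesis by simp
qed

lemma avg_abs_deriv:
  assumes "(c + s * \<gamma>)\<^sup>2 < (\<eta> + s * \<eta>')\<^sup>2 + (\<zeta> + s * \<zeta>')\<^sup>2"
  shows "((\<lambda>s. avg_abs (c + s * \<gamma>) (\<eta> + s * \<eta>') (\<zeta> + s * \<zeta>')) has_real_derivative
     slope (c + s * \<gamma>) (\<eta> + s * \<eta>') (\<zeta> + s * \<zeta>') \<gamma> \<eta>' \<zeta>') (at s)"
    and "((\<lambda>s. slope (c + s * \<gamma>) (\<eta> + s * \<eta>') (\<zeta> + s * \<zeta>') \<gamma> \<eta>' \<zeta>') has_real_derivative
     curv (c + s * \<gamma>) (\<eta> + s * \<eta>') (\<zeta> + s * \<zeta>') \<gamma> \<eta>' \<zeta>') (at s)"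
proof -
  define C where "C s = c + s * \<gamma>" for s
  define R where "R s = (\<eta> + s * \<eta>')\<^sup>2 + (\<zeta> + s * \<zeta>')\<^sup>2" for s
  define W where "W s = (\<eta> + s * \<eta>') * \<eta>' + (\<zeta> + s * \<zeta>') * \<zeta>'" for s
  define X where "X = (\<eta> + s * \<eta>') * \<zeta>' - (\<zeta> + s * \<zeta>') * \<eta>'"
  have lt: "C s ^ 2 < R s" using assms by (simp add: C_def R_def)
  have R: "R s > 0" using lt by (meson le_less_trans zero_le_power2)
  have dC: "(C has_real_derivative \<gamma>) (at s)" unfolding C_def by (auto intro!: derivative_eq_intros)
  have dR: "(R has_real_derivative 2 * W s) (at s)" unfolding R_def W_def
    by (auto intro!: derivative_eq_intros simp: algebra_simps)
  have dW: "(W has_real_derivative \<eta>'\<^sup>2 + \<zeta>'\<^sup>2) (at s)" unfolding W_def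
    by (auto intro!: derivative_eq_intros simp: power2_eq_square)
  define D where "D = sqrt (R s - (C s)\<^sup>2)"
  have D: "D > 0" "D * D = R s - (C s)\<^sup>2" using lt by (auto simp: D_def)
  have da: "((\<lambda>s. arcsin (C s / sqrt (R s))) has_real_derivative ((\<gamma> - C s * W s / R s) / D)) (at s)"
    using arcsin_quot_deriv[OF lt dC dR] by (simp add: D_def)
  have ds: "((\<lambda>s. sqrt (R s - (C s)\<^sup>2)) has_real_derivative ((W s - C s * \<gamma>) / D)) (at s)"
  proof -
    have d: "((\<lambda>s. R s - (C s)\<^sup>2) has_real_derivative 2 * W s - 2 * (C s * \<gamma>)) (at s)"
      by (rule DERIV_diff[OF dR]) (auto intro!: derivative_eq_intros dC)
    have "((\<lambda>s. sqrt (R s - (C s)\<^sup>2)) has_real_derivative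
        inverse (sqrt (R s - (C s)\<^sup>2)) / 2 * (2 * W s - 2 * (C s * \<gamma>))) (at s)"
      by (rule DERIV_chain2[where f = sqrt and g = "\<lambda>s. R s - (C s)\<^sup>2", OF DERIV_real_sqrt d]) (use lt in simp)
    moreover have "inverse (sqrt (R s - (C s)\<^sup>2)) / 2 * (2 * W s - 2 * (C s * \<gamma>)) = (W s - C s * \<gamma>) / D"
      unfolding D_def[symmetric] using D(1) by (simp add: field_simps)
    ultimately show ?thesis by (simp only:)
  qed
  have XW: "(\<eta>'\<^sup>2 + \<zeta>'\<^sup>2) * R s = (W s)\<^sup>2 + X\<^sup>2"
    unfolding R_def W_def X_def by (simp add: power2_eq_square algebra_simps)
  have "((\<lambda>s. 2 / pi * (C s * arcsin (C s / sqrt (R s)) + sqrt (R s - (C s)\<^sup>2))) has_real_derivative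
     2 / pi * (\<gamma> * arcsin (C s / sqrt (R s)) + W s * D / R s)) (at s)"
  proof -
    have "C s * ((\<gamma> - C s * W s / R s) / D) + (W s - C s * \<gamma>) / D = W s * ((R s - (C s)\<^sup>2) / R s) / D"
      using R D(1) by (simp add: field_simps power2_eq_square)
    also have "\<dots> = W s * D / R s" unfolding D(2)[symmetric] using D(1) by simp
    finally have e: "\<gamma> * arcsin (C s / sqrt (R s)) + (\<gamma> - C s * W s / R s) / D * C s + (W s - C s * \<gamma>) / D
        = \<gamma> * arcsin (C s / sqrt (R s)) + W s * D / R s"
      by (simp add: mult.commute)
    have "((\<lambda>s. C s * arcsin (C s / sqrt (R s)) + sqrt (R s - (C s)\<^sup>2)) has_real_derivative
      \<gamma> * arcsin (C s / sqrt (R s)) + (\<gamma> - C s * W s / R s) / D * C s + (W s - C s * \<gamma>) / D) (at s)"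
      by (rule DERIV_add[OF DERIV_mult[OF dC da] ds])
    then show ?thesis unfolding e by (rule DERIV_cmult)
  qed
  then show "((\<lambda>s. avg_abs (c + s * \<gamma>) (\<eta> + s * \<eta>') (\<zeta> + s * \<zeta>')) has_real_derivative
     slope (c + s * \<gamma>) (\<eta> + s * \<eta>') (\<zeta> + s * \<zeta>') \<gamma> \<eta>' \<zeta>') (at s)"
    by (simp add: avg_abs_def slope_def C_def R_def W_def D_def)
  have "((\<lambda>s. 2 / pi * (\<gamma> * arcsin (C s / sqrt (R s)) + W s * sqrt (R s - (C s)\<^sup>2) / R s)) has_real_derivative
     2 / pi * ((\<gamma> - C s * W s / R s)\<^sup>2 / D + X\<^sup>2 * D / (R s)\<^sup>2)) (at s)"
  proof (rule DERIV_cmult)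
    have q: "((\<lambda>s. W s * sqrt (R s - (C s)\<^sup>2) / R s) has_real_derivative
       (((\<eta>'\<^sup>2 + \<zeta>'\<^sup>2) * D + (W s - C s * \<gamma>) / D * W s) * R s - W s * D * (2 * W s)) / (R s * R s)) (at s)"
      using R by (intro DERIV_divide[OF DERIV_mult[OF dW ds] dR, folded D_def]) auto
    have "((\<lambda>s. \<gamma> * arcsin (C s / sqrt (R s)) + W s * sqrt (R s - (C s)\<^sup>2) / R s) has_real_derivative
      (\<gamma> * ((\<gamma> - C s * W s / R s) / D) +
       (((\<eta>'\<^sup>2 + \<zeta>'\<^sup>2) * D + (W s - C s * \<gamma>) / D * W s) * R s - W s * D * (2 * W s)) / (R s * R s))) (at s)"
      by (intro DERIV_add DERIV_cmult da q)
    moreover have "\<gamma> * ((\<gamma> - C s * W s / R s) / D) +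
       (((\<eta>'\<^sup>2 + \<zeta>'\<^sup>2) * D + (W s - C s * \<gamma>) / D * W s) * R s - W s * D * (2 * W s)) / (R s * R s)
       = (\<gamma> - C s * W s / R s)\<^sup>2 / D + X\<^sup>2 * D / (R s)\<^sup>2"
    proof -
      define r where "r = W s / R s"
      have w: "W s = r * R s" using R by (simp add: r_def)
      have v: "(\<eta>'\<^sup>2 + \<zeta>'\<^sup>2) * D * R s = (W s)\<^sup>2 * D + X\<^sup>2 * D"
        using XW by (simp only: mult.assoc mult.commute[of D] distrib_right[symmetric]) (simp only: mult.assoc[symmetric])
      have "(((\<eta>'\<^sup>2 + \<zeta>'\<^sup>2) * D + (W s - C s * \<gamma>) / D * W s) * R s - W s * D * (2 * W s))
         = X\<^sup>2 * D - (W s)\<^sup>2 * D + (W s - C s * \<gamma>) * W s * R s / D"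
        using v by (simp add: algebra_simps power2_eq_square)
      also have "\<dots> / (R s * R s) = X\<^sup>2 * D / (R s)\<^sup>2 - r\<^sup>2 * D + (r * R s - C s * \<gamma>) * r / D"
        using R D(1) unfolding w by (simp add: field_simps power2_eq_square)
      finally have 1: "(((\<eta>'\<^sup>2 + \<zeta>'\<^sup>2) * D + (W s - C s * \<gamma>) / D * W s) * R s - W s * D * (2 * W s)) / (R s * R s)
         = X\<^sup>2 * D / (R s)\<^sup>2 - r\<^sup>2 * D + (r * R s - C s * \<gamma>) * r / D" .
      have 2: "r\<^sup>2 * D = r\<^sup>2 * (R s - (C s)\<^sup>2) / D" unfolding D(2)[symmetric] using D(1) by simp
      have 3: "C s * W s / R s = C s * r" by (simp add: r_def)
      show ?thesis unfolding 1 2 3 using D(1) by (simp add: field_simps power2_eq_square)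
    qed
    ultimately show "((\<lambda>s. \<gamma> * arcsin (C s / sqrt (R s)) + W s * sqrt (R s - (C s)\<^sup>2) / R s) has_real_derivative
     (\<gamma> - C s * W s / R s)\<^sup>2 / D + X\<^sup>2 * D / (R s)\<^sup>2) (at s)" by simp
  qed
  then show "((\<lambda>s. slope (c + s * \<gamma>) (\<eta> + s * \<eta>') (\<zeta> + s * \<zeta>') \<gamma> \<eta>' \<zeta>') has_real_derivative
     curv (c + s * \<gamma>) (\<eta> + s * \<eta>') (\<zeta> + s * \<zeta>') \<gamma> \<eta>' \<zeta>') (at s)"
    by (simp add: curv_def slope_def C_def R_def W_def D_def X_def)
qed

text \<open>
  The average of the gap over one angle.
\<close>

definition gap_int :: "real \<Rightarrow> real \<Rightarrow> real \<Rightarrow> real \<Rightarrow> real \<Rightarrow> real \<Rightarrow> real" where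
  "gap_int c \<eta> \<zeta> \<gamma> \<eta>' \<zeta>' = (\<integral>y. gap (wave c \<eta> \<zeta> y) (wave \<gamma> \<eta>' \<zeta>' y) \<partial>circ)"

lemma gap_int_nonneg: "0 \<le> gap_int c \<eta> \<zeta> \<gamma> \<eta>' \<zeta>'"
  unfolding gap_int_def by (intro integral_nonneg_AE) (simp add: gap_nonneg)

lemma gap_int_eq:
  fixes t :: real
  assumes c: "c\<^sup>2 < \<eta>\<^sup>2 + \<zeta>\<^sup>2" and ct: "(c + t * \<gamma>)\<^sup>2 < (\<eta> + t * \<eta>')\<^sup>2 + (\<zeta> + t * \<zeta>')\<^sup>2"
  shows "gap_int c \<eta> \<zeta> (t * \<gamma>) (t * \<eta>') (t * \<zeta>') =
    avg_abs (c + t * \<gamma>) (\<eta> + t * \<eta>') (\<zeta> + t * \<zeta>') - avg_abs c \<eta> \<zeta> - t * slope c \<eta> \<zeta> \<gamma> \<eta>' \<zeta>'"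
proof -
  \<comment> \<open>The average of the sign term is a subgradient of the differentiable function \<open>avg_abs\<close>, hence its derivative.\<close>
  define m where "m = (\<integral>y. sgn (wave c \<eta> \<zeta> y) * wave \<gamma> \<eta>' \<zeta>' y \<partial>circ)"
  have gi: "gap_int c \<eta> \<zeta> (s * \<gamma>) (s * \<eta>') (s * \<zeta>') =
      avg_abs (c + s * \<gamma>) (\<eta> + s * \<eta>') (\<zeta> + s * \<zeta>') - avg_abs c \<eta> \<zeta> - s * m"
    if "(c + s * \<gamma>)\<^sup>2 < (\<eta> + s * \<eta>')\<^sup>2 + (\<zeta> + s * \<zeta>')\<^sup>2" for s
  proof -
    have i1: "integrable circ (\<lambda>y. \<bar>wave c' e z y\<bar>)" for c' e z
      by (rule integrable_circ_bounded[of _ "\<bar>c'\<bar> + \<bar>e\<bar> + \<bar>z\<bar>"]) (use wave_bound in auto)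
    have i2: "integrable circ (\<lambda>y. s * (sgn (wave c \<eta> \<zeta> y) * wave \<gamma> \<eta>' \<zeta>' y))"
    proof (rule integrable_circ_bounded[of _ "\<bar>s\<bar> * (\<bar>\<gamma>\<bar> + \<bar>\<eta>'\<bar> + \<bar>\<zeta>'\<bar>)"])
      show "\<bar>s * (sgn (wave c \<eta> \<zeta> y) * wave \<gamma> \<eta>' \<zeta>' y)\<bar> \<le> \<bar>s\<bar> * (\<bar>\<gamma>\<bar> + \<bar>\<eta>'\<bar> + \<bar>\<zeta>'\<bar>)" for y
      proof -
        have "\<bar>sgn (wave c \<eta> \<zeta> y)\<bar> * \<bar>wave \<gamma> \<eta>' \<zeta>' y\<bar> \<le> 1 * (\<bar>\<gamma>\<bar> + \<bar>\<eta>'\<bar> + \<bar>\<zeta>'\<bar>)"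
          using wave_bound[of \<gamma> \<eta>' \<zeta>' y] by (intro mult_mono) (auto simp: sgn_if)
        then show ?thesis by (simp add: abs_mult mult_left_mono)
      qed
    qed measurable
    have e: "wave (s * \<gamma>) (s * \<eta>') (s * \<zeta>') y = s * wave \<gamma> \<eta>' \<zeta>' y" for y
      by (simp add: wave_def algebra_simps)
    have "gap_int c \<eta> \<zeta> (s * \<gamma>) (s * \<eta>') (s * \<zeta>') =
      (\<integral>y. \<bar>wave (c + s * \<gamma>) (\<eta> + s * \<eta>') (\<zeta> + s * \<zeta>') y\<bar> - \<bar>wave c \<eta> \<zeta> y\<bar> - s * (sgn (wave c \<eta> \<zeta> y) * wave \<gamma> \<eta>' \<zeta>' y) \<partial>circ)"
      unfolding gap_int_def gap_def e wave_add by (intro Bochner_Integration.integral_cong) (auto simp: algebra_simps)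
    also have "\<dots> = avg_abs (c + s * \<gamma>) (\<eta> + s * \<eta>') (\<zeta> + s * \<zeta>') - avg_abs c \<eta> \<zeta> - s * m"
      using i1 i2 by (simp add: m_def avg_abs_eq c that)
    finally show ?thesis .
  qed
  have "m = slope c \<eta> \<zeta> \<gamma> \<eta>' \<zeta>'"
  proof -
    define f where "f s = avg_abs (c + s * \<gamma>) (\<eta> + s * \<eta>') (\<zeta> + s * \<zeta>') - s * m" for s
    have "((\<lambda>s. avg_abs (c + s * \<gamma>) (\<eta> + s * \<eta>') (\<zeta> + s * \<zeta>')) has_real_derivative slope c \<eta> \<zeta> \<gamma> \<eta>' \<zeta>') (at 0)"
      using avg_abs_deriv(1)[of c 0 \<gamma> \<eta> \<eta>' \<zeta> \<zeta>'] c by simp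
    then have df: "(f has_real_derivative slope c \<eta> \<zeta> \<gamma> \<eta>' \<zeta>' - m) (at 0)"
      unfolding f_def[abs_def] by (auto intro!: derivative_eq_intros)
    have "open {s. 0 < (\<eta> + s * \<eta>')\<^sup>2 + (\<zeta> + s * \<zeta>')\<^sup>2 - (c + s * \<gamma>)\<^sup>2}"
      by (intro open_Collect_less continuous_intros)
    then have "\<forall>\<^sub>F s in nhds 0. (\<eta> + s * \<eta>')\<^sup>2 + (\<zeta> + s * \<zeta>')\<^sup>2 - (c + s * \<gamma>)\<^sup>2 > 0"
      using eventually_nhds_in_open[of _ "0::real"] c by force
    then have "\<forall>\<^sub>F s in nhds 0. f 0 \<le> f s"
    proof eventually_elim
      case (elim s)
      then have "0 \<le> avg_abs (c + s * \<gamma>) (\<eta> + s * \<eta>') (\<zeta> + s * \<zeta>') - avg_abs c \<eta> \<zeta> - s * m"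
        using gi[of s] gap_int_nonneg[of c \<eta> \<zeta> "s * \<gamma>" "s * \<eta>'" "s * \<zeta>'"] by simp
      then show ?case by (simp add: f_def)
    qed
    then obtain d where "d > 0" "\<And>s. dist s 0 < d \<Longrightarrow> f 0 \<le> f s" unfolding eventually_nhds_metric by blast
    then have "slope c \<eta> \<zeta> \<gamma> \<eta>' \<zeta>' - m = 0"
      by (intro DERIV_local_min[OF df, of d]) (auto simp: dist_real_def)
    then show ?thesis by simp
  qed
  then show ?thesis using gi[OF ct] by simp
qed

lemma norm_pair: "norm (a :: real, b :: real) = sqrt (a\<^sup>2 + b\<^sup>2)"
  by (simp add: norm_Pair)

text \<open>
  Where \<open>\<bar>c\<bar> < sqrt (\<eta>\<^sup>2 + \<zeta>\<^sup>2)\<close>, the average gap has the second order expansion given by \<open>curv\<close>, uniformly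
  in the base point and in the direction.
\<close>

lemma gap_int_limit:
  fixes T :: "nat \<Rightarrow> real"
  assumes c: "c\<^sup>2 < \<eta>\<^sup>2 + \<zeta>\<^sup>2" and T: "T \<longlonglongrightarrow> 0" "\<And>n. 0 < T n"
    and l: "C \<longlonglongrightarrow> c" "E \<longlonglongrightarrow> \<eta>" "Z \<longlonglongrightarrow> \<zeta>" "G \<longlonglongrightarrow> \<gamma>" "E' \<longlonglongrightarrow> \<eta>'" "Z' \<longlonglongrightarrow> \<zeta>'"
  shows "(\<lambda>n. gap_int (C n) (E n) (Z n) (T n * G n) (T n * E' n) (T n * Z' n) / (T n)\<^sup>2)
    \<longlonglongrightarrow> curv c \<eta> \<zeta> \<gamma> \<eta>' \<zeta>' / 2"
proof -
  have cr: "\<bar>c\<bar> < norm (\<eta>, \<zeta>)" using real_sqrt_less_mono[OF c] by (simp add: norm_pair)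
  have "(\<lambda>n. norm (E n, Z n) - T n * norm (E' n, Z' n) - (\<bar>C n\<bar> + T n * \<bar>G n\<bar>))
      \<longlonglongrightarrow> norm (\<eta>, \<zeta>) - 0 * norm (\<eta>', \<zeta>') - (\<bar>c\<bar> + 0 * \<bar>\<gamma>\<bar>)"
    by (intro tendsto_intros T l)
  then have ev: "\<forall>\<^sub>F n in sequentially. norm (E n, Z n) - T n * norm (E' n, Z' n) - (\<bar>C n\<bar> + T n * \<bar>G n\<bar>) > 0"
    using cr by (intro order_tendstoD(1)) auto
  have seg: "(C n + s * G n)\<^sup>2 < (E n + s * E' n)\<^sup>2 + (Z n + s * Z' n)\<^sup>2"
    if n: "norm (E n, Z n) - T n * norm (E' n, Z' n) - (\<bar>C n\<bar> + T n * \<bar>G n\<bar>) > 0" and s: "0 \<le> s" "s \<le> T n" for n s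
  proof -
    have "norm (E n, Z n) \<le> norm ((E n, Z n) + s *\<^sub>R (E' n, Z' n)) + norm (s *\<^sub>R (E' n, Z' n))"
      using norm_triangle_ineq4[of "(E n, Z n) + s *\<^sub>R (E' n, Z' n)" "s *\<^sub>R (E' n, Z' n)"] by simp
    also have "norm (s *\<^sub>R (E' n, Z' n)) = s * norm (E' n, Z' n)"
      unfolding norm_scaleR using s by simp
    also have "\<dots> \<le> T n * norm (E' n, Z' n)" using s by (intro mult_right_mono) auto
    finally have 1: "norm (E n, Z n) \<le> norm (E n + s * E' n, Z n + s * Z' n) + T n * norm (E' n, Z' n)" by simp
    have "\<bar>C n + s * G n\<bar> \<le> \<bar>C n\<bar> + s * \<bar>G n\<bar>" using s by (metis abs_mult abs_of_nonneg abs_triangle_ineq)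
    also have "\<dots> \<le> \<bar>C n\<bar> + T n * \<bar>G n\<bar>" using s by (intro add_left_mono mult_right_mono) auto
    finally have "\<bar>C n + s * G n\<bar> < norm (E n + s * E' n, Z n + s * Z' n)" using 1 n by linarith
    then have "\<bar>C n + s * G n\<bar>\<^sup>2 < (norm (E n + s * E' n, Z n + s * Z' n))\<^sup>2" by (intro power_strict_mono) auto
    then show ?thesis by (simp add: norm_pair)
  qed
  \<comment> \<open>Taylor's formula with Lagrange remainder along the segment.\<close>
  have "\<exists>\<xi>. 0 < \<xi> \<and> \<xi> < T n \<and> gap_int (C n) (E n) (Z n) (T n * G n) (T n * E' n) (T n * Z' n) / (T n)\<^sup>2
      = curv (C n + \<xi> * G n) (E n + \<xi> * E' n) (Z n + \<xi> * Z' n) (G n) (E' n) (Z' n) / 2"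
    if n: "norm (E n, Z n) - T n * norm (E' n, Z' n) - (\<bar>C n\<bar> + T n * \<bar>G n\<bar>) > 0" for n
  proof -
    define f where "f s = avg_abs (C n + s * G n) (E n + s * E' n) (Z n + s * Z' n)" for s
    define f1 where "f1 s = slope (C n + s * G n) (E n + s * E' n) (Z n + s * Z' n) (G n) (E' n) (Z' n)" for s
    define f2 where "f2 s = curv (C n + s * G n) (E n + s * E' n) (Z n + s * Z' n) (G n) (E' n) (Z' n)" for s
    define df where "df m = (if m = 0 then f else if m = 1 then f1 else f2)" for m :: nat
    have "\<forall>m s. m < 2 \<and> 0 \<le> s \<and> s \<le> T n \<longrightarrow> DERIV (df m) s :> df (Suc m) s"
    proof (intro allI impI)
      fix m :: nat and s assume "m < 2 \<and> 0 \<le> s \<and> s \<le> T n"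
      then show "DERIV (df m) s :> df (Suc m) s"
        using avg_abs_deriv[OF seg[OF n, of s]]
        by (cases "m = 0") (auto simp: df_def f_def[abs_def] f1_def[abs_def] f2_def)
    qed
    from Maclaurin[OF T(2) _ _ this, of f] obtain \<xi> where
      xi: "0 < \<xi>" "\<xi> < T n" "f (T n) = (\<Sum>m<2. df m 0 / fact m * T n ^ m) + df 2 \<xi> / fact 2 * (T n)\<^sup>2"
      by (auto simp: df_def)
    have "f (T n) = f 0 + f1 0 * T n + f2 \<xi> / 2 * (T n)\<^sup>2"
      using xi(3) by (simp add: df_def numeral_2_eq_2)
    moreover have "gap_int (C n) (E n) (Z n) (T n * G n) (T n * E' n) (T n * Z' n) = f (T n) - f 0 - T n * f1 0"
      using gap_int_eq[of "C n" "E n" "Z n" "T n" "G n" "E' n" "Z' n"] seg[OF n, of 0] seg[OF n, of "T n"] T(2)[of n]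
      by (simp add: f_def f1_def less_imp_le)
    ultimately have "gap_int (C n) (E n) (Z n) (T n * G n) (T n * E' n) (T n * Z' n) = f2 \<xi> / 2 * (T n)\<^sup>2" by simp
    then have "gap_int (C n) (E n) (Z n) (T n * G n) (T n * E' n) (T n * Z' n) / (T n)\<^sup>2 = f2 \<xi> / 2"
      using T(2)[of n] by simp
    then show ?thesis using xi by (auto simp: f2_def)
  qed
  then obtain \<xi> where xi: "\<And>n. norm (E n, Z n) - T n * norm (E' n, Z' n) - (\<bar>C n\<bar> + T n * \<bar>G n\<bar>) > 0 \<Longrightarrow>
     0 < \<xi> n \<and> \<xi> n < T n \<and> gap_int (C n) (E n) (Z n) (T n * G n) (T n * E' n) (T n * Z' n) / (T n)\<^sup>2
      = curv (C n + \<xi> n * G n) (E n + \<xi> n * E' n) (Z n + \<xi> n * Z' n) (G n) (E' n) (Z' n) / 2" by metis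
  have xi0: "\<xi> \<longlonglongrightarrow> 0"
    by (rule tendsto_sandwich[OF _ _ tendsto_const T(1)]; use ev in eventually_elim) (use xi in \<open>auto intro: less_imp_le\<close>)
  have lim: "(\<lambda>n. curv (C n + \<xi> n * G n) (E n + \<xi> n * E' n) (Z n + \<xi> n * Z' n) (G n) (E' n) (Z' n) / 2)
     \<longlonglongrightarrow> curv (c + 0 * \<gamma>) (\<eta> + 0 * \<eta>') (\<zeta> + 0 * \<zeta>') \<gamma> \<eta>' \<zeta>' / 2"
  proof -
    have "\<eta>\<^sup>2 + \<zeta>\<^sup>2 > 0" using c by (meson le_less_trans zero_le_power2)
    then have nz: "(\<eta> + 0 * \<eta>')\<^sup>2 + (\<zeta> + 0 * \<zeta>')\<^sup>2 \<noteq> 0"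
      "sqrt ((\<eta> + 0 * \<eta>')\<^sup>2 + (\<zeta> + 0 * \<zeta>')\<^sup>2 - (c + 0 * \<gamma>)\<^sup>2) \<noteq> 0"
      "((\<eta> + 0 * \<eta>')\<^sup>2 + (\<zeta> + 0 * \<zeta>')\<^sup>2)\<^sup>2 \<noteq> 0" using c by auto
    show ?thesis unfolding curv_def by (intro tendsto_intros l xi0 nz) simp_all
  qed
  have "(\<lambda>n. gap_int (C n) (E n) (Z n) (T n * G n) (T n * E' n) (T n * Z' n) / (T n)\<^sup>2)
     \<longlonglongrightarrow> curv (c + 0 * \<gamma>) (\<eta> + 0 * \<eta>') (\<zeta> + 0 * \<zeta>') \<gamma> \<eta>' \<zeta>' / 2"
    by (rule Lim_transform_eventually[OF lim]) (use ev in \<open>eventually_elim, use xi in auto\<close>)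
  then show ?thesis by simp
qed

section \<open>The torus of phases\<close>

text \<open>
  The law of independent angles, one for each oscillator.
\<close>

definition torus :: "('n::finite \<Rightarrow> real) measure" where
  "torus = Pi\<^sub>M UNIV (\<lambda>_. circ)"

lemma space_torus [simp]: "space torus = UNIV"
  by (auto simp: torus_def space_PiM)

lemma torus_component [measurable]: "(\<lambda>\<phi>. \<phi> j) \<in> borel_measurable torus"
proof -
  have "(\<lambda>\<phi>. \<phi> j) \<in> measurable torus circ" unfolding torus_def by (rule measurable_component_singleton) simp
  then show ?thesis by (simp cong: measurable_cong_sets)
qed

lemma prob_space_torus: "prob_space torus"
  unfolding torus_def by (rule prob_space_PiM) (rule prob_space_circ)

interpretation torus: prob_space torus by (rule prob_space_torus)

interpretation circles: product_sigma_finite "\<lambda>_ :: 'i. circ"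
  by standard

lemma torus_update [measurable]:
  "(\<lambda>(\<phi>, y). \<phi>(i := y)) \<in> measurable (torus \<Otimes>\<^sub>M circ) torus"
  unfolding torus_def split_beta'
  by (rule measurable_fun_upd[where J = UNIV]) auto

lemma torus_update_section [measurable]: "(\<lambda>y. \<phi>(i := y)) \<in> measurable borel torus"
proof -
  have "(\<lambda>y. (\<lambda>(\<phi>, y). \<phi>(i := y)) (\<phi>, y)) \<in> measurable circ torus"
    by (rule measurable_compose[OF _ torus_update]) simp
  then show ?thesis by (simp cong: measurable_cong_sets)
qed

lemma resample_measurable:
  fixes f :: "('n::finite \<Rightarrow> real) \<Rightarrow> ennreal"
  assumes f: "f \<in> borel_measurable torus"
  shows "(\<lambda>\<phi>. \<integral>\<^sup>+y. f (\<phi>(i := y)) \<partial>circ) \<in> borel_measurable torus"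
proof -
  have "(\<lambda>p. f ((\<lambda>(\<phi>, y). \<phi>(i := y)) p)) \<in> borel_measurable (torus \<Otimes>\<^sub>M circ)"
    by (rule measurable_compose[OF torus_update f])
  then show ?thesis by (intro circ.borel_measurable_nn_integral) (simp add: split_beta')
qed

text \<open>Averaging over one angle first does not change an integral over the torus.\<close>

lemma resample:
  fixes f :: "('n::finite \<Rightarrow> real) \<Rightarrow> ennreal"
  assumes f: "f \<in> borel_measurable torus"
  shows "(\<integral>\<^sup>+\<phi>. f \<phi> \<partial>torus) = (\<integral>\<^sup>+\<phi>. \<integral>\<^sup>+y. f (\<phi>(i := y)) \<partial>circ \<partial>torus)"
proof -
  have U: "insert i (UNIV - {i}) = UNIV" by blast
  have ins: "(\<integral>\<^sup>+\<phi>. h \<phi> \<partial>torus) = (\<integral>\<^sup>+\<phi>. \<integral>\<^sup>+y. h (\<phi>(i := y)) \<partial>circ \<partial>Pi\<^sub>M (UNIV - {i}) (\<lambda>_. circ))"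
    if "h \<in> borel_measurable torus" for h :: "('n \<Rightarrow> real) \<Rightarrow> ennreal"
    using circles.product_nn_integral_insert[of "UNIV - {i}" i h] that by (simp add: U torus_def insert_absorb)
  have "(\<integral>\<^sup>+\<phi>. \<integral>\<^sup>+y. f (\<phi>(i := y)) \<partial>circ \<partial>torus)
     = (\<integral>\<^sup>+\<phi>. \<integral>\<^sup>+z. \<integral>\<^sup>+y. f ((\<phi>(i := z))(i := y)) \<partial>circ \<partial>circ \<partial>Pi\<^sub>M (UNIV - {i}) (\<lambda>_. circ))"
    by (rule ins) (rule resample_measurable[OF f])
  also have "\<dots> = (\<integral>\<^sup>+\<phi>. \<integral>\<^sup>+y. f (\<phi>(i := y)) \<partial>circ \<partial>Pi\<^sub>M (UNIV - {i}) (\<lambda>_. circ))"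
    using circ.emeasure_space_1 by simp
  finally show ?thesis using ins[OF f] by simp
qed

lemma resample_AE:
  fixes Q :: "('n::finite \<Rightarrow> real) \<Rightarrow> bool"
  assumes Q: "Measurable.pred torus Q" and ae: "\<And>\<phi>. AE y in circ. Q (\<phi>(i := y))"
  shows "AE \<phi> in torus. Q \<phi>"
proof -
  note Q[measurable]
  have "{\<phi> \<in> space torus. \<not> Q \<phi>} \<in> sets torus" by measurable
  then have m: "{\<phi>. \<not> Q \<phi>} \<in> sets torus" by simp
  have "emeasure torus {\<phi>. \<not> Q \<phi>} = (\<integral>\<^sup>+\<phi>. indicator {\<phi>. \<not> Q \<phi>} \<phi> \<partial>torus)" using m by simp
  also have "\<dots> = (\<integral>\<^sup>+\<phi>. \<integral>\<^sup>+y. indicator {\<phi>. \<not> Q \<phi>} (\<phi>(i := y)) \<partial>circ \<partial>torus)"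
    by (rule resample) (use m in simp)
  also have "\<dots> = (\<integral>\<^sup>+\<phi>. 0 \<partial>(torus :: ('n \<Rightarrow> real) measure))"
  proof (rule nn_integral_cong)
    fix \<phi> :: "'n \<Rightarrow> real"
    have "(\<integral>\<^sup>+y. indicator {\<phi>. \<not> Q \<phi>} (\<phi>(i := y)) \<partial>circ) = (\<integral>\<^sup>+y. 0 \<partial>circ)"
      by (rule nn_integral_cong_AE) (use ae[of \<phi>] in \<open>eventually_elim, simp\<close>)
    then show "(\<integral>\<^sup>+y. indicator {\<phi>. \<not> Q \<phi>} (\<phi>(i := y)) \<partial>circ) = (0 :: ennreal)" by simp
  qed
  finally have "emeasure torus {\<phi>. \<not> Q \<phi>} = 0" by simp
  then show ?thesis using m by (intro AE_I[of _ _ "{\<phi>. \<not> Q \<phi>}"]) auto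
qed

text \<open>
  Throughout, \<open>eta P j * cos (\<phi> j) + zeta P j * sin (\<phi> j)\<close> is the contribution of the \<open>j\<close>-th component of a dual
  vector \<open>P\<close>; its amplitude is \<open>radius P j\<close>. The sum of these contributions is linear in \<open>P\<close>: it is the
  inner product with \<open>phase_vec \<phi>\<close>.
\<close>

locale oscillators =
  fixes \<omega> :: "'n::finite \<Rightarrow> real"
  assumes \<omega>_pos: "\<omega> i > 0"
begin

definition eta :: "'n phase \<Rightarrow> 'n \<Rightarrow> real" where "eta P j = snd (P $ j)"
definition zeta :: "'n phase \<Rightarrow> 'n \<Rightarrow> real" where "zeta P j = fst (P $ j) / \<omega> j"

definition phase_vec :: "('n \<Rightarrow> real) \<Rightarrow> 'n phase" where
  "phase_vec \<phi> = (\<chi> j. (sin (\<phi> j) / \<omega> j, cos (\<phi> j)))"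

text \<open>
  The contributions of all oscillators but the \<open>i\<close>-th.
\<close>

definition rest :: "'n \<Rightarrow> 'n phase \<Rightarrow> ('n \<Rightarrow> real) \<Rightarrow> real" where
  "rest i P \<phi> = (\<Sum>j\<in>UNIV - {i}. wave 0 (eta P j) (zeta P j) (\<phi> j))"

definition radius :: "'n phase \<Rightarrow> 'n \<Rightarrow> real" where
  "radius P j = sqrt ((eta P j)\<^sup>2 + (zeta P j)\<^sup>2)"

text \<open>
  The modulus of the derivative of the \<open>j\<close>-th wave in its angle.
\<close>

definition perp :: "'n phase \<Rightarrow> 'n \<Rightarrow> real \<Rightarrow> real" where
  "perp P j y = \<bar>eta P j * sin y - zeta P j * cos y\<bar>"

lemma eta_add: "eta (P + t *\<^sub>R V) j = eta P j + t * eta V j"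
  and zeta_add: "zeta (P + t *\<^sub>R V) j = zeta P j + t * zeta V j"
  and eta_scale: "eta (t *\<^sub>R V) j = t * eta V j" and zeta_scale: "zeta (t *\<^sub>R V) j = t * zeta V j"
  by (simp_all add: eta_def zeta_def add_divide_distrib)

lemma rest_scale: "rest i (t *\<^sub>R V) \<phi> = t * rest i V \<phi>"
  by (simp add: rest_def eta_scale zeta_scale wave_def sum_distrib_left algebra_simps)

lemma rest_add: "rest i (P + t *\<^sub>R V) \<phi> = rest i P \<phi> + t * rest i V \<phi>"
  by (simp add: rest_def eta_add zeta_add wave_def sum_distrib_left algebra_simps flip: sum.distrib)

lemma rest_update [simp]: "rest i P (\<phi>(i := y)) = rest i P \<phi>"
  by (simp add: rest_def)

lemma rest_measurable [measurable]: "rest i P \<in> borel_measurable torus"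
  unfolding rest_def[abs_def] wave_def by measurable

lemma inner_phase_sum: "P \<bullet> phase_vec \<phi> = (\<Sum>j\<in>UNIV. wave 0 (eta P j) (zeta P j) (\<phi> j))"
  unfolding inner_vec_def
  by (intro sum.cong refl) (simp add: phase_vec_def wave_def eta_def zeta_def inner_prod_def)

lemma inner_phase: "P \<bullet> phase_vec \<phi> = wave (rest i P \<phi>) (eta P i) (zeta P i) (\<phi> i)"
proof -
  have "P \<bullet> phase_vec \<phi> = wave 0 (eta P i) (zeta P i) (\<phi> i) + rest i P \<phi>"
    unfolding inner_phase_sum rest_def by (subst sum.remove[of UNIV i]) auto
  then show ?thesis by (simp add: wave_def)
qed

lemma inner_phase_update:
  "P \<bullet> phase_vec (\<phi>(i := y)) = wave (rest i P \<phi>) (eta P i) (zeta P i) y"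
  by (simp add: inner_phase[of _ _ i])

lemma inner_phase_measurable [measurable]: "(\<lambda>\<phi>. P \<bullet> phase_vec \<phi>) \<in> borel_measurable torus"
  unfolding inner_phase_sum wave_def by measurable

lemma phase_vec_measurable [measurable]: "phase_vec \<in> borel_measurable torus"
proof -
  have "phase_vec \<phi> \<bullet> b = b \<bullet> phase_vec \<phi>" for \<phi> b by (rule inner_commute)
  then show ?thesis by (subst borel_measurable_euclidean_space) simp
qed

lemma radius_nonneg: "0 \<le> radius P j" by (simp add: radius_def)

lemma radius_pos_iff: "0 < radius P j \<longleftrightarrow> P $ j \<noteq> 0"
proof -
  have "0 < radius P j \<longleftrightarrow> \<not> (eta P j = 0 \<and> zeta P j = 0)"
    unfolding radius_def by (metis real_sqrt_gt_0_iff sum_power2_gt_zero_iff)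
  also have "\<dots> \<longleftrightarrow> P $ j \<noteq> 0"
    using \<omega>_pos[of j] by (auto simp: eta_def zeta_def prod_eq_iff)
  finally show ?thesis .
qed

lemma ex_radius_pos: "P \<noteq> 0 \<Longrightarrow> \<exists>i. 0 < radius P i"
  unfolding radius_pos_iff by (simp add: vec_eq_iff)

lemma radius_sq: "(radius P j)\<^sup>2 = (eta P j)\<^sup>2 + (zeta P j)\<^sup>2"
  by (simp add: radius_def)

lemma wave_perp: "(wave 0 (eta P j) (zeta P j) y)\<^sup>2 + (perp P j y)\<^sup>2 = (radius P j)\<^sup>2"
proof -
  have "(wave 0 (eta P j) (zeta P j) y)\<^sup>2 + (perp P j y)\<^sup>2 = ((eta P j)\<^sup>2 + (zeta P j)\<^sup>2) * ((sin y)\<^sup>2 + (cos y)\<^sup>2)"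
    unfolding wave_def perp_def power2_abs unfolding power2_eq_square by algebra
  then show ?thesis by (simp add: radius_sq)
qed

lemma wave_le_radius: "\<bar>wave 0 (eta P j) (zeta P j) y\<bar> \<le> radius P j"
proof -
  have "(wave 0 (eta P j) (zeta P j) y)\<^sup>2 \<le> (radius P j)\<^sup>2" using wave_perp[of P j y] by (metis le_add_same_cancel1 zero_le_power2)
  then have "\<bar>wave 0 (eta P j) (zeta P j) y\<bar> \<le> \<bar>radius P j\<bar>" by (rule abs_le_square_iff[THEN iffD2])
  then show ?thesis using radius_nonneg[of P j] by simp
qed

lemma perp_nonneg: "0 \<le> perp P j y" by (simp add: perp_def)

lemma perp_measurable [measurable]: "perp P j \<in> borel_measurable borel"
  unfolding perp_def[abs_def] by measurable

lemma phase_vec_bounded: "\<exists>C>0. \<forall>\<phi>. norm (phase_vec \<phi>) \<le> C"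
proof -
  define C where "C = (\<Sum>j\<in>UNIV. 1 / \<omega> j + 1)"
  have "norm (phase_vec \<phi>) \<le> C" for \<phi>
  proof -
    have "norm (phase_vec \<phi>) \<le> (\<Sum>j\<in>UNIV. norm (phase_vec \<phi> $ j))"
      unfolding norm_vec_def by (rule L2_set_le_sum) simp
    also have "\<dots> \<le> C" unfolding C_def
    proof (rule sum_mono)
      fix j :: 'n
      have "norm (phase_vec \<phi> $ j) \<le> norm (sin (\<phi> j) / \<omega> j) + norm (cos (\<phi> j))"
        unfolding phase_vec_def vec_lambda_beta by (rule norm_Pair_le)
      also have "\<dots> \<le> 1 / \<omega> j + 1"
        using \<omega>_pos[of j] by (intro add_mono) (auto simp: abs_divide intro: divide_right_mono)
      finally show "norm (phase_vec \<phi> $ j) \<le> 1 / \<omega> j + 1" .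
    qed
    finally show ?thesis .
  qed
  moreover have "0 < C" unfolding C_def using \<omega>_pos by (intro sum_pos) (auto simp: add_pos_pos)
  ultimately show ?thesis by blast
qed

text \<open>
  A bound for the norm of \<open>phase_vec\<close>.
\<close>

definition phase_bound :: real where "phase_bound = (SOME C. C > 0 \<and> (\<forall>\<phi>. norm (phase_vec \<phi>) \<le> C))"

lemma phase_bound: "0 < phase_bound" "norm (phase_vec \<phi>) \<le> phase_bound"
proof -
  have "\<exists>C. C > 0 \<and> (\<forall>\<phi>. norm (phase_vec \<phi>) \<le> C)" using phase_vec_bounded by blast
  from someI_ex[OF this] show "0 < phase_bound" "norm (phase_vec \<phi>) \<le> phase_bound"
    unfolding phase_bound_def by auto
qed

lemma inner_phase_bound: "\<bar>P \<bullet> phase_vec \<phi>\<bar> \<le> norm P * phase_bound"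
  by (meson Cauchy_Schwarz_ineq2 mult_left_mono norm_ge_zero order_trans phase_bound(2))

lemma torus_AE_nonzero: assumes "P \<noteq> 0" shows "AE \<phi> in torus. P \<bullet> phase_vec \<phi> \<noteq> 0"
proof -
  obtain i where "0 < radius P i" using ex_radius_pos[OF assms] by blast
  then have r: "(eta P i)\<^sup>2 + (zeta P i)\<^sup>2 > 0" by (simp add: radius_def)
  show ?thesis
  proof (rule resample_AE[where i = i])
    show "AE y in circ. P \<bullet> phase_vec (\<phi>(i := y)) \<noteq> 0" for \<phi>
      unfolding inner_phase_update wave_def by (rule circ_AE_affine[OF r])
  qed measurable
qed

lemma torus_AE_perp: assumes "0 < radius P i" shows "AE \<phi> in torus. 0 < perp P i (\<phi> i)"
proof (rule resample_AE[where i = i])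
  show "AE y in circ. 0 < perp P i ((\<phi>(i := y)) i)" for \<phi>
    using circ_AE_perp[of "eta P i" "zeta P i"] assms by (simp add: perp_def radius_def)
qed measurable

lemma integrable_torus_bounded:
  fixes f :: "('n \<Rightarrow> real) \<Rightarrow> 'b::{banach, second_countable_topology}"
  assumes "f \<in> borel_measurable torus" "\<And>\<phi>. norm (f \<phi>) \<le> B" shows "integrable torus f"
  by (rule torus.integrable_const_bound[where B = B]) (use assms in auto)

text \<open>
  The mean modulus of the total wave, and its gradient off the origin.
\<close>

definition phase_norm :: "'n phase \<Rightarrow> real" where
  "phase_norm P = (\<integral>\<phi>. \<bar>P \<bullet> phase_vec \<phi>\<bar> \<partial>torus)"

definition phase_grad :: "'n phase \<Rightarrow> 'n phase" where
  "phase_grad P = (\<integral>\<phi>. sgn (P \<bullet> phase_vec \<phi>) *\<^sub>R phase_vec \<phi> \<partial>torus)"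

lemma integrable_abs_phase: "integrable torus (\<lambda>\<phi>. \<bar>P \<bullet> phase_vec \<phi>\<bar>)"
  by (rule integrable_torus_bounded[where B = "norm P * phase_bound"]) (auto simp: inner_phase_bound)

lemma integrable_sgn_phase: "integrable torus (\<lambda>\<phi>. sgn (P \<bullet> phase_vec \<phi>) *\<^sub>R phase_vec \<phi>)"
  by (rule integrable_torus_bounded[where B = phase_bound])
    (auto simp: phase_bound(2) sgn_if less_imp_le[OF phase_bound(1)])

lemma phase_norm_add: "phase_norm (P + Q) \<le> phase_norm P + phase_norm Q"
proof -
  have "phase_norm (P + Q) \<le> (\<integral>\<phi>. \<bar>P \<bullet> phase_vec \<phi>\<bar> + \<bar>Q \<bullet> phase_vec \<phi>\<bar> \<partial>torus)"
    unfolding phase_norm_def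
    by (intro integral_mono integrable_abs_phase Bochner_Integration.integrable_add) (simp add: inner_add_left)
  also have "\<dots> = phase_norm P + phase_norm Q"
    unfolding phase_norm_def by (intro Bochner_Integration.integral_add integrable_abs_phase)
  finally show ?thesis .
qed

lemma phase_norm_scale: "phase_norm (c *\<^sub>R P) = \<bar>c\<bar> * phase_norm P"
  unfolding phase_norm_def by (simp add: abs_mult)

lemma phase_norm_pos: assumes "P \<noteq> 0" shows "0 < phase_norm P"
proof -
  have "phase_norm P \<noteq> 0"
  proof
    assume "phase_norm P = 0"
    then have "AE \<phi> in torus. \<bar>P \<bullet> phase_vec \<phi>\<bar> = 0"
      unfolding phase_norm_def by (subst (asm) integral_nonneg_eq_0_iff_AE) (auto simp: integrable_abs_phase)
    with torus_AE_nonzero[OF assms] have "AE \<phi> in (torus :: ('n \<Rightarrow> real) measure). False" by (rule eventually_elim2) simp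
    then show False using torus.AE_False by simp
  qed
  moreover have "0 \<le> phase_norm P" unfolding phase_norm_def by (intro integral_nonneg_AE) simp
  ultimately show ?thesis by simp
qed

lemma phase_grad_inner: "phase_grad P \<bullet> V = (\<integral>\<phi>. sgn (P \<bullet> phase_vec \<phi>) * (V \<bullet> phase_vec \<phi>) \<partial>torus)"
proof -
  have "phase_grad P \<bullet> V = (\<integral>\<phi>. (sgn (P \<bullet> phase_vec \<phi>) *\<^sub>R phase_vec \<phi>) \<bullet> V \<partial>torus)"
    unfolding phase_grad_def by (rule integral_inner_left[symmetric]) (rule integrable_sgn_phase)
  then show ?thesis by (simp add: inner_commute)
qed

lemma gap_phase_bound: "norm (gap (P \<bullet> phase_vec \<phi>) (V \<bullet> phase_vec \<phi>)) \<le> 2 * (norm V * phase_bound)"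
  using gap_le[of "P \<bullet> phase_vec \<phi>" "V \<bullet> phase_vec \<phi>"] gap_nonneg[of "P \<bullet> phase_vec \<phi>" "V \<bullet> phase_vec \<phi>"]
    inner_phase_bound[of V \<phi>] by simp

lemma integrable_gap: "integrable torus (\<lambda>\<phi>. gap (P \<bullet> phase_vec \<phi>) (V \<bullet> phase_vec \<phi>))"
  by (rule integrable_torus_bounded[OF _ gap_phase_bound]) measurable

lemma bregman_gap: "bregman phase_norm phase_grad P V = (\<integral>\<phi>. gap (P \<bullet> phase_vec \<phi>) (V \<bullet> phase_vec \<phi>) \<partial>torus)"
proof -
  have i: "integrable torus (\<lambda>\<phi>. sgn (P \<bullet> phase_vec \<phi>) * (V \<bullet> phase_vec \<phi>))"
    by (rule integrable_torus_bounded[where B = "norm V * phase_bound"])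
      (auto simp: abs_mult sgn_if inner_phase_bound less_imp_le[OF phase_bound(1)])
  have j: "integrable torus (\<lambda>\<phi>. \<bar>P \<bullet> phase_vec \<phi> + V \<bullet> phase_vec \<phi>\<bar>)"
    using integrable_abs_phase[of "P + V"] by (simp add: inner_add_left)
  show ?thesis
    unfolding bregman_def phase_grad_inner gap_def phase_norm_def inner_add_left
    using i j integrable_abs_phase[of P] by simp
qed

lemma bregman_nonneg: "0 \<le> bregman phase_norm phase_grad P V"
  unfolding bregman_gap by (intro integral_nonneg_AE) (simp add: gap_nonneg)

text \<open>The phases at which the total wave is at most \<open>\<tau>\<close> in modulus.\<close>

abbreviation strip :: "'n phase \<Rightarrow> real \<Rightarrow> ('n \<Rightarrow> real) set" where
  "strip P \<tau> \<equiv> {\<phi>. \<bar>P \<bullet> phase_vec \<phi>\<bar> \<le> \<tau>}"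

lemma strip_sets [measurable, simp]: "strip P c \<in> sets torus"
proof -
  have "{\<phi> \<in> space torus. \<bar>P \<bullet> phase_vec \<phi>\<bar> \<le> c} \<in> sets torus" by measurable
  then show ?thesis by simp
qed

lemma strip_measure_tendsto:
  assumes "P \<noteq> 0" "T \<longlonglongrightarrow> 0"
  shows "(\<lambda>n. measure torus (strip P (T n))) \<longlonglongrightarrow> 0"
proof -
  have "(\<lambda>n. \<integral>\<phi>. indicator (strip P (T n)) \<phi> \<partial>torus) \<longlonglongrightarrow> (\<integral>\<phi>. (0::real) \<partial>(torus :: ('n \<Rightarrow> real) measure))"
  proof (rule integral_dominated_convergence[where w = "\<lambda>_. 1" and f = "\<lambda>_. 0"
        and s = "\<lambda>n \<phi>. indicator (strip P (T n)) \<phi>"])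
    show "AE \<phi> in torus. (\<lambda>n. indicator (strip P (T n)) \<phi>) \<longlonglongrightarrow> (0::real)"
      using torus_AE_nonzero[OF assms(1)]
    proof eventually_elim
      fix \<phi> assume "P \<bullet> phase_vec \<phi> \<noteq> 0"
      then have "\<forall>\<^sub>F n in sequentially. T n < \<bar>P \<bullet> phase_vec \<phi>\<bar>"
        using order_tendstoD(2)[OF assms(2), of "\<bar>P \<bullet> phase_vec \<phi>\<bar>"] by simp
      then have "\<forall>\<^sub>F n in sequentially. indicator (strip P (T n)) \<phi> = (0::real)"
        by eventually_elim simp
      then show "(\<lambda>n. indicator (strip P (T n)) \<phi>) \<longlonglongrightarrow> (0::real)"
        by (rule tendsto_eventually)
    qed
    show "integrable (torus :: ('n \<Rightarrow> real) measure) (\<lambda>_. 1 :: real)" by simp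
  qed (auto simp: indicator_def)
  then show ?thesis by simp
qed

lemma phase_norm_GDERIV: assumes P: "P \<noteq> 0" shows "GDERIV phase_norm P :> phase_grad P"
proof -
  define C where "C = phase_bound"
  have C: "C > 0" unfolding C_def by (rule phase_bound)
  have b: "norm (phase_norm Y - phase_norm P - (Y - P) \<bullet> phase_grad P) / norm (Y - P) \<le>
     2 * C * measure torus (strip P (C * norm (Y - P)))" if "Y \<noteq> P" for Y
  proof -
    define V where "V = Y - P"
    have V: "norm V > 0" using that by (simp add: V_def)
    let ?A = "strip P (C * norm V)"
    have "norm (phase_norm Y - phase_norm P - (Y - P) \<bullet> phase_grad P) = bregman phase_norm phase_grad P V"
      using bregman_nonneg[of P V] by (simp add: bregman_def V_def inner_commute)
    also have "\<dots> \<le> (\<integral>\<phi>. 2 * (norm V * C) * indicator ?A \<phi> \<partial>torus)"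
      unfolding bregman_gap
    proof (rule integral_mono[OF integrable_gap])
      show "integrable torus (\<lambda>\<phi>. 2 * (norm V * C) * indicator ?A \<phi>)"
        by (intro integrable_mult_right) (simp add: torus.emeasure_eq_measure)
      fix \<phi> :: "'n \<Rightarrow> real"
      show "gap (P \<bullet> phase_vec \<phi>) (V \<bullet> phase_vec \<phi>) \<le> 2 * (norm V * C) * indicator ?A \<phi>"
      proof (cases "\<phi> \<in> ?A")
        case True
        then show ?thesis using gap_phase_bound[of P \<phi> V] by (simp add: C_def)
      next
        case False
        then have "\<bar>V \<bullet> phase_vec \<phi>\<bar> < \<bar>P \<bullet> phase_vec \<phi>\<bar>"
          using inner_phase_bound[of V \<phi>] by (simp add: C_def mult.commute)
        then show ?thesis using False by (simp add: gap_eq_0)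
      qed
    qed
    also have "\<dots> = 2 * (norm V * C) * measure torus ?A" by simp
    finally show ?thesis using V by (simp add: V_def field_simps)
  qed
  have "(phase_norm has_derivative (\<lambda>h. h \<bullet> phase_grad P)) (at P)"
    unfolding has_derivative_iff_norm
  proof (intro conjI)
    show "bounded_linear (\<lambda>h. h \<bullet> phase_grad P)" by (rule bounded_linear_inner_left)
    show "((\<lambda>Y. norm (phase_norm Y - phase_norm P - (Y - P) \<bullet> phase_grad P) / norm (Y - P)) \<longlongrightarrow> 0) (at P)"
      unfolding tendsto_at_iff_sequentially
    proof (intro allI impI)
      fix X assume X: "\<forall>i. X i \<in> UNIV - {P}" "X \<longlonglongrightarrow> P"
      have "(\<lambda>n. C * norm (X n - P)) \<longlonglongrightarrow> C * norm (P - P)" by (intro tendsto_intros X)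
      then have "(\<lambda>n. C * norm (X n - P)) \<longlonglongrightarrow> 0" by simp
      from tendsto_mult[OF tendsto_const strip_measure_tendsto[OF P this], of "2 * C"]
      have "(\<lambda>n. 2 * C * measure torus (strip P (C * norm (X n - P)))) \<longlonglongrightarrow> 0" by simp
      from _ this show "((\<lambda>Y. norm (phase_norm Y - phase_norm P - (Y - P) \<bullet> phase_grad P) / norm (Y - P)) \<circ> X) \<longlonglongrightarrow> 0"
      proof (rule Lim_null_comparison)
        show "\<forall>\<^sub>F n in sequentially. norm (((\<lambda>Y. norm (phase_norm Y - phase_norm P - (Y - P) \<bullet> phase_grad P) / norm (Y - P)) \<circ> X) n)
           \<le> 2 * C * measure torus (strip P (C * norm (X n - P)))"
          using b X(1) by (intro always_eventually allI) simp
      qed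
    qed
  qed
  then show ?thesis by (simp add: gderiv_def)
qed

text \<open>The gap at fixed values of the other angles, averaged over the angle \<open>i\<close>.\<close>

abbreviation gap_at where
  "gap_at i P V \<phi> \<equiv> gap_int (rest i P \<phi>) (eta P i) (zeta P i) (rest i V \<phi>) (eta V i) (zeta V i)"

lemma nn_gap_int:
  "(\<integral>\<^sup>+y. ennreal (gap (wave c e z y) (wave c' e' z' y)) \<partial>circ) = ennreal (gap_int c e z c' e' z')"
  unfolding gap_int_def
proof (rule nn_integral_eq_integral)
  show "integrable circ (\<lambda>y. gap (wave c e z y) (wave c' e' z' y))"
  proof (rule integrable_circ_bounded)
    show "\<bar>gap (wave c e z y) (wave c' e' z' y)\<bar> \<le> 2 * (\<bar>c'\<bar> + \<bar>e'\<bar> + \<bar>z'\<bar>)" for y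
      using gap_le[of "wave c e z y" "wave c' e' z' y"] gap_nonneg[of "wave c e z y" "wave c' e' z' y"] wave_bound[of c' e' z' y]
      by simp
  qed measurable
qed (simp add: gap_nonneg)

lemma gap_at_measurable [measurable]: "(\<lambda>\<phi>. gap_at i P V \<phi>) \<in> borel_measurable torus"
proof -
  have "(\<lambda>\<phi>. \<integral>\<^sup>+y. ennreal (gap (P \<bullet> phase_vec (\<phi>(i := y))) (V \<bullet> phase_vec (\<phi>(i := y)))) \<partial>circ) \<in> borel_measurable torus"
    by (rule resample_measurable) measurable
  then have "(\<lambda>\<phi>. ennreal (gap_at i P V \<phi>)) \<in> borel_measurable torus"
    by (simp add: inner_phase_update nn_gap_int)
  then have "(\<lambda>\<phi>. enn2real (ennreal (gap_at i P V \<phi>))) \<in> borel_measurable torus" by measurable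
  then show ?thesis by (simp add: gap_int_nonneg)
qed

lemma gap_torus_int:
  assumes h: "h \<in> borel_measurable torus" "\<And>\<phi> y. h (\<phi>(i := y)) = h \<phi>"
  shows "(\<integral>\<^sup>+\<phi>. ennreal (gap (P \<bullet> phase_vec \<phi>) (V \<bullet> phase_vec \<phi>)) * h \<phi> \<partial>torus)
     = (\<integral>\<^sup>+\<phi>. ennreal (gap_at i P V \<phi>) * h \<phi> \<partial>torus)"
proof -
  have "(\<integral>\<^sup>+\<phi>. ennreal (gap (P \<bullet> phase_vec \<phi>) (V \<bullet> phase_vec \<phi>)) * h \<phi> \<partial>torus)
    = (\<integral>\<^sup>+\<phi>. \<integral>\<^sup>+y. ennreal (gap (P \<bullet> phase_vec (\<phi>(i := y))) (V \<bullet> phase_vec (\<phi>(i := y)))) * h (\<phi>(i := y)) \<partial>circ \<partial>torus)"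
    by (rule resample) (use h(1) in measurable)
  also have "\<dots> = (\<integral>\<^sup>+\<phi>. ennreal (gap_at i P V \<phi>) * h \<phi> \<partial>torus)"
  proof (rule nn_integral_cong)
    fix \<phi> :: "'n \<Rightarrow> real"
    have "(\<lambda>y. ennreal (gap (wave (rest i P \<phi>) (eta P i) (zeta P i) y) (wave (rest i V \<phi>) (eta V i) (zeta V i) y))) \<in> borel_measurable borel"
      by measurable
    then have m: "(\<lambda>y. ennreal (gap (wave (rest i P \<phi>) (eta P i) (zeta P i) y) (wave (rest i V \<phi>) (eta V i) (zeta V i) y))) \<in> borel_measurable circ"
      by (simp cong: measurable_cong_sets)
    show "(\<integral>\<^sup>+y. ennreal (gap (P \<bullet> phase_vec (\<phi>(i := y))) (V \<bullet> phase_vec (\<phi>(i := y)))) * h (\<phi>(i := y)) \<partial>circ) = ennreal (gap_at i P V \<phi>) * h \<phi>"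
      unfolding inner_phase_update h(2) by (subst nn_integral_multc[OF m]) (simp add: nn_gap_int)
  qed
  finally show ?thesis .
qed

lemma bregman_gap_at: "ennreal (bregman phase_norm phase_grad P V) = (\<integral>\<^sup>+\<phi>. ennreal (gap_at i P V \<phi>) \<partial>torus)"
proof -
  have "ennreal (bregman phase_norm phase_grad P V) = (\<integral>\<^sup>+\<phi>. ennreal (gap (P \<bullet> phase_vec \<phi>) (V \<bullet> phase_vec \<phi>)) \<partial>torus)"
    unfolding bregman_gap by (rule nn_integral_eq_integral[symmetric, OF integrable_gap]) (simp add: gap_nonneg)
  also have "\<dots> = (\<integral>\<^sup>+\<phi>. ennreal (gap_at i P V \<phi>) \<partial>torus)"
    using gap_torus_int[of "\<lambda>_. 1" i P V] by simp
  finally show ?thesis .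
qed

section \<open>Curvature of the averaged norm\<close>

text \<open>
  The density \<open>mform\<close> of the second order form at \<open>P\<close>, after averaging over the angle \<open>i\<close>. It is a weighted sum
  of two squares: \<open>normal_part\<close> is proportional to the variation of the ratio of \<open>rest\<close> to the \<open>i\<close>-th
  amplitude, and \<open>angular_part\<close> to the rotation of the \<open>i\<close>-th component. Only the weight of the former is
  unbounded. Both weights are zero where \<open>rest\<close> is at least the \<open>i\<close>-th amplitude in modulus, because
  beyond that bound the averaged modulus is linear.
\<close>

definition tang :: "'n \<Rightarrow> 'n phase \<Rightarrow> 'n phase \<Rightarrow> real" where
  "tang i P V = (eta P i * eta V i + zeta P i * zeta V i) / (radius P i)\<^sup>2"

definition normal_part :: "'n \<Rightarrow> 'n phase \<Rightarrow> 'n phase \<Rightarrow> ('n \<Rightarrow> real) \<Rightarrow> real" where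
  "normal_part i P V \<phi> = rest i V \<phi> - rest i P \<phi> * tang i P V"

definition angular_part :: "'n \<Rightarrow> 'n phase \<Rightarrow> 'n phase \<Rightarrow> real" where
  "angular_part i P V = eta P i * zeta V i - zeta P i * eta V i"

definition normal_weight :: "'n \<Rightarrow> 'n phase \<Rightarrow> ('n \<Rightarrow> real) \<Rightarrow> real" where
  "normal_weight i P \<phi> = (if (rest i P \<phi>)\<^sup>2 < (radius P i)\<^sup>2 then 2 / pi / sqrt ((radius P i)\<^sup>2 - (rest i P \<phi>)\<^sup>2) else 0)"

definition angular_weight :: "'n \<Rightarrow> 'n phase \<Rightarrow> ('n \<Rightarrow> real) \<Rightarrow> real" where
  "angular_weight i P \<phi> = (if (rest i P \<phi>)\<^sup>2 < (radius P i)\<^sup>2 then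
     2 / pi * sqrt ((radius P i)\<^sup>2 - (rest i P \<phi>)\<^sup>2) / ((radius P i)\<^sup>2)\<^sup>2 else 0)"

definition mform :: "'n \<Rightarrow> 'n phase \<Rightarrow> 'n phase \<Rightarrow> 'n phase \<Rightarrow> ('n \<Rightarrow> real) \<Rightarrow> real" where
  "mform i P V W \<phi> = normal_weight i P \<phi> * (normal_part i P V \<phi> * normal_part i P W \<phi>) + angular_weight i P \<phi> * (angular_part i P V * angular_part i P W)"

text \<open>
  The directions of finite curvature at \<open>P\<close>, and the second order form on them.
\<close>

definition curv_dom :: "'n \<Rightarrow> 'n phase \<Rightarrow> 'n phase set" where
  "curv_dom i P = {V. integrable torus (mform i P V V)}"

definition curv_form :: "'n \<Rightarrow> 'n phase \<Rightarrow> 'n phase \<Rightarrow> 'n phase \<Rightarrow> real" where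
  "curv_form i P V W = (\<integral>\<phi>. mform i P V W \<phi> \<partial>torus)"

lemma w_nonneg: "0 \<le> normal_weight i P \<phi>" "0 \<le> angular_weight i P \<phi>"
  by (auto simp: normal_weight_def angular_weight_def)

lemma mform_nonneg: "0 \<le> mform i P V V \<phi>"
  by (simp add: mform_def w_nonneg)

lemma k_measurable [measurable]: "normal_part i P V \<in> borel_measurable torus" "normal_weight i P \<in> borel_measurable torus"
   "angular_weight i P \<in> borel_measurable torus"
  unfolding normal_part_def[abs_def] normal_weight_def[abs_def] angular_weight_def[abs_def] by measurable

lemma mform_measurable [measurable]: "mform i P V W \<in> borel_measurable torus"
  unfolding mform_def[abs_def] by measurable

lemma k_linear: "tang i P (a *\<^sub>R V + b *\<^sub>R W) = a * tang i P V + b * tang i P W"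
  "normal_part i P (a *\<^sub>R V + b *\<^sub>R W) \<phi> = a * normal_part i P V \<phi> + b * normal_part i P W \<phi>"
  "angular_part i P (a *\<^sub>R V + b *\<^sub>R W) = a * angular_part i P V + b * angular_part i P W"
proof -
  show t: "tang i P (a *\<^sub>R V + b *\<^sub>R W) = a * tang i P V + b * tang i P W"
    by (simp add: tang_def eta_add zeta_add eta_scale zeta_scale add_divide_distrib algebra_simps)
  show "normal_part i P (a *\<^sub>R V + b *\<^sub>R W) \<phi> = a * normal_part i P V \<phi> + b * normal_part i P W \<phi>"
    by (simp add: normal_part_def t rest_add rest_scale algebra_simps)
  show "angular_part i P (a *\<^sub>R V + b *\<^sub>R W) = a * angular_part i P V + b * angular_part i P W"
    by (simp add: angular_part_def eta_add zeta_add eta_scale zeta_scale algebra_simps)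
qed

lemma mform_sym: "mform i P V W \<phi> = mform i P W V \<phi>"
  by (simp add: mform_def mult.commute)

lemma mform_linear: "mform i P (a *\<^sub>R V + b *\<^sub>R W) Z \<phi> = a * mform i P V Z \<phi> + b * mform i P W Z \<phi>"
  unfolding mform_def k_linear by (simp add: algebra_simps)

lemma mform_bound: "\<bar>mform i P V W \<phi>\<bar> \<le> mform i P V V \<phi> + mform i P W W \<phi>"
proof -
  have *: "\<bar>x * y\<bar> \<le> x * x + y * y" for x y :: real
  proof -
    have "2 * (\<bar>x\<bar> * \<bar>y\<bar>) \<le> x * x + y * y"
      using sum_squares_bound[of "\<bar>x\<bar>" "\<bar>y\<bar>"] by (simp add: power2_eq_square)
    moreover have "0 \<le> \<bar>x\<bar> * \<bar>y\<bar>" by simp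
    ultimately show ?thesis by (simp only: abs_mult)
  qed
  have "\<bar>mform i P V W \<phi>\<bar> \<le> normal_weight i P \<phi> * \<bar>normal_part i P V \<phi> * normal_part i P W \<phi>\<bar> + angular_weight i P \<phi> * \<bar>angular_part i P V * angular_part i P W\<bar>"
    unfolding mform_def by (rule order_trans[OF abs_triangle_ineq]) (simp add: abs_mult w_nonneg)
  also have "\<dots> \<le> normal_weight i P \<phi> * (normal_part i P V \<phi> * normal_part i P V \<phi> + normal_part i P W \<phi> * normal_part i P W \<phi>) + angular_weight i P \<phi> * (angular_part i P V * angular_part i P V + angular_part i P W * angular_part i P W)"
    by (intro add_mono mult_left_mono * w_nonneg)
  also have "\<dots> = mform i P V V \<phi> + mform i P W W \<phi>" by (simp add: mform_def algebra_simps)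
  finally show ?thesis .
qed

lemma mform_integrable:
  assumes "V \<in> curv_dom i P" "W \<in> curv_dom i P" shows "integrable torus (mform i P V W)"
proof (rule Bochner_Integration.integrable_bound)
  show "integrable torus (\<lambda>\<phi>. mform i P V V \<phi> + mform i P W W \<phi>)"
    using assms by (auto simp: curv_dom_def)
  show "AE \<phi> in torus. norm (mform i P V W \<phi>) \<le> norm (mform i P V V \<phi> + mform i P W W \<phi>)"
    using mform_bound mform_nonneg by (intro AE_I2) (smt (verit) real_norm_def)
qed measurable

lemma subspace_curv_dom: "subspace (curv_dom i P)"
proof -
  have comb: "a *\<^sub>R V + b *\<^sub>R W \<in> curv_dom i P" if "V \<in> curv_dom i P" "W \<in> curv_dom i P" for a b V W
  proof -
    have e: "mform i P (a *\<^sub>R V + b *\<^sub>R W) (a *\<^sub>R V + b *\<^sub>R W) \<phi> =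
       a * a * mform i P V V \<phi> + 2 * a * b * mform i P V W \<phi> + b * b * mform i P W W \<phi>" for \<phi>
      unfolding mform_linear mform_sym[of i P V "a *\<^sub>R V + b *\<^sub>R W"] mform_sym[of i P W "a *\<^sub>R V + b *\<^sub>R W"]
      by (simp add: mform_sym[of i P W V] algebra_simps)
    have "integrable torus (\<lambda>\<phi>. a * a * mform i P V V \<phi> + 2 * a * b * mform i P V W \<phi> + b * b * mform i P W W \<phi>)"
      using mform_integrable[OF that] mform_integrable[OF that(1) that(1)] mform_integrable[OF that(2) that(2)] by simp
    then show ?thesis by (simp add: curv_dom_def e[abs_def])
  qed
  have "0 \<in> curv_dom i P"
  proof -
    have e: "mform i P 0 0 \<phi> = 0" for \<phi> using mform_linear[of i P 0 0 0 0 0 \<phi>] by simp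
    show ?thesis by (simp add: curv_dom_def e[abs_def])
  qed
  then show ?thesis unfolding subspace_def using comb[of _ _ 1 1] comb[of _ _ _ 0] by auto
qed

lemma mform_curv:
  assumes "(rest i P \<phi>)\<^sup>2 < (radius P i)\<^sup>2"
  shows "curv (rest i P \<phi>) (eta P i) (zeta P i) (rest i V \<phi>) (eta V i) (zeta V i) = mform i P V V \<phi>"
proof -
  let ?D = "(radius P i)\<^sup>2 - (rest i P \<phi>)\<^sup>2"
  have "curv (rest i P \<phi>) (eta P i) (zeta P i) (rest i V \<phi>) (eta V i) (zeta V i)
    = 2 / pi * ((normal_part i P V \<phi>)\<^sup>2 / sqrt ?D + (angular_part i P V)\<^sup>2 * sqrt ?D / ((radius P i)\<^sup>2)\<^sup>2)"
    by (simp only: curv_def normal_part_def angular_part_def tang_def radius_sq times_divide_eq_right)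
  also have "\<dots> = 2 / pi / sqrt ?D * (normal_part i P V \<phi> * normal_part i P V \<phi>)
      + 2 / pi * sqrt ?D / ((radius P i)\<^sup>2)\<^sup>2 * (angular_part i P V * angular_part i P V)"
    by (simp only: power2_eq_square[of "normal_part i P V \<phi>"] power2_eq_square[of "angular_part i P V"]) (simp add: distrib_left)
  finally show ?thesis using assms by (simp add: mform_def normal_weight_def angular_weight_def)
qed

lemma rest_tendsto:
  assumes "V \<longlonglongrightarrow> v" shows "(\<lambda>n. rest i (V n) \<phi>) \<longlonglongrightarrow> rest i v \<phi>"
  unfolding rest_def wave_def eta_def zeta_def by (intro tendsto_intros assms) (use \<omega>_pos in \<open>auto simp: less_imp_neq[symmetric]\<close>)

lemma eta_tendsto: assumes "V \<longlonglongrightarrow> v" shows "(\<lambda>n. eta (V n) i) \<longlonglongrightarrow> eta v i"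
  unfolding eta_def by (intro tendsto_intros assms)

lemma zeta_tendsto: assumes "V \<longlonglongrightarrow> v" shows "(\<lambda>n. zeta (V n) i) \<longlonglongrightarrow> zeta v i"
  unfolding zeta_def by (intro tendsto_intros assms) (use \<omega>_pos in \<open>auto simp: less_imp_neq[symmetric]\<close>)

lemma gap_at_limit:
  assumes lt: "(rest i p \<phi>)\<^sup>2 < (radius p i)\<^sup>2" and P: "P \<longlonglongrightarrow> p"
    and T: "T \<longlonglongrightarrow> 0" "\<And>n. 0 < T n" and V: "V \<longlonglongrightarrow> v"
  shows "(\<lambda>n. gap_at i (P n) (T n *\<^sub>R V n) \<phi> / (T n)\<^sup>2) \<longlonglongrightarrow> mform i p v v \<phi> / 2"
proof -
  have "(\<lambda>n. gap_int (rest i (P n) \<phi>) (eta (P n) i) (zeta (P n) i)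
      (T n * rest i (V n) \<phi>) (T n * eta (V n) i) (T n * zeta (V n) i) / (T n)\<^sup>2)
    \<longlonglongrightarrow> curv (rest i p \<phi>) (eta p i) (zeta p i) (rest i v \<phi>) (eta v i) (zeta v i) / 2"
    by (rule gap_int_limit[OF _ T]) (use lt in \<open>auto simp: radius_sq intro: rest_tendsto eta_tendsto zeta_tendsto P V\<close>)
  then show ?thesis by (simp add: mform_curv[OF lt] rest_scale eta_scale zeta_scale)
qed

text \<open>Fatou's lemma gives the lower estimate of the curvature, without any domination.\<close>

lemma curvature_lower:
  assumes P: "P \<longlonglongrightarrow> p" and T: "T \<longlonglongrightarrow> 0" "\<And>n. 0 < T n" and V: "V \<longlonglongrightarrow> v" and K: "K \<longlonglongrightarrow> k"
    and b: "\<And>n. bregman phase_norm phase_grad (P n) (T n *\<^sub>R V n) \<le> K n * (T n)\<^sup>2"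
  shows "v \<in> curv_dom i p" "curv_form i p v v \<le> 2 * k"
proof -
  have Kn: "0 \<le> K n" for n
  proof -
    have "0 \<le> K n * (T n)\<^sup>2" using b[of n] bregman_nonneg[of "P n" "T n *\<^sub>R V n"] by linarith
    then show ?thesis using T(2)[of n] by (simp add: zero_le_mult_iff)
  qed
  have k0: "0 \<le> k" using K Kn by (intro LIMSEQ_le_const[OF K]) auto
  define f where "f n \<phi> = ennreal (gap_at i (P n) (T n *\<^sub>R V n) \<phi> / (T n)\<^sup>2)" for n \<phi>
  have [measurable]: "f n \<in> borel_measurable torus" for n unfolding f_def[abs_def] by measurable
  have low: "ennreal (mform i p v v \<phi> / 2) \<le> liminf (\<lambda>n. f n \<phi>)" for \<phi>
  proof (cases "(rest i p \<phi>)\<^sup>2 < (radius p i)\<^sup>2")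
    case True
    have "(\<lambda>n. f n \<phi>) \<longlonglongrightarrow> ennreal (mform i p v v \<phi> / 2)"
      unfolding f_def by (intro tendsto_ennrealI gap_at_limit[OF True P T V])
    then show ?thesis using lim_imp_Liminf[OF sequentially_bot] by fastforce
  next
    case False
    then show ?thesis by (simp add: mform_def normal_weight_def angular_weight_def)
  qed
  have fn: "(\<integral>\<^sup>+\<phi>. f n \<phi> \<partial>torus) \<le> ennreal (K n)" for n
  proof -
    have "(\<integral>\<^sup>+\<phi>. f n \<phi> \<partial>torus) = (\<integral>\<^sup>+\<phi>. ennreal (1 / (T n)\<^sup>2) * ennreal (gap_at i (P n) (T n *\<^sub>R V n) \<phi>) \<partial>torus)"
      unfolding f_def by (intro nn_integral_cong) (simp add: ennreal_mult[symmetric] gap_int_nonneg)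
    also have "\<dots> = ennreal (1 / (T n)\<^sup>2) * (\<integral>\<^sup>+\<phi>. ennreal (gap_at i (P n) (T n *\<^sub>R V n) \<phi>) \<partial>torus)"
      by (rule nn_integral_cmult) measurable
    also have "\<dots> = ennreal (1 / (T n)\<^sup>2 * bregman phase_norm phase_grad (P n) (T n *\<^sub>R V n))"
      unfolding bregman_gap_at[symmetric] by (rule ennreal_mult[symmetric]) (auto simp: bregman_nonneg)
    also have "\<dots> \<le> ennreal (K n)"
      using b[of n] T(2)[of n] by (intro ennreal_leI) (simp add: field_simps)
    finally show ?thesis .
  qed
  have "(\<integral>\<^sup>+\<phi>. ennreal (mform i p v v \<phi> / 2) \<partial>torus) \<le> (\<integral>\<^sup>+\<phi>. liminf (\<lambda>n. f n \<phi>) \<partial>torus)"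
    by (intro nn_integral_mono low)
  also have "\<dots> \<le> liminf (\<lambda>n. \<integral>\<^sup>+\<phi>. f n \<phi> \<partial>torus)" by (rule nn_integral_liminf) measurable
  also have "\<dots> \<le> liminf (\<lambda>n. ennreal (K n))" by (intro Liminf_mono always_eventually allI fn)
  also have "\<dots> = ennreal k" using tendsto_ennrealI[OF K] by (intro lim_imp_Liminf) auto
  finally have half: "(\<integral>\<^sup>+\<phi>. ennreal (mform i p v v \<phi> / 2) \<partial>torus) \<le> ennreal k" .
  have "integrable torus (\<lambda>\<phi>. mform i p v v \<phi> / 2)"
    by (rule integrableI_nonneg) (use half mform_nonneg in \<open>auto simp: le_less_trans[OF _ ennreal_less_top]\<close>)
  from integrable_mult_right[OF this, of 2]
  have int: "integrable torus (mform i p v v)" by simp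
  then show "v \<in> curv_dom i p" by (simp add: curv_dom_def)
  have "ennreal (\<integral>\<phi>. mform i p v v \<phi> / 2 \<partial>torus) = (\<integral>\<^sup>+\<phi>. ennreal (mform i p v v \<phi> / 2) \<partial>torus)"
    by (rule nn_integral_eq_integral[symmetric]) (use int mform_nonneg in auto)
  then have "ennreal (\<integral>\<phi>. mform i p v v \<phi> / 2 \<partial>torus) \<le> ennreal k" using half by (simp only:)
  then have "(\<integral>\<phi>. mform i p v v \<phi> / 2 \<partial>torus) \<le> k" by (simp only: ennreal_le_iff[OF k0])
  then show "curv_form i p v v \<le> 2 * k" by (simp add: curv_form_def)
qed

text \<open>The singular set \<open>\<bar>radius - \<bar>rest\<bar>\<bar> < \<delta>\<close>, where the averaged gap is not uniformly smooth.\<close>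

definition near :: "'n \<Rightarrow> 'n phase \<Rightarrow> real \<Rightarrow> ('n \<Rightarrow> real) set" where
  "near i P \<delta> = {\<phi>. \<bar>radius P i - \<bar>rest i P \<phi>\<bar>\<bar> < \<delta>}"

lemma near_sets [measurable, simp]: "near i P \<delta> \<in> sets torus"
proof -
  have "{\<phi> \<in> space torus. \<bar>radius P i - \<bar>rest i P \<phi>\<bar>\<bar> < \<delta>} \<in> sets torus" by measurable
  then show ?thesis by (simp add: near_def)
qed

lemma near_update: "\<phi>(i := y) \<in> near i P \<delta> \<longleftrightarrow> \<phi> \<in> near i P \<delta>"
  by (simp add: near_def)

text \<open>Away from the singular set the averaged gap is of second order, uniformly.\<close>

lemma gap_at_bound:
  assumes r: "0 < radius P i" and d: "0 < \<delta>" and far: "\<phi> \<notin> near i P \<delta>"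
    and t: "0 < t" "t * (norm V * phase_bound) \<le> \<delta> / 2"
  shows "gap_at i P (t *\<^sub>R V) \<phi> / t\<^sup>2 \<le> 2 * (norm V * phase_bound)\<^sup>2 / sqrt (radius P i * \<delta> / 2)"
proof -
  define B where "B = norm V * phase_bound"
  define e where "e = sqrt (radius P i * \<delta> / 2)"
  have e: "e > 0" using r d by (simp add: e_def)
  have B0: "B \<ge> 0" using phase_bound(1) by (simp add: B_def)
  let ?a = "wave (rest i P \<phi>) (eta P i) (zeta P i)" and ?b = "wave (rest i (t *\<^sub>R V) \<phi>) (eta (t *\<^sub>R V) i) (zeta (t *\<^sub>R V) i)"
  have b: "\<bar>?b y\<bar> \<le> t * B" for y
    using inner_phase_bound[of "t *\<^sub>R V" "\<phi>(i := y)"] t unfolding inner_phase_update by (simp add: B_def)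
  have "ennreal (gap_at i P (t *\<^sub>R V) \<phi>) = (\<integral>\<^sup>+y. ennreal (gap (?a y) (?b y)) \<partial>circ)" by (rule nn_gap_int[symmetric])
  also have "\<dots> \<le> (\<integral>\<^sup>+y. ennreal (2 * (t * B) / e) * (indicator {y. \<bar>rest i P \<phi> + (eta P i * cos y + zeta P i * sin y)\<bar> \<le> t * B} y * ennreal \<bar>eta P i * sin y - zeta P i * cos y\<bar>) \<partial>circ)"
  proof (rule nn_integral_mono)
    fix y :: real
    show "ennreal (gap (?a y) (?b y)) \<le> ennreal (2 * (t * B) / e) * (indicator {y. \<bar>rest i P \<phi> + (eta P i * cos y + zeta P i * sin y)\<bar> \<le> t * B} y * ennreal \<bar>eta P i * sin y - zeta P i * cos y\<bar>)"
    proof (cases "\<bar>?a y\<bar> \<le> t * B")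
      case False
      then have "\<bar>?b y\<bar> < \<bar>?a y\<bar>" using b[of y] by linarith
      then show ?thesis by (simp add: gap_eq_0)
    next
      case True
      define A where "A = wave 0 (eta P i) (zeta P i) y"
      have aA: "?a y = rest i P \<phi> + A" by (simp add: A_def wave_def)
      have AR: "\<bar>A\<bar> \<le> radius P i" unfolding A_def by (rule wave_le_radius)
      have "\<delta> \<le> \<bar>radius P i - \<bar>rest i P \<phi>\<bar>\<bar>" using far by (simp add: near_def)
      then have "\<delta> / 2 \<le> radius P i - \<bar>A\<bar>" using True t(2) AR unfolding aA B_def[symmetric] by linarith
      then have "(\<delta> / 2) * radius P i \<le> (radius P i - \<bar>A\<bar>) * (radius P i + \<bar>A\<bar>)"
        using d r by (intro mult_mono) auto
      also have "\<dots> = (radius P i)\<^sup>2 - A\<^sup>2" by (simp add: power2_eq_square algebra_simps)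
      also have "\<dots> = (perp P i y)\<^sup>2" using wave_perp[of P i y] by (simp add: A_def)
      finally have "e \<le> perp P i y" unfolding e_def using perp_nonneg
        by (intro real_le_lsqrt) (auto simp: mult.commute)
      then have "2 * (t * B) * 1 \<le> 2 * (t * B) * (perp P i y / e)" using e t B0 by (intro mult_left_mono) auto
      then have "gap (?a y) (?b y) \<le> 2 * (t * B) / e * perp P i y" using gap_le[of "?a y" "?b y"] b[of y] by simp
      then have "ennreal (gap (?a y) (?b y)) \<le> ennreal (2 * (t * B) / e * perp P i y)" by (rule ennreal_leI)
      also have "\<dots> = ennreal (2 * (t * B) / e) * ennreal (perp P i y)"
        using e t B0 perp_nonneg by (intro ennreal_mult) auto
      finally show ?thesis using True by (simp add: perp_def wave_def)
    qed
  qed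
  also have "\<dots> = ennreal (2 * (t * B) / e) * (\<integral>\<^sup>+y. indicator {y. \<bar>rest i P \<phi> + (eta P i * cos y + zeta P i * sin y)\<bar> \<le> t * B} y * ennreal \<bar>eta P i * sin y - zeta P i * cos y\<bar> \<partial>circ)"
  proof (rule nn_integral_cmult)
    have [measurable]: "{y. \<bar>c + (e * cos y + z * sin y)\<bar> \<le> \<tau>} \<in> sets borel" for c e z \<tau> :: real
      by measurable
    have "(\<lambda>y. indicator {y. \<bar>c + (e * cos y + z * sin y)\<bar> \<le> \<tau>} y * ennreal \<bar>e * sin y - z * cos y\<bar>) \<in> borel_measurable borel"
      for c e z \<tau> :: real by measurable
    then show "(\<lambda>y. indicator {y. \<bar>rest i P \<phi> + (eta P i * cos y + zeta P i * sin y)\<bar> \<le> t * B} y * ennreal \<bar>eta P i * sin y - zeta P i * cos y\<bar>) \<in> borel_measurable circ"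
      by (simp cong: measurable_cong_sets)
  qed
  also have "\<dots> \<le> ennreal (2 * (t * B) / e) * ennreal (t * B)"
    by (intro mult_left_mono circ_strip) (use t B0 in auto)
  also have "\<dots> = ennreal (2 * (t * B) / e * (t * B))" using e t B0 by (intro ennreal_mult[symmetric]) auto
  finally have "gap_at i P (t *\<^sub>R V) \<phi> \<le> 2 * (t * B) / e * (t * B)"
    using e t B0 by (subst (asm) ennreal_le_iff) auto
  then show ?thesis using t e by (simp add: B_def e_def field_simps power2_eq_square)
qed

text \<open>
  The singular set contributes arbitrarily little to the second order expansion in the direction \<open>V\<close>.
\<close>

definition negligible_near :: "'n \<Rightarrow> 'n phase \<Rightarrow> 'n phase \<Rightarrow> bool" where
  "negligible_near i P V \<longleftrightarrow> (\<forall>e>0. \<forall>T. T \<longlonglongrightarrow> 0 \<longrightarrow> (\<forall>n. 0 < T n) \<longrightarrow> (\<exists>\<delta>>0. \<forall>\<^sub>F n in sequentially.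
     (\<integral>\<^sup>+\<phi>. ennreal (gap (P \<bullet> phase_vec \<phi>) ((T n *\<^sub>R V) \<bullet> phase_vec \<phi>)) * indicator (near i P \<delta>) \<phi> \<partial>torus)
       \<le> ennreal (e * (T n)\<^sup>2)))"

text \<open>
  Off the singular set the limit passes under the integral by dominated convergence; the lower half of the
  convergence is again \<open>curvature_lower\<close>.
\<close>

lemma curvature_upper:
  assumes r: "0 < radius P i" and V: "V \<in> curv_dom i P" and neg: "negligible_near i P V"
    and T: "T \<longlonglongrightarrow> 0" "\<And>n. 0 < T n"
  shows "(\<lambda>n. bregman phase_norm phase_grad P (T n *\<^sub>R V) / (T n)\<^sup>2) \<longlonglongrightarrow> curv_form i P V V / 2"
proof -
  define X where "X n = bregman phase_norm phase_grad P (T n *\<^sub>R V) / (T n)\<^sup>2" for n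
  define q where "q = curv_form i P V V / 2"
  have up: "\<forall>\<^sub>F n in sequentially. X n < q + e" if e: "e > 0" for e
  proof -
    have e2: "e / 2 > 0" using e by simp
    from neg[unfolded negligible_near_def, rule_format, OF e2 T]
    obtain \<delta> where d: "\<delta> > 0" "\<forall>\<^sub>F n in sequentially.
     (\<integral>\<^sup>+\<phi>. ennreal (gap (P \<bullet> phase_vec \<phi>) ((T n *\<^sub>R V) \<bullet> phase_vec \<phi>)) * indicator (near i P \<delta>) \<phi> \<partial>torus)
       \<le> ennreal (e / 2 * (T n)\<^sup>2)" by blast
    define B where "B = norm V * phase_bound"
    define J where "J n \<phi> = indicator (- near i P \<delta>) \<phi> * (gap_at i P (T n *\<^sub>R V) \<phi> / (T n)\<^sup>2)" for n \<phi>
    have "(\<lambda>n. T n * B) \<longlonglongrightarrow> 0 * B" by (intro tendsto_intros T)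
    then have evT: "\<forall>\<^sub>F n in sequentially. T n * B < \<delta> / 2" using d by (intro order_tendstoD(2)) auto
    define D where "D = 2 * B\<^sup>2 / sqrt (radius P i * \<delta> / 2)"
    have D0: "D \<ge> 0" using r d by (simp add: D_def)
    have [measurable]: "J n \<in> borel_measurable torus" for n unfolding J_def[abs_def] by measurable
    obtain N where N: "\<And>n. n \<ge> N \<Longrightarrow> T n * B < \<delta> / 2" using evT unfolding eventually_sequentially by blast
    have J0: "0 \<le> J n \<phi>" for n \<phi> by (simp add: J_def gap_int_nonneg)
    have Jb: "norm (J (n + N) \<phi>) \<le> D" for n \<phi>
    proof (cases "\<phi> \<in> near i P \<delta>")
      case False
      have "gap_at i P (T (n + N) *\<^sub>R V) \<phi> / (T (n + N))\<^sup>2 \<le> D"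
        unfolding D_def B_def by (rule gap_at_bound[OF r d(1) False T(2)]) (use N[of "n + N"] in \<open>simp add: B_def\<close>)
      then show ?thesis using J0[of "n + N" \<phi>] False by (simp add: J_def)
    qed (use D0 in \<open>simp add: J_def\<close>)
    define m where "m \<phi> = indicator (- near i P \<delta>) \<phi> * (mform i P V V \<phi> / 2)" for \<phi>
    have [measurable]: "m \<in> borel_measurable torus" unfolding m_def[abs_def] by measurable
    have Jlim: "(\<lambda>n. J (n + N) \<phi>) \<longlonglongrightarrow> m \<phi>" for \<phi>
    proof (cases "\<phi> \<in> near i P \<delta>")
      case True
      then show ?thesis by (simp add: J_def m_def)
    next
      case False
      have far: "\<delta> \<le> \<bar>radius P i - \<bar>rest i P \<phi>\<bar>\<bar>" using False by (simp add: near_def)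
      have "(\<lambda>n. gap_at i P (T n *\<^sub>R V) \<phi> / (T n)\<^sup>2) \<longlonglongrightarrow> mform i P V V \<phi> / 2"
      proof (cases "\<bar>rest i P \<phi>\<bar> < radius P i")
        case True
        then have "(rest i P \<phi>)\<^sup>2 < (radius P i)\<^sup>2" using power_strict_mono[OF True, of 2] by simp
        then show ?thesis by (rule gap_at_limit[OF _ tendsto_const T tendsto_const])
      next
        case gt: False
        then have g: "radius P i + \<delta> \<le> \<bar>rest i P \<phi>\<bar>" using far by linarith
        have m0: "mform i P V V \<phi> = 0"
        proof -
          have "\<bar>radius P i\<bar> \<le> \<bar>rest i P \<phi>\<bar>" using gt r by simp
          then have "\<not> (rest i P \<phi>)\<^sup>2 < (radius P i)\<^sup>2" unfolding abs_le_square_iff by simp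
          then show ?thesis by (simp add: mform_def normal_weight_def angular_weight_def)
        qed
        have "gap_at i P (T n *\<^sub>R V) \<phi> = 0" if n: "T n * B < \<delta> / 2" for n
        proof -
          have "gap (wave (rest i P \<phi>) (eta P i) (zeta P i) y) (wave (rest i (T n *\<^sub>R V) \<phi>) (eta (T n *\<^sub>R V) i) (zeta (T n *\<^sub>R V) i) y) = 0" for y
          proof (rule gap_eq_0)
            have "\<bar>wave (rest i (T n *\<^sub>R V) \<phi>) (eta (T n *\<^sub>R V) i) (zeta (T n *\<^sub>R V) i) y\<bar> \<le> T n * B"
              using inner_phase_bound[of "T n *\<^sub>R V" "\<phi>(i := y)"] T(2)[of n] unfolding inner_phase_update by (simp add: B_def)
            moreover have "wave (rest i P \<phi>) (eta P i) (zeta P i) y = rest i P \<phi> + wave 0 (eta P i) (zeta P i) y"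
              by (simp add: wave_def)
            ultimately show "\<bar>wave (rest i (T n *\<^sub>R V) \<phi>) (eta (T n *\<^sub>R V) i) (zeta (T n *\<^sub>R V) i) y\<bar> < \<bar>wave (rest i P \<phi>) (eta P i) (zeta P i) y\<bar>"
              using wave_le_radius[of P i y] g n d(1) by linarith
          qed
          then show ?thesis by (simp add: gap_int_def)
        qed
        then have "\<forall>\<^sub>F n in sequentially. gap_at i P (T n *\<^sub>R V) \<phi> / (T n)\<^sup>2 = 0"
          using evT by (auto elim!: eventually_mono)
        then show ?thesis unfolding m0 by (simp add: tendsto_eventually)
      qed
      then have "(\<lambda>n. gap_at i P (T (n + N) *\<^sub>R V) \<phi> / (T (n + N))\<^sup>2) \<longlonglongrightarrow> mform i P V V \<phi> / 2"
        by (rule LIMSEQ_ignore_initial_segment)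
      then show ?thesis using False by (simp add: J_def m_def)
    qed
    have conv: "(\<lambda>n. \<integral>\<phi>. J (n + N) \<phi> \<partial>torus) \<longlonglongrightarrow> (\<integral>\<phi>. m \<phi> \<partial>torus)"
      by (rule integral_dominated_convergence[where w = "\<lambda>_. D"]) (use Jlim Jb in auto)
    have mq: "(\<integral>\<phi>. m \<phi> \<partial>torus) \<le> q"
    proof -
      have i1: "integrable torus (\<lambda>\<phi>. mform i P V V \<phi> / 2)" using V by (simp add: curv_dom_def)
      have "(\<integral>\<phi>. m \<phi> \<partial>torus) \<le> (\<integral>\<phi>. mform i P V V \<phi> / 2 \<partial>torus)"
      proof (rule integral_mono[OF _ i1])
        show "integrable torus m"
          by (rule Bochner_Integration.integrable_bound[OF i1]) (auto simp: m_def indicator_def)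
        show "m \<phi> \<le> mform i P V V \<phi> / 2" for \<phi>
          using mform_nonneg[of i P V \<phi>] by (auto simp: m_def indicator_def)
      qed
      then show ?thesis by (simp add: q_def curv_form_def)
    qed
    have "\<forall>\<^sub>F n in sequentially. (\<integral>\<phi>. J (n + N) \<phi> \<partial>torus) < q + e / 2"
      using mq e by (intro order_tendstoD(2)[OF conv]) linarith
    then have evJ: "\<forall>\<^sub>F n in sequentially. (\<integral>\<phi>. J n \<phi> \<partial>torus) < q + e / 2"
      by (rule eventually_sequentially_seg[THEN iffD1])
    have "\<forall>\<^sub>F n in sequentially. n \<ge> N" by (rule eventually_ge_at_top)
    with evJ d(2) show ?thesis
    proof eventually_elim
      case (elim n)
      have Tn: "T n > 0" by (rule T)
      have intJ: "integrable torus (J n)"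
      proof (rule integrable_torus_bounded)
        show "norm (J n \<phi>) \<le> D" for \<phi> using Jb[of "n - N" \<phi>] elim(3) by simp
      qed measurable
      have "ennreal (bregman phase_norm phase_grad P (T n *\<^sub>R V)) = (\<integral>\<^sup>+\<phi>. ennreal (gap_at i P (T n *\<^sub>R V) \<phi>) \<partial>torus)" by (rule bregman_gap_at)
      also have "\<dots> = (\<integral>\<^sup>+\<phi>. ennreal (gap_at i P (T n *\<^sub>R V) \<phi>) * indicator (near i P \<delta>) \<phi> + ennreal ((T n)\<^sup>2 * J n \<phi>) \<partial>torus)"
        using Tn by (intro nn_integral_cong) (auto simp: J_def indicator_def)
      also have "\<dots> = (\<integral>\<^sup>+\<phi>. ennreal (gap_at i P (T n *\<^sub>R V) \<phi>) * indicator (near i P \<delta>) \<phi> \<partial>torus) + (\<integral>\<^sup>+\<phi>. ennreal ((T n)\<^sup>2 * J n \<phi>) \<partial>torus)"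
        by (rule nn_integral_add) measurable
      also have "(\<integral>\<^sup>+\<phi>. ennreal (gap_at i P (T n *\<^sub>R V) \<phi>) * indicator (near i P \<delta>) \<phi> \<partial>torus)
         = (\<integral>\<^sup>+\<phi>. ennreal (gap (P \<bullet> phase_vec \<phi>) ((T n *\<^sub>R V) \<bullet> phase_vec \<phi>)) * indicator (near i P \<delta>) \<phi> \<partial>torus)"
        by (rule gap_torus_int[symmetric]) (auto simp: indicator_def near_update)
      also have "(\<integral>\<^sup>+\<phi>. ennreal ((T n)\<^sup>2 * J n \<phi>) \<partial>torus) = ennreal ((T n)\<^sup>2 * (\<integral>\<phi>. J n \<phi> \<partial>torus))"
        by (subst nn_integral_eq_integral) (use intJ J0 in auto)
      also have "(\<integral>\<^sup>+\<phi>. ennreal (gap (P \<bullet> phase_vec \<phi>) ((T n *\<^sub>R V) \<bullet> phase_vec \<phi>)) * indicator (near i P \<delta>) \<phi> \<partial>torus)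
         + ennreal ((T n)\<^sup>2 * (\<integral>\<phi>. J n \<phi> \<partial>torus)) \<le> ennreal (e / 2 * (T n)\<^sup>2) + ennreal ((T n)\<^sup>2 * (\<integral>\<phi>. J n \<phi> \<partial>torus))"
        by (rule add_right_mono[OF elim(2)])
      also have "\<dots> = ennreal (e / 2 * (T n)\<^sup>2 + (T n)\<^sup>2 * (\<integral>\<phi>. J n \<phi> \<partial>torus))"
        using e J0 by (intro ennreal_plus[symmetric]) (auto intro!: mult_nonneg_nonneg integral_nonneg_AE)
      finally have "bregman phase_norm phase_grad P (T n *\<^sub>R V) \<le> e / 2 * (T n)\<^sup>2 + (T n)\<^sup>2 * (\<integral>\<phi>. J n \<phi> \<partial>torus)"
        using e J0 by (subst (asm) ennreal_le_iff) (auto intro!: add_nonneg_nonneg mult_nonneg_nonneg integral_nonneg_AE)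
      then have "X n \<le> e / 2 + (\<integral>\<phi>. J n \<phi> \<partial>torus)" using Tn by (simp add: X_def field_simps)
      then show ?case using elim(1) by linarith
    qed
  qed
  have lo: "\<forall>\<^sub>F n in sequentially. q - e < X n" if e: "e > 0" for e
  proof (rule ccontr)
    assume "\<not> ?thesis"
    then have "\<exists>\<^sub>F n in sequentially. X n \<le> q - e" by (simp add: not_eventually not_less)
    then have "infinite {n. X n \<le> q - e}" by (simp add: cofinite_eq_sequentially[symmetric] frequently_cofinite)
    from infinite_enumerate[OF this] obtain s :: "nat \<Rightarrow> nat" where s: "strict_mono s" "\<And>n. X (s n) \<le> q - e" by auto
    have "curv_form i P V V \<le> 2 * (q - e)"
    proof (rule curvature_lower(2)[OF tendsto_const _ _ tendsto_const tendsto_const])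
      show "(T \<circ> s) \<longlonglongrightarrow> 0" using LIMSEQ_subseq_LIMSEQ[OF T(1) s(1)] .
      show "0 < (T \<circ> s) n" for n using T(2) by simp
      show "bregman phase_norm phase_grad P ((T \<circ> s) n *\<^sub>R V) \<le> (q - e) * ((T \<circ> s) n)\<^sup>2" for n
        using s(2)[of n] T(2)[of "s n"] by (simp add: X_def field_simps)
    qed
    then show False using e by (simp add: q_def)
  qed
  have "X \<longlonglongrightarrow> q"
    unfolding tendsto_iff
  proof (intro allI impI)
    fix e :: real assume "e > 0"
    then show "\<forall>\<^sub>F n in sequentially. dist (X n) q < e"
      using up[of e] lo[of e] by (auto simp: dist_real_def abs_less_iff elim: eventually_elim2)
  qed
  then show ?thesis by (simp add: X_def[abs_def] q_def)
qed

section \<open>Directions of finite curvature\<close>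

lemma perp_sets [measurable, simp]: "{\<phi>. perp P x (\<phi> x) \<le> \<epsilon>} \<in> sets torus"
proof -
  have "{\<phi> \<in> space torus. perp P x (\<phi> x) \<le> \<epsilon>} \<in> sets torus" by measurable
  then show ?thesis by simp
qed

text \<open>
  In the strip where the total wave is at most \<open>\<tau>\<close>, the weight \<open>perp P i\<close> gives mass of order \<open>\<tau>\<close>, independently
  of all other angles.
\<close>

lemma strip_weighted:
  assumes f: "f \<in> borel_measurable torus" "\<And>\<phi> y. f (\<phi>(i := y)) = f \<phi>" and \<tau>: "0 \<le> \<tau>"
  shows "(\<integral>\<^sup>+\<phi>. indicator (strip P \<tau>) \<phi> * ennreal (perp P i (\<phi> i)) * f \<phi> \<partial>torus)
    \<le> ennreal \<tau> * (\<integral>\<^sup>+\<phi>. f \<phi> \<partial>torus)"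
proof -
  note f(1)[measurable]
  have "(\<integral>\<^sup>+\<phi>. indicator (strip P \<tau>) \<phi> * ennreal (perp P i (\<phi> i)) * f \<phi> \<partial>torus)
    = (\<integral>\<^sup>+\<phi>. \<integral>\<^sup>+y. indicator (strip P \<tau>) (\<phi>(i := y)) * ennreal (perp P i ((\<phi>(i := y)) i)) * f (\<phi>(i := y)) \<partial>circ \<partial>torus)"
    by (rule resample) measurable
  also have "\<dots> \<le> (\<integral>\<^sup>+\<phi>. ennreal \<tau> * f \<phi> \<partial>torus)"
  proof (rule nn_integral_mono)
    fix \<phi> :: "'n \<Rightarrow> real"
    define h where "h y = indicator {y. \<bar>rest i P \<phi> + (eta P i * cos y + zeta P i * sin y)\<bar> \<le> \<tau>} y * ennreal \<bar>eta P i * sin y - zeta P i * cos y\<bar>" for y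
    have [measurable]: "{y. \<bar>c + (e * cos y + z * sin y)\<bar> \<le> \<tau>} \<in> sets borel" for c e z :: real
      by measurable
    have hm: "h \<in> borel_measurable circ"
      unfolding h_def[abs_def] by (simp cong: measurable_cong_sets)
    have "(\<integral>\<^sup>+y. indicator (strip P \<tau>) (\<phi>(i := y)) * ennreal (perp P i ((\<phi>(i := y)) i)) * f (\<phi>(i := y)) \<partial>circ)
      = (\<integral>\<^sup>+y. h y * f \<phi> \<partial>circ)"
      by (intro nn_integral_cong) (simp add: f(2) h_def inner_phase_update wave_def perp_def indicator_def)
    also have "\<dots> = (\<integral>\<^sup>+y. h y \<partial>circ) * f \<phi>" by (rule nn_integral_multc[OF hm])
    also have "\<dots> \<le> ennreal \<tau> * f \<phi>" unfolding h_def by (intro mult_right_mono circ_strip \<tau>) simp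
    finally show "(\<integral>\<^sup>+y. indicator (strip P \<tau>) (\<phi>(i := y)) * ennreal (perp P i ((\<phi>(i := y)) i)) * f (\<phi>(i := y)) \<partial>circ)
      \<le> ennreal \<tau> * f \<phi>" .
  qed
  also have "\<dots> = ennreal \<tau> * (\<integral>\<^sup>+\<phi>. f \<phi> \<partial>torus)" by (rule nn_integral_cmult[OF f(1)])
  finally show ?thesis .
qed

lemma gap_near_le:
  assumes t: "0 < t"
  shows "(\<integral>\<^sup>+\<phi>. ennreal (gap (P \<bullet> phase_vec \<phi>) ((t *\<^sub>R V) \<bullet> phase_vec \<phi>)) * indicator (near i P \<delta>) \<phi> \<partial>torus)
   \<le> (\<integral>\<^sup>+\<phi>. ennreal (2 * t * \<bar>V \<bullet> phase_vec \<phi>\<bar>) * indicator (strip P (t * (norm V * phase_bound))) \<phi>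
        * indicator (near i P \<delta>) \<phi> \<partial>torus)"
proof (rule nn_integral_mono)
  fix \<phi> :: "'n \<Rightarrow> real"
  show "ennreal (gap (P \<bullet> phase_vec \<phi>) ((t *\<^sub>R V) \<bullet> phase_vec \<phi>)) * indicator (near i P \<delta>) \<phi>
     \<le> ennreal (2 * t * \<bar>V \<bullet> phase_vec \<phi>\<bar>) * indicator (strip P (t * (norm V * phase_bound))) \<phi> * indicator (near i P \<delta>) \<phi>"
  proof (cases "\<bar>P \<bullet> phase_vec \<phi>\<bar> \<le> t * (norm V * phase_bound)")
    case True
    have "gap (P \<bullet> phase_vec \<phi>) ((t *\<^sub>R V) \<bullet> phase_vec \<phi>) \<le> 2 * t * \<bar>V \<bullet> phase_vec \<phi>\<bar>"
      using gap_le[of "P \<bullet> phase_vec \<phi>" "(t *\<^sub>R V) \<bullet> phase_vec \<phi>"] t by (simp add: abs_mult)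
    then have "ennreal (gap (P \<bullet> phase_vec \<phi>) ((t *\<^sub>R V) \<bullet> phase_vec \<phi>)) \<le> ennreal (2 * t * \<bar>V \<bullet> phase_vec \<phi>\<bar>)"
      by (rule ennreal_leI)
    then show ?thesis using True by (simp add: indicator_def)
  next
    case False
    have "t * \<bar>V \<bullet> phase_vec \<phi>\<bar> \<le> t * (norm V * phase_bound)" using t inner_phase_bound by (intro mult_left_mono) auto
    then have "\<bar>(t *\<^sub>R V) \<bullet> phase_vec \<phi>\<bar> < \<bar>P \<bullet> phase_vec \<phi>\<bar>" using False t
      unfolding inner_scaleR_left abs_mult by linarith
    then show ?thesis by (simp add: gap_eq_0)
  qed
qed

text \<open>If one oscillator dominates all others together, the singular set is empty.\<close>

lemma negligible_dominant:
  assumes dom: "(\<Sum>j\<in>UNIV - {i}. radius P j) < radius P i"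
  shows "negligible_near i P V"
  unfolding negligible_near_def
proof (intro allI impI)
  fix e :: real and T :: "nat \<Rightarrow> real" assume "0 < e"
  define \<delta> where "\<delta> = radius P i - (\<Sum>j\<in>UNIV - {i}. radius P j)"
  have "near i P \<delta> = {}"
  proof -
    have "\<bar>rest i P \<phi>\<bar> \<le> (\<Sum>j\<in>UNIV - {i}. radius P j)" for \<phi>
      unfolding rest_def by (rule order_trans[OF sum_abs]) (intro sum_mono wave_le_radius)
    then have "\<delta> \<le> \<bar>radius P i - \<bar>rest i P \<phi>\<bar>\<bar>" for \<phi> unfolding \<delta>_def by (smt (verit))
    then show ?thesis unfolding near_def by (auto simp: not_less)
  qed
  then show "\<exists>\<delta>>0. \<forall>\<^sub>F n in sequentially. (\<integral>\<^sup>+\<phi>. ennreal (gap (P \<bullet> phase_vec \<phi>) ((T n *\<^sub>R V) \<bullet> phase_vec \<phi>)) * indicator (near i P \<delta>) \<phi> \<partial>torus)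
       \<le> ennreal (e * (T n)\<^sup>2)"
    using dom by (intro exI[of _ \<delta>]) (simp add: \<delta>_def)
qed

text \<open>
  The next inequality distributes the strip over three angles: whichever of \<open>a\<close>, \<open>b\<close>, \<open>c\<close> is largest serves
  as the weight of \<open>strip_weighted\<close>, and the two others enter with the integrable power \<open>-3/4\<close>.
\<close>

lemma three_weights:
  fixes a b c :: real
  assumes p: "0 < a" "0 < b" "0 < c"
  shows "1 \<le> sqrt a * (a * (b powr (- 3/4) * c powr (- 3/4)) + b * (a powr (- 3/4) * c powr (- 3/4))
     + c * (a powr (- 3/4) * b powr (- 3/4)))"
proof -
  define A where "A = a * (b powr (- 3/4) * c powr (- 3/4))"
  define B where "B = b * (a powr (- 3/4) * c powr (- 3/4))"
  define C where "C = c * (a powr (- 3/4) * b powr (- 3/4))"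
  have nn: "0 \<le> A" "0 \<le> B" "0 \<le> C" using p by (auto simp: A_def B_def C_def)
  have max: "a powr (- 1/2) \<le> x * (a powr (- 3/4) * y powr (- 3/4))" if "0 < y" "y \<le> x" "a \<le> x" for x y
  proof -
    have x: "x > 0" using that by linarith
    have "a powr (- 1/2) = a powr (1/4) * a powr (- 3/4)" using p by (simp add: powr_add[symmetric])
    also have "\<dots> \<le> x powr (1/4) * a powr (- 3/4)" using p that by (intro mult_right_mono powr_mono2) auto
    also have "x powr (1/4) = x * x powr (- 3/4)" using x powr_add[of x 1 "- 3/4"] by simp
    also have "x * x powr (- 3/4) * a powr (- 3/4) \<le> x * y powr (- 3/4) * a powr (- 3/4)"
      using that x by (intro mult_right_mono mult_left_mono powr_mono2') auto
    finally show ?thesis by (simp add: mult_ac)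
  qed
  have "a powr (- 1/2) \<le> A + B + C"
  proof -
    consider "b \<le> a" "c \<le> a" | "a \<le> b" "c \<le> b" | "a \<le> c" "b \<le> c" by linarith
    then show ?thesis
    proof cases
      case 1
      have "a powr (- 1/2) \<le> a * (a powr (- 3/4) * b powr (- 3/4))" using max[of b a] p 1 by simp
      also have "\<dots> \<le> a * (c powr (- 3/4) * b powr (- 3/4))"
        using p 1 by (intro mult_left_mono mult_right_mono powr_mono2') auto
      also have "\<dots> = A" by (simp add: A_def mult_ac)
      finally show ?thesis using nn by simp
    next
      case 2
      then show ?thesis using max[of c b] p nn by (simp add: B_def)
    next
      case 3
      then show ?thesis using max[of b c] p nn by (simp add: C_def)
    qed
  qed
  then have "sqrt a * a powr (- 1/2) \<le> sqrt a * (A + B + C)" using p by (intro mult_left_mono) auto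
  moreover have "sqrt a * a powr (- 1/2) = 1" using p by (simp add: powr_half_sqrt[symmetric] powr_add[symmetric])
  ultimately show ?thesis by (simp add: A_def B_def C_def)
qed

lemma perp_powr_finite:
  assumes r: "0 < radius P x" "0 < radius P y" and xy: "x \<noteq> y"
  shows "(\<integral>\<^sup>+\<phi>. ennreal (perp P x (\<phi> x) powr (- 3/4)) * ennreal (perp P y (\<phi> y) powr (- 3/4)) \<partial>torus) < \<infinity>"
proof -
  define K where "K z = (\<integral>\<^sup>+s. ennreal (perp P z s powr (- 3/4)) \<partial>circ)" for z
  have K: "K z < \<infinity>" if "0 < radius P z" for z
    using circ_perp_powr[of "eta P z" "zeta P z"] that by (simp add: K_def perp_def radius_def)
  have m: "(\<lambda>s. ennreal (perp P z s powr (- 3/4))) \<in> borel_measurable circ" for z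
    unfolding perp_def by (simp cong: measurable_cong_sets)
  have "(\<integral>\<^sup>+\<phi>. ennreal (perp P x (\<phi> x) powr (- 3/4)) * ennreal (perp P y (\<phi> y) powr (- 3/4)) \<partial>torus)
     = (\<integral>\<^sup>+\<phi>. \<integral>\<^sup>+s. ennreal (perp P x ((\<phi>(x := s)) x) powr (- 3/4)) * ennreal (perp P y ((\<phi>(x := s)) y) powr (- 3/4)) \<partial>circ \<partial>torus)"
    by (rule resample) measurable
  also have "\<dots> = (\<integral>\<^sup>+\<phi>. K x * ennreal (perp P y (\<phi> y) powr (- 3/4)) \<partial>torus)"
  proof (rule nn_integral_cong)
    fix \<phi> :: "'n \<Rightarrow> real"
    have "(\<integral>\<^sup>+s. ennreal (perp P x s powr (- 3/4)) * ennreal (perp P y (\<phi> y) powr (- 3/4)) \<partial>circ) = K x * ennreal (perp P y (\<phi> y) powr (- 3/4))"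
      unfolding K_def by (rule nn_integral_multc[OF m])
    then show "(\<integral>\<^sup>+s. ennreal (perp P x ((\<phi>(x := s)) x) powr (- 3/4)) * ennreal (perp P y ((\<phi>(x := s)) y) powr (- 3/4)) \<partial>circ)
      = K x * ennreal (perp P y (\<phi> y) powr (- 3/4))"
      using xy by simp
  qed
  also have "\<dots> = K x * (\<integral>\<^sup>+\<phi>. ennreal (perp P y (\<phi> y) powr (- 3/4)) \<partial>torus)" by (rule nn_integral_cmult) measurable
  also have "(\<integral>\<^sup>+\<phi>. ennreal (perp P y (\<phi> y) powr (- 3/4)) \<partial>torus)
     = (\<integral>\<^sup>+\<phi>. \<integral>\<^sup>+s. ennreal (perp P y ((\<phi>(y := s)) y) powr (- 3/4)) \<partial>circ \<partial>(torus :: ('n \<Rightarrow> real) measure))"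
    by (rule resample) measurable
  also have "\<dots> = K y" by (simp add: K_def torus.emeasure_space_1[simplified])
  finally show ?thesis using K[OF r(1)] K[OF r(2)] by (simp add: ennreal_mult_less_top)
qed

text \<open>
  With three nonzero amplitudes, the part of the strip near the extrema of one wave has mass at
  most of order \<open>sqrt \<epsilon> * \<tau>\<close>.
\<close>

lemma strip_perp_small:
  assumes r: "0 < radius P i" "0 < radius P j" "0 < radius P k" and d: "i \<noteq> j" "i \<noteq> k" "j \<noteq> k"
  shows "\<exists>K\<ge>0. \<forall>\<tau>\<ge>0. \<forall>\<epsilon>\<ge>0. (\<integral>\<^sup>+\<phi>. indicator (strip P \<tau>) \<phi> * indicator {\<phi>. perp P i (\<phi> i) \<le> \<epsilon>} \<phi> \<partial>torus)
     \<le> ennreal (sqrt \<epsilon> * (\<tau> * K))"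
proof -
  define f where "f x \<phi> = ennreal (perp P x (\<phi> x) powr (- 3/4))" for x \<phi>
  have [measurable]: "f x \<in> borel_measurable torus" for x unfolding f_def[abs_def] by measurable
  have upd: "f x (\<phi>(y := s)) = f x \<phi>" if "x \<noteq> y" for x y \<phi> s using that by (simp add: f_def)
  define I where "I x y = (\<integral>\<^sup>+\<phi>. f x \<phi> * f y \<phi> \<partial>torus)" for x y
  define K where "K = enn2real (I j k + I i k + I i j)"
  have fin: "I j k + I i k + I i j < \<infinity>" unfolding I_def f_def using perp_powr_finite r d by simp
  then have KI: "ennreal K = I j k + I i k + I i j" by (simp add: K_def less_top)
  have "(\<integral>\<^sup>+\<phi>. indicator (strip P \<tau>) \<phi> * indicator {\<phi>. perp P i (\<phi> i) \<le> \<epsilon>} \<phi> \<partial>torus)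
     \<le> ennreal (sqrt \<epsilon> * (\<tau> * K))" if t: "\<tau> \<ge> 0" "\<epsilon> \<ge> 0" for \<tau> \<epsilon>
  proof -
    define g where "g x y z \<phi> = indicator (strip P \<tau>) \<phi> * ennreal (perp P x (\<phi> x)) * (f y \<phi> * f z \<phi>)" for x y z \<phi>
    have [measurable]: "g x y z \<in> borel_measurable torus" for x y z unfolding g_def[abs_def] by measurable
    have gI: "(\<integral>\<^sup>+\<phi>. g x y z \<phi> \<partial>torus) \<le> ennreal \<tau> * I y z" if "y \<noteq> x" "z \<noteq> x" for x y z
      unfolding g_def I_def by (rule strip_weighted) (use t upd that in auto)
    have "(\<integral>\<^sup>+\<phi>. indicator (strip P \<tau>) \<phi> * indicator {\<phi>. perp P i (\<phi> i) \<le> \<epsilon>} \<phi> \<partial>torus)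
      \<le> (\<integral>\<^sup>+\<phi>. ennreal (sqrt \<epsilon>) * (g i j k \<phi> + g j i k \<phi> + g k i j \<phi>) \<partial>torus)"
    proof (rule nn_integral_mono_AE)
      show "AE \<phi> in torus. indicator (strip P \<tau>) \<phi> * indicator {\<phi>. perp P i (\<phi> i) \<le> \<epsilon>} \<phi>
        \<le> ennreal (sqrt \<epsilon>) * (g i j k \<phi> + g j i k \<phi> + g k i j \<phi>)"
        using torus_AE_perp[OF r(1)] torus_AE_perp[OF r(2)] torus_AE_perp[OF r(3)]
      proof eventually_elim
        case (elim \<phi>)
        show ?case
        proof (cases "\<bar>P \<bullet> phase_vec \<phi>\<bar> \<le> \<tau> \<and> perp P i (\<phi> i) \<le> \<epsilon>")
          case True
          let ?a = "perp P i (\<phi> i)" and ?b = "perp P j (\<phi> j)" and ?c = "perp P k (\<phi> k)"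
          let ?A = "?a * (?b powr (- 3/4) * ?c powr (- 3/4))" and ?B = "?b * (?a powr (- 3/4) * ?c powr (- 3/4))"
            and ?C = "?c * (?a powr (- 3/4) * ?b powr (- 3/4))"
          have "1 \<le> sqrt ?a * (?A + ?B + ?C)" using three_weights[OF elim] by simp
          also have "\<dots> \<le> sqrt \<epsilon> * (?A + ?B + ?C)"
            using True elim by (intro mult_right_mono) (auto intro!: add_nonneg_nonneg)
          finally have "ennreal 1 \<le> ennreal (sqrt \<epsilon> * (?A + ?B + ?C))" by (rule ennreal_leI)
          also have "\<dots> = ennreal (sqrt \<epsilon>) * (ennreal ?A + ennreal ?B + ennreal ?C)"
            using elim t by (subst ennreal_mult) (auto intro!: add_nonneg_nonneg simp: ennreal_plus)
          also have "\<dots> = ennreal (sqrt \<epsilon>) * (g i j k \<phi> + g j i k \<phi> + g k i j \<phi>)"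
            using True elim by (simp add: g_def f_def ennreal_mult)
          finally show ?thesis using True by simp
        qed (auto simp: indicator_def)
      qed
    qed
    also have "\<dots> = ennreal (sqrt \<epsilon>) * ((\<integral>\<^sup>+\<phi>. g i j k \<phi> \<partial>torus) + (\<integral>\<^sup>+\<phi>. g j i k \<phi> \<partial>torus) + (\<integral>\<^sup>+\<phi>. g k i j \<phi> \<partial>torus))"
      by (simp add: nn_integral_cmult nn_integral_add)
    also have "\<dots> \<le> ennreal (sqrt \<epsilon>) * (ennreal \<tau> * I j k + ennreal \<tau> * I i k + ennreal \<tau> * I i j)"
      by (intro mult_left_mono add_mono gI) (use d in auto)
    also have "\<dots> = ennreal (sqrt \<epsilon>) * (ennreal \<tau> * ennreal K)" unfolding KI by (simp add: distrib_left)
    also have "\<dots> = ennreal (sqrt \<epsilon> * (\<tau> * K))" using t by (simp add: ennreal_mult K_def)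
    finally show ?thesis .
  qed
  then show ?thesis by (intro exI[of _ K]) (auto simp: K_def)
qed

text \<open>On the singular set inside the strip, the angle \<open>i\<close> is close to an extremum of its wave.\<close>

lemma near_perp:
  assumes r: "0 < radius P i" and n: "\<phi> \<in> near i P \<delta>" and a: "\<bar>P \<bullet> phase_vec \<phi>\<bar> \<le> \<tau>"
  shows "perp P i (\<phi> i) \<le> sqrt (2 * radius P i * (\<delta> + \<tau>))"
proof -
  define A where "A = wave 0 (eta P i) (zeta P i) (\<phi> i)"
  have AR: "\<bar>A\<bar> \<le> radius P i" unfolding A_def by (rule wave_le_radius)
  have "P \<bullet> phase_vec \<phi> = rest i P \<phi> + A" by (simp add: inner_phase[of _ _ i] A_def wave_def)
  then have "radius P i - \<bar>A\<bar> \<le> \<delta> + \<tau>" using n a unfolding near_def mem_Collect_eq by linarith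
  then have "(radius P i - \<bar>A\<bar>) * (radius P i + \<bar>A\<bar>) \<le> (\<delta> + \<tau>) * (2 * radius P i)"
    using AR by (intro mult_mono) auto
  moreover have "(radius P i - \<bar>A\<bar>) * (radius P i + \<bar>A\<bar>) = (perp P i (\<phi> i))\<^sup>2"
    using wave_perp[of P i "\<phi> i"] by (simp add: A_def power2_eq_square algebra_simps)
  ultimately have "(perp P i (\<phi> i))\<^sup>2 \<le> 2 * radius P i * (\<delta> + \<tau>)" by (simp add: mult.commute)
  then show ?thesis by (rule real_le_rsqrt)
qed

lemma negligible_three:
  assumes r: "0 < radius P i" "0 < radius P j" "0 < radius P k" and d: "i \<noteq> j" "i \<noteq> k" "j \<noteq> k"
  shows "negligible_near i P V"
  unfolding negligible_near_def
proof (intro allI impI)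
  fix e :: real and T :: "nat \<Rightarrow> real" assume e: "0 < e" and T: "T \<longlonglongrightarrow> 0" "\<forall>n. 0 < T n"
  obtain K where K: "K \<ge> 0" "\<And>\<tau> \<epsilon>. \<tau> \<ge> 0 \<Longrightarrow> \<epsilon> \<ge> 0 \<Longrightarrow>
     (\<integral>\<^sup>+\<phi>. indicator (strip P \<tau>) \<phi> * indicator {\<phi>. perp P i (\<phi> i) \<le> \<epsilon>} \<phi> \<partial>torus)
     \<le> ennreal (sqrt \<epsilon> * (\<tau> * K))" using strip_perp_small[OF r d] by blast
  define B where "B = norm V * phase_bound"
  have B0: "B \<ge> 0" using phase_bound(1) by (simp add: B_def)
  define c where "c = 2 * B\<^sup>2 * K"
  have c0: "c \<ge> 0" using K by (simp add: c_def)
  define s where "s = e / (c + 1)"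
  have s: "s > 0" "c * s \<le> e" using e c0 by (auto simp: s_def field_simps)
  \<comment> \<open>With this \<open>\<delta>\<close> and \<open>T n * B \<le> \<delta>\<close>, \<open>near_perp\<close> bounds \<open>perp P i\<close> by \<open>s\<^sup>2\<close>.\<close>
  define \<delta> where "\<delta> = s ^ 4 / (4 * radius P i)"
  have d0: "\<delta> > 0" using s r by (simp add: \<delta>_def)
  have "(\<lambda>n. T n * B) \<longlonglongrightarrow> 0 * B" by (intro tendsto_intros T)
  then have evT: "\<forall>\<^sub>F n in sequentially. T n * B < \<delta>" using d0 by (intro order_tendstoD(2)) auto
  show "\<exists>\<delta>>0. \<forall>\<^sub>F n in sequentially. (\<integral>\<^sup>+\<phi>. ennreal (gap (P \<bullet> phase_vec \<phi>) ((T n *\<^sub>R V) \<bullet> phase_vec \<phi>)) * indicator (near i P \<delta>) \<phi> \<partial>torus)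
       \<le> ennreal (e * (T n)\<^sup>2)"
  proof (intro exI[of _ \<delta>] conjI d0)
    show "\<forall>\<^sub>F n in sequentially. (\<integral>\<^sup>+\<phi>. ennreal (gap (P \<bullet> phase_vec \<phi>) ((T n *\<^sub>R V) \<bullet> phase_vec \<phi>)) * indicator (near i P \<delta>) \<phi> \<partial>torus)
       \<le> ennreal (e * (T n)\<^sup>2)"
      using evT
    proof eventually_elim
      case (elim n)
      define t where "t = T n"
      have t: "t > 0" "t * B < \<delta>" using T(2) elim by (auto simp: t_def)
      have perp_s: "perp P i (\<phi> i) \<le> s\<^sup>2" if "\<phi> \<in> near i P \<delta>" "\<bar>P \<bullet> phase_vec \<phi>\<bar> \<le> t * B" for \<phi>
      proof -
        have "perp P i (\<phi> i) \<le> sqrt (2 * radius P i * (\<delta> + t * B))" by (rule near_perp[OF r(1) that])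
        also have "\<dots> \<le> sqrt (2 * radius P i * (\<delta> + \<delta>))" using t r by (intro real_sqrt_le_mono mult_left_mono) auto
        also have "2 * radius P i * (\<delta> + \<delta>) = (s\<^sup>2)\<^sup>2" using r by (simp add: \<delta>_def power2_eq_square power4_eq_xxxx)
        also have "sqrt ((s\<^sup>2)\<^sup>2) = s\<^sup>2" by (rule real_sqrt_unique) auto
        finally show ?thesis .
      qed
      have "(\<integral>\<^sup>+\<phi>. ennreal (gap (P \<bullet> phase_vec \<phi>) ((t *\<^sub>R V) \<bullet> phase_vec \<phi>)) * indicator (near i P \<delta>) \<phi> \<partial>torus)
        \<le> (\<integral>\<^sup>+\<phi>. ennreal (2 * t * \<bar>V \<bullet> phase_vec \<phi>\<bar>) * indicator (strip P (t * B)) \<phi>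
        * indicator (near i P \<delta>) \<phi> \<partial>torus)" unfolding B_def by (rule gap_near_le[OF t(1)])
      also have "\<dots> \<le> (\<integral>\<^sup>+\<phi>. ennreal (2 * t * B) * (indicator (strip P (t * B)) \<phi> * indicator {\<phi>. perp P i (\<phi> i) \<le> s\<^sup>2} \<phi>) \<partial>torus)"
      proof (rule nn_integral_mono)
        fix \<phi> :: "'n \<Rightarrow> real"
        have "ennreal (2 * t * \<bar>V \<bullet> phase_vec \<phi>\<bar>) \<le> ennreal (2 * t * B)"
          using t inner_phase_bound[of V \<phi>] unfolding B_def by (intro ennreal_leI mult_left_mono) auto
        then show "ennreal (2 * t * \<bar>V \<bullet> phase_vec \<phi>\<bar>) * indicator (strip P (t * B)) \<phi> * indicator (near i P \<delta>) \<phi>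
          \<le> ennreal (2 * t * B) * (indicator (strip P (t * B)) \<phi> * indicator {\<phi>. perp P i (\<phi> i) \<le> s\<^sup>2} \<phi>)"
          using perp_s[of \<phi>] by (auto simp: indicator_def)
      qed
      also have "\<dots> = ennreal (2 * t * B) * (\<integral>\<^sup>+\<phi>. indicator (strip P (t * B)) \<phi> * indicator {\<phi>. perp P i (\<phi> i) \<le> s\<^sup>2} \<phi> \<partial>torus)"
        by (rule nn_integral_cmult) measurable
      also have "\<dots> \<le> ennreal (2 * t * B) * ennreal (sqrt (s\<^sup>2) * (t * B * K))"
        by (intro mult_left_mono K(2)) (use t B0 in auto)
      also have "\<dots> = ennreal (2 * t * B * (sqrt (s\<^sup>2) * (t * B * K)))"
        using t B0 K s by (intro ennreal_mult[symmetric]) auto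
      also have "\<dots> \<le> ennreal (e * t\<^sup>2)"
      proof (rule ennreal_leI)
        have "2 * t * B * (sqrt (s\<^sup>2) * (t * B * K)) = c * s * t\<^sup>2" using s by (simp add: c_def power2_eq_square)
        also have "\<dots> \<le> e * t\<^sup>2" using s by (intro mult_right_mono) auto
        finally show "2 * t * B * (sqrt (s\<^sup>2) * (t * B * K)) \<le> e * t\<^sup>2" .
      qed
      finally show ?case by (simp add: t_def)
    qed
  qed
qed

lemma perp_measure_small:
  assumes r: "0 < radius P x" and s: "0 < s"
  shows "\<exists>\<epsilon>>0. measure torus {\<phi>. perp P x (\<phi> x) \<le> \<epsilon>} \<le> s"
proof -
  have "(\<lambda>n. \<integral>\<phi>. indicator {\<phi>. perp P x (\<phi> x) \<le> inverse (real (Suc n))} \<phi> \<partial>torus) \<longlonglongrightarrow> (\<integral>\<phi>. (0::real) \<partial>(torus :: ('n \<Rightarrow> real) measure))"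
  proof (rule integral_dominated_convergence[where w = "\<lambda>_. 1" and f = "\<lambda>_. 0"
        and s = "\<lambda>n \<phi>. indicator {\<phi>. perp P x (\<phi> x) \<le> inverse (real (Suc n))} \<phi>"])
    show "AE \<phi> in torus. (\<lambda>n. indicator {\<phi>. perp P x (\<phi> x) \<le> inverse (real (Suc n))} \<phi>) \<longlonglongrightarrow> (0::real)"
      using torus_AE_perp[OF r]
    proof eventually_elim
      fix \<phi> assume "0 < perp P x (\<phi> x)"
      then have "\<forall>\<^sub>F n in sequentially. inverse (real (Suc n)) < perp P x (\<phi> x)"
        by (rule order_tendstoD(2)[OF LIMSEQ_inverse_real_of_nat])
      then have "\<forall>\<^sub>F n in sequentially. indicator {\<phi>. perp P x (\<phi> x) \<le> inverse (real (Suc n))} \<phi> = (0::real)"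
        by eventually_elim simp
      then show "(\<lambda>n. indicator {\<phi>. perp P x (\<phi> x) \<le> inverse (real (Suc n))} \<phi>) \<longlonglongrightarrow> (0::real)"
        by (rule tendsto_eventually)
    qed
    show "integrable (torus :: ('n \<Rightarrow> real) measure) (\<lambda>_. 1 :: real)" by simp
  qed (auto simp: indicator_def)
  then have "(\<lambda>n. measure torus {\<phi>. perp P x (\<phi> x) \<le> inverse (real (Suc n))}) \<longlonglongrightarrow> 0" by simp
  then have "\<forall>\<^sub>F n in sequentially. measure torus {\<phi>. perp P x (\<phi> x) \<le> inverse (real (Suc n))} < s"
    using s by (rule order_tendstoD(2))
  then obtain n where "measure torus {\<phi>. perp P x (\<phi> x) \<le> inverse (real (Suc n))} < s"
    unfolding eventually_sequentially by blast
  then show ?thesis by (intro exI[of _ "inverse (real (Suc n))"]) auto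
qed

lemma orthogonal_wave_bound:
  assumes o: "\<alpha> * \<eta> + \<beta> * \<zeta> = 0" and r: "\<eta>\<^sup>2 + \<zeta>\<^sup>2 > 0"
  shows "\<bar>wave 0 \<alpha> \<beta> y\<bar> \<le> \<bar>\<beta> * \<eta> - \<alpha> * \<zeta>\<bar> / (\<eta>\<^sup>2 + \<zeta>\<^sup>2) * \<bar>\<eta> * sin y - \<zeta> * cos y\<bar>"
proof -
  have "(\<alpha> * cos y + \<beta> * sin y) * (\<eta>\<^sup>2 + \<zeta>\<^sup>2)
     = (\<alpha> * \<eta> + \<beta> * \<zeta>) * (\<eta> * cos y + \<zeta> * sin y) + (\<beta> * \<eta> - \<alpha> * \<zeta>) * (\<eta> * sin y - \<zeta> * cos y)"
    by (simp add: power2_eq_square algebra_simps)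
  then have "\<bar>wave 0 \<alpha> \<beta> y\<bar> * (\<eta>\<^sup>2 + \<zeta>\<^sup>2) = \<bar>\<beta> * \<eta> - \<alpha> * \<zeta>\<bar> * \<bar>\<eta> * sin y - \<zeta> * cos y\<bar>"
    using r unfolding wave_def o by (metis abs_mult abs_of_pos add_0 mult_zero_left)
  then show ?thesis using r by (simp add: field_simps)
qed

text \<open>
  Two equal amplitudes and all others zero: here the curvature is infinite in some directions. Finiteness
  in the direction \<open>V\<close> forces \<open>V\<close> to be tangential up to a multiple of \<open>P\<close>.
\<close>

lemma pair_directions:
  assumes ij: "i \<noteq> j" and r: "radius P j = radius P i" "0 < radius P i"
    and z: "\<And>k. k \<noteq> i \<Longrightarrow> k \<noteq> j \<Longrightarrow> P $ k = 0" and V: "V \<in> curv_dom i P"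
  defines "W \<equiv> V + (- tang i P V) *\<^sub>R P"
  shows "\<And>k. k \<noteq> i \<Longrightarrow> k \<noteq> j \<Longrightarrow> W $ k = 0"
    and "eta W j * eta P j + zeta W j * zeta P j = 0" and "eta W i * eta P i + zeta W i * zeta P i = 0"
proof -
  have rj: "(eta P j)\<^sup>2 + (zeta P j)\<^sup>2 > 0" using r by (simp add: radius_def)
  have restP: "rest i P \<phi> = wave 0 (eta P j) (zeta P j) (\<phi> j)" for \<phi>
  proof -
    have "rest i P \<phi> = wave 0 (eta P j) (zeta P j) (\<phi> j) + (\<Sum>k\<in>UNIV - {i} - {j}. wave 0 (eta P k) (zeta P k) (\<phi> k))"
      unfolding rest_def by (rule sum.remove) (use ij in auto)
    also have "(\<Sum>k\<in>UNIV - {i} - {j}. wave 0 (eta P k) (zeta P k) (\<phi> k)) = 0"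
      by (intro sum.neutral) (simp add: z eta_def zeta_def wave_def)
    finally show ?thesis by simp
  qed
  have w1P: "normal_weight i P \<phi> = 2 / pi / perp P j (\<phi> j)" for \<phi>
  proof -
    have e: "(radius P i)\<^sup>2 - (rest i P \<phi>)\<^sup>2 = (perp P j (\<phi> j))\<^sup>2"
      using wave_perp[of P j "\<phi> j"] r(1) by (simp add: restP)
    have "(rest i P \<phi>)\<^sup>2 < (radius P i)\<^sup>2 \<longleftrightarrow> 0 < (perp P j (\<phi> j))\<^sup>2" using e by linarith
    then show ?thesis unfolding normal_weight_def e using perp_nonneg[of P j "\<phi> j"] by (auto simp: real_sqrt_abs)
  qed
  define W' where "W' = (\<chi> k. if k = i \<or> k = j then 0 else W $ k)"
  have kW: "normal_part i P V \<phi> = W' \<bullet> phase_vec \<phi> + wave 0 (eta W j) (zeta W j) (\<phi> j)" for \<phi>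
  proof -
    have "normal_part i P V \<phi> = rest i W \<phi>" unfolding normal_part_def W_def rest_add by simp
    also have "\<dots> = wave 0 (eta W j) (zeta W j) (\<phi> j) + (\<Sum>k\<in>UNIV - {i} - {j}. wave 0 (eta W k) (zeta W k) (\<phi> k))"
      unfolding rest_def by (rule sum.remove) (use ij in auto)
    also have "(\<Sum>k\<in>UNIV - {i} - {j}. wave 0 (eta W k) (zeta W k) (\<phi> k)) = W' \<bullet> phase_vec \<phi>"
      unfolding inner_phase_sum
      by (rule sum.mono_neutral_cong_left) (auto simp: W'_def eta_def zeta_def wave_def)
    finally show ?thesis by simp
  qed
  have W'upd: "W' \<bullet> phase_vec (\<phi>(j := y)) = W' \<bullet> phase_vec \<phi>" for \<phi> y
    unfolding inner_phase_sum by (intro sum.cong) (auto simp: W'_def eta_def zeta_def wave_def)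
  define F where "F \<phi> = ennreal ((normal_part i P V \<phi>)\<^sup>2 / perp P j (\<phi> j))" for \<phi>
  have [measurable]: "F \<in> borel_measurable torus" unfolding F_def[abs_def] by measurable
  have "(\<integral>\<^sup>+\<phi>. ennreal (2 / pi) * F \<phi> \<partial>torus) \<le> (\<integral>\<^sup>+\<phi>. ennreal (mform i P V V \<phi>) \<partial>torus)"
  proof (rule nn_integral_mono)
    fix \<phi> :: "'n \<Rightarrow> real"
    have "2 / pi * ((normal_part i P V \<phi>)\<^sup>2 / perp P j (\<phi> j)) = normal_weight i P \<phi> * (normal_part i P V \<phi> * normal_part i P V \<phi>)"
      by (simp add: w1P power2_eq_square)
    also have "\<dots> \<le> mform i P V V \<phi>" unfolding mform_def using w_nonneg by simp
    finally show "ennreal (2 / pi) * F \<phi> \<le> ennreal (mform i P V V \<phi>)"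
      unfolding F_def by (subst ennreal_mult[symmetric]) (auto simp: perp_nonneg intro: ennreal_leI)
  qed
  also have "\<dots> = ennreal (\<integral>\<phi>. mform i P V V \<phi> \<partial>torus)"
    using V mform_nonneg by (intro nn_integral_eq_integral) (auto simp: curv_dom_def)
  also have "\<dots> < \<infinity>" by simp
  finally have "ennreal (2 / pi) * (\<integral>\<^sup>+\<phi>. F \<phi> \<partial>torus) < \<infinity>" by (simp add: nn_integral_cmult)
  moreover have "ennreal (2 / pi) \<noteq> 0" by simp
  ultimately have "(\<integral>\<^sup>+\<phi>. F \<phi> \<partial>torus) < \<infinity>"
    by (auto simp: ennreal_mult_less_top)
  also have "(\<integral>\<^sup>+\<phi>. F \<phi> \<partial>torus) = (\<integral>\<^sup>+\<phi>. \<integral>\<^sup>+y. F (\<phi>(j := y)) \<partial>circ \<partial>torus)" by (rule resample) measurable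
  finally have ae: "AE \<phi> in torus. (\<integral>\<^sup>+y. F (\<phi>(j := y)) \<partial>circ) \<noteq> \<infinity>"
    by (intro nn_integral_PInf_AE resample_measurable) auto
  have sing: "W' \<bullet> phase_vec \<phi> = 0 \<and> eta W j * eta P j + zeta W j * zeta P j = 0"
    if "(\<integral>\<^sup>+y. F (\<phi>(j := y)) \<partial>circ) \<noteq> \<infinity>" for \<phi>
  proof -
    have "(\<integral>\<^sup>+y. F (\<phi>(j := y)) \<partial>circ) = (\<integral>\<^sup>+y. ennreal ((W' \<bullet> phase_vec \<phi> + eta W j * cos y + zeta W j * sin y)\<^sup>2 / \<bar>eta P j * sin y - zeta P j * cos y\<bar>) \<partial>circ)"
      by (simp add: F_def kW W'upd perp_def wave_def add.assoc)
    then have "(\<integral>\<^sup>+y. ennreal ((W' \<bullet> phase_vec \<phi> + eta W j * cos y + zeta W j * sin y)\<^sup>2 / \<bar>eta P j * sin y - zeta P j * cos y\<bar>) \<partial>circ) < \<infinity>"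
      using that by (simp add: less_top)
    from circ_singular[OF rj this] show ?thesis by simp
  qed
  have ae': "AE \<phi> in torus. W' \<bullet> phase_vec \<phi> = 0 \<and> eta W j * eta P j + zeta W j * zeta P j = 0"
    using ae by eventually_elim (rule sing)
  have "W' = 0"
  proof (rule ccontr)
    assume "W' \<noteq> 0"
    from ae' torus_AE_nonzero[OF this] have "AE \<phi> in (torus :: ('n \<Rightarrow> real) measure). False" by (rule eventually_elim2) simp
    then show False using torus.AE_False by simp
  qed
  show "W $ k = 0" if "k \<noteq> i" "k \<noteq> j" for k
  proof -
    have "W $ k = W' $ k" using that by (simp add: W'_def)
    then show ?thesis using \<open>W' = 0\<close> by simp
  qed
  show "eta W j * eta P j + zeta W j * zeta P j = 0"
  proof (rule ccontr)
    assume n: "eta W j * eta P j + zeta W j * zeta P j \<noteq> 0"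
    from ae' have "AE \<phi> in (torus :: ('n \<Rightarrow> real) measure). False" by eventually_elim (use n in simp)
    then show False using torus.AE_False by simp
  qed
  have "eta W i * eta P i + zeta W i * zeta P i = eta P i * eta V i + zeta P i * zeta V i - tang i P V * (radius P i)\<^sup>2"
    unfolding W_def eta_add zeta_add radius_sq by (simp add: power2_eq_square algebra_simps)
  also have "\<dots> = 0" using r by (simp add: tang_def)
  finally show "eta W i * eta P i + zeta W i * zeta P i = 0" .
qed

text \<open>
  In the directions found above, \<open>V \<bullet> phase_vec \<phi>\<close> is bounded by the wave of \<open>P\<close> and by the two weights \<open>perp\<close>,
  so it is small on the singular set, which compensates for the infinite density of the wave of \<open>P\<close> at zero.
\<close>

lemma negligible_pair:
  assumes ij: "i \<noteq> j" and r: "radius P j = radius P i" "0 < radius P i"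
    and z: "\<And>k. k \<noteq> i \<Longrightarrow> k \<noteq> j \<Longrightarrow> P $ k = 0" and V: "V \<in> curv_dom i P"
  shows "negligible_near i P V"
  unfolding negligible_near_def
proof (intro allI impI)
  fix e :: real and T :: "nat \<Rightarrow> real" assume e: "0 < e" and T: "T \<longlonglongrightarrow> 0" "\<forall>n. 0 < T n"
  have P0: "P \<noteq> 0" using r(2) radius_pos_iff by auto
  have rj: "0 < radius P j" using r by simp
  define \<sigma> where "\<sigma> = tang i P V"
  define W where "W = V + (- \<sigma>) *\<^sub>R P"
  note W = pair_directions[OF ij r z V, folded \<sigma>_def, folded W_def]
  define M where "M x = \<bar>zeta W x * eta P x - eta W x * zeta P x\<bar> / ((eta P x)\<^sup>2 + (zeta P x)\<^sup>2)" for x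
  have M0: "M x \<ge> 0" for x by (simp add: M_def)
  have Wb: "\<bar>V \<bullet> phase_vec \<phi>\<bar> \<le> \<bar>\<sigma>\<bar> * \<bar>P \<bullet> phase_vec \<phi>\<bar> + M i * perp P i (\<phi> i) + M j * perp P j (\<phi> j)" for \<phi>
  proof -
    have "W \<bullet> phase_vec \<phi> = wave 0 (eta W i) (zeta W i) (\<phi> i) + wave 0 (eta W j) (zeta W j) (\<phi> j)"
    proof -
      have "W \<bullet> phase_vec \<phi> = (\<Sum>k\<in>{i, j}. wave 0 (eta W k) (zeta W k) (\<phi> k))"
        unfolding inner_phase_sum by (rule sum.mono_neutral_right) (auto simp: W(1) eta_def zeta_def wave_def)
      then show ?thesis using ij by simp
    qed
    moreover have "\<bar>wave 0 (eta W x) (zeta W x) (\<phi> x)\<bar> \<le> M x * perp P x (\<phi> x)" if "x = i \<or> x = j" for x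
    proof -
      have "(eta P x)\<^sup>2 + (zeta P x)\<^sup>2 > 0" using that r rj by (auto simp: radius_def)
      moreover have "eta W x * eta P x + zeta W x * zeta P x = 0" using that W by auto
      ultimately show ?thesis unfolding M_def perp_def by (intro orthogonal_wave_bound)
    qed
    ultimately have "\<bar>W \<bullet> phase_vec \<phi>\<bar> \<le> M i * perp P i (\<phi> i) + M j * perp P j (\<phi> j)"
      by (smt (verit))
    moreover have "V \<bullet> phase_vec \<phi> = W \<bullet> phase_vec \<phi> + \<sigma> * (P \<bullet> phase_vec \<phi>)"
      by (simp add: W_def inner_add_left inner_diff_left)
    ultimately show ?thesis using abs_triangle_ineq[of "W \<bullet> phase_vec \<phi>" "\<sigma> * (P \<bullet> phase_vec \<phi>)"]
      by (simp add: abs_mult)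
  qed
  define B where "B = norm V * phase_bound"
  have B0: "B \<ge> 0" using phase_bound(1) by (simp add: B_def)
  define c where "c = 2 * B * (\<bar>\<sigma>\<bar> + M i + M j)"
  have c0: "c \<ge> 0" using B0 M0 by (simp add: c_def)
  define s where "s = e / (c + 1)"
  have s: "s > 0" "c * s \<le> e" using e c0 by (auto simp: s_def field_simps)
  obtain \<epsilon>1 where e1: "\<epsilon>1 > 0" "measure torus {\<phi>. perp P i (\<phi> i) \<le> \<epsilon>1} \<le> s"
    using perp_measure_small[OF r(2) s(1)] by blast
  obtain \<epsilon>2 where e2: "\<epsilon>2 > 0" "measure torus {\<phi>. perp P j (\<phi> j) \<le> \<epsilon>2} \<le> s"
    using perp_measure_small[OF rj s(1)] by blast
  define \<epsilon> where "\<epsilon> = min \<epsilon>1 \<epsilon>2"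
  have ep: "\<epsilon> > 0" using e1 e2 by (simp add: \<epsilon>_def)
  have small: "measure torus {\<phi>. perp P x (\<phi> x) \<le> \<epsilon>} \<le> s" if "x = i \<or> x = j" for x
  proof -
    have "measure torus {\<phi>. perp P i (\<phi> i) \<le> \<epsilon>} \<le> measure torus {\<phi>. perp P i (\<phi> i) \<le> \<epsilon>1}"
      "measure torus {\<phi>. perp P j (\<phi> j) \<le> \<epsilon>} \<le> measure torus {\<phi>. perp P j (\<phi> j) \<le> \<epsilon>2}"
      by (auto intro!: torus.finite_measure_mono simp: \<epsilon>_def)
    then show ?thesis using that e1 e2 by auto
  qed
  \<comment> \<open>With this \<open>\<delta>\<close> and \<open>T n * B \<le> \<delta>\<close>, both weights are at most \<open>\<epsilon>\<close> on the singular set inside the strip.\<close>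
  define \<delta> where "\<delta> = \<epsilon>\<^sup>2 / (4 * radius P i)"
  have d0: "\<delta> > 0" using ep r by (simp add: \<delta>_def)
  have dd: "sqrt (2 * radius P i * (\<delta> + \<delta>)) = \<epsilon>"
  proof -
    have "2 * radius P i * (\<delta> + \<delta>) = \<epsilon>\<^sup>2" using r by (simp add: \<delta>_def)
    then show ?thesis using ep by simp
  qed
  have nearj: "perp P j (\<phi> j) \<le> \<epsilon>" if "\<phi> \<in> near i P \<delta>" for \<phi>
  proof -
    define A where "A = wave 0 (eta P j) (zeta P j) (\<phi> j)"
    have AR: "\<bar>A\<bar> \<le> radius P i" unfolding A_def r(1)[symmetric] by (rule wave_le_radius)
    have "rest i P \<phi> = A + (\<Sum>k\<in>UNIV - {i} - {j}. wave 0 (eta P k) (zeta P k) (\<phi> k))"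
      unfolding rest_def A_def by (rule sum.remove) (use ij in auto)
    also have "(\<Sum>k\<in>UNIV - {i} - {j}. wave 0 (eta P k) (zeta P k) (\<phi> k)) = 0"
      by (intro sum.neutral) (simp add: z eta_def zeta_def wave_def)
    finally have "radius P i - \<bar>A\<bar> \<le> \<delta>" using that AR by (simp add: near_def)
    then have "(radius P i - \<bar>A\<bar>) * (radius P i + \<bar>A\<bar>) \<le> (\<delta> + \<delta>) * (2 * radius P i)"
      using AR d0 by (intro mult_mono) auto
    moreover have "(radius P i - \<bar>A\<bar>) * (radius P i + \<bar>A\<bar>) = (perp P j (\<phi> j))\<^sup>2"
      using wave_perp[of P j "\<phi> j"] r(1) by (simp add: A_def power2_eq_square algebra_simps)
    ultimately have "(perp P j (\<phi> j))\<^sup>2 \<le> 2 * radius P i * (\<delta> + \<delta>)" by (simp add: mult.commute)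
    then show ?thesis unfolding dd[symmetric] by (rule real_le_rsqrt)
  qed
  have TB: "(\<lambda>n. T n * B) \<longlonglongrightarrow> 0" using tendsto_mult[OF T(1) tendsto_const[of B]] by simp
  have ev1: "\<forall>\<^sub>F n in sequentially. T n * B < \<delta>" using TB d0 by (rule order_tendstoD(2))
  have ev2: "\<forall>\<^sub>F n in sequentially. measure torus (strip P (T n * B)) < s"
    using strip_measure_tendsto[OF P0 TB] s(1) by (rule order_tendstoD(2))
  show "\<exists>\<delta>>0. \<forall>\<^sub>F n in sequentially. (\<integral>\<^sup>+\<phi>. ennreal (gap (P \<bullet> phase_vec \<phi>) ((T n *\<^sub>R V) \<bullet> phase_vec \<phi>)) * indicator (near i P \<delta>) \<phi> \<partial>torus)
       \<le> ennreal (e * (T n)\<^sup>2)"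
  proof (intro exI[of _ \<delta>] conjI d0)
    show "\<forall>\<^sub>F n in sequentially. (\<integral>\<^sup>+\<phi>. ennreal (gap (P \<bullet> phase_vec \<phi>) ((T n *\<^sub>R V) \<bullet> phase_vec \<phi>)) * indicator (near i P \<delta>) \<phi> \<partial>torus)
       \<le> ennreal (e * (T n)\<^sup>2)"
      using ev1 ev2
    proof eventually_elim
      case (elim n)
      define t where "t = T n"
      have t: "t > 0" "t * B < \<delta>" "measure torus (strip P (t * B)) < s" "t * B \<ge> 0"
        using T(2)[rule_format, of n] elim B0 by (simp_all add: t_def)
      let ?S = "strip P (t * B)"
      let ?E = "\<lambda>x. {\<phi>. perp P x (\<phi> x) \<le> \<epsilon>}"
      have neari: "perp P i (\<phi> i) \<le> \<epsilon>" if "\<phi> \<in> near i P \<delta>" "\<phi> \<in> ?S" for \<phi>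
      proof -
        have "perp P i (\<phi> i) \<le> sqrt (2 * radius P i * (\<delta> + t * B))" by (rule near_perp[OF r(2)]) (use that in auto)
        also have "\<dots> \<le> sqrt (2 * radius P i * (\<delta> + \<delta>))" using t r by (intro real_sqrt_le_mono mult_left_mono) auto
        finally show ?thesis unfolding dd .
      qed
      define u where "u x y \<phi> = indicator ?S \<phi> * ennreal (perp P x (\<phi> x)) * indicator (?E y) \<phi>" for x y \<phi>
      have [measurable]: "u x y \<in> borel_measurable torus" for x y unfolding u_def[abs_def] by measurable
      have uI: "(\<integral>\<^sup>+\<phi>. u x y \<phi> \<partial>torus) \<le> ennreal (t * B * s)" if "x \<noteq> y" "y = i \<or> y = j" for x y
      proof -
        have "(\<integral>\<^sup>+\<phi>. u x y \<phi> \<partial>torus) \<le> ennreal (t * B) * (\<integral>\<^sup>+\<phi>. indicator (?E y) \<phi> \<partial>torus)"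
          unfolding u_def by (rule strip_weighted) (use that t in \<open>auto simp: indicator_def\<close>)
        also have "(\<integral>\<^sup>+\<phi>. indicator (?E y) \<phi> \<partial>torus) = ennreal (measure torus (?E y))"
          by (simp add: torus.emeasure_eq_measure)
        also have "ennreal (t * B) * \<dots> \<le> ennreal (t * B) * ennreal s"
          using small[OF that(2)] by (intro mult_left_mono ennreal_leI) auto
        also have "\<dots> = ennreal (t * B * s)" using t s by (intro ennreal_mult[symmetric]) auto
        finally show ?thesis .
      qed
      have "(\<integral>\<^sup>+\<phi>. ennreal (gap (P \<bullet> phase_vec \<phi>) ((t *\<^sub>R V) \<bullet> phase_vec \<phi>)) * indicator (near i P \<delta>) \<phi> \<partial>torus)
        \<le> (\<integral>\<^sup>+\<phi>. ennreal (2 * t * \<bar>V \<bullet> phase_vec \<phi>\<bar>) * indicator ?S \<phi> * indicator (near i P \<delta>) \<phi> \<partial>torus)"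
        unfolding B_def by (rule gap_near_le[OF t(1)])
      also have "\<dots> \<le> (\<integral>\<^sup>+\<phi>. ennreal (2 * t * (\<bar>\<sigma>\<bar> * (t * B))) * indicator ?S \<phi>
          + (ennreal (2 * t * M i) * u i j \<phi> + ennreal (2 * t * M j) * u j i \<phi>) \<partial>torus)"
      proof (rule nn_integral_mono)
        fix \<phi> :: "'n \<Rightarrow> real"
        show "ennreal (2 * t * \<bar>V \<bullet> phase_vec \<phi>\<bar>) * indicator ?S \<phi> * indicator (near i P \<delta>) \<phi>
          \<le> ennreal (2 * t * (\<bar>\<sigma>\<bar> * (t * B))) * indicator ?S \<phi>
          + (ennreal (2 * t * M i) * u i j \<phi> + ennreal (2 * t * M j) * u j i \<phi>)"
        proof (cases "\<phi> \<in> ?S \<and> \<phi> \<in> near i P \<delta>")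
          case True
          have "\<bar>V \<bullet> phase_vec \<phi>\<bar> \<le> \<bar>\<sigma>\<bar> * (t * B) + (M i * perp P i (\<phi> i) + M j * perp P j (\<phi> j))"
            using Wb[of \<phi>] True mult_left_mono[of "\<bar>P \<bullet> phase_vec \<phi>\<bar>" "t * B" "\<bar>\<sigma>\<bar>"] by simp
          then have "2 * t * \<bar>V \<bullet> phase_vec \<phi>\<bar> \<le> 2 * t * (\<bar>\<sigma>\<bar> * (t * B) + (M i * perp P i (\<phi> i) + M j * perp P j (\<phi> j)))"
            using t by (intro mult_left_mono) auto
          also have "\<dots> = 2 * t * (\<bar>\<sigma>\<bar> * (t * B)) + (2 * t * M i * perp P i (\<phi> i) + 2 * t * M j * perp P j (\<phi> j))"
            by (simp add: distrib_left mult.assoc)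
          finally have "ennreal (2 * t * \<bar>V \<bullet> phase_vec \<phi>\<bar>)
             \<le> ennreal (2 * t * (\<bar>\<sigma>\<bar> * (t * B)) + (2 * t * M i * perp P i (\<phi> i) + 2 * t * M j * perp P j (\<phi> j)))"
            by (rule ennreal_leI)
          also have "\<dots> = ennreal (2 * t * (\<bar>\<sigma>\<bar> * (t * B))) + (ennreal (2 * t * M i) * ennreal (perp P i (\<phi> i)) + ennreal (2 * t * M j) * ennreal (perp P j (\<phi> j)))"
          proof -
            have n: "0 \<le> 2 * t * (\<bar>\<sigma>\<bar> * (t * B))" "0 \<le> 2 * t * M i" "0 \<le> 2 * t * M j"
              using t M0 by (auto intro!: mult_nonneg_nonneg)
            show ?thesis using n perp_nonneg by (simp only: ennreal_plus ennreal_mult mult_nonneg_nonneg add_nonneg_nonneg)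
          qed
          finally show ?thesis using True neari[of \<phi>] nearj[of \<phi>] by (simp add: u_def)
        next
          case False
          then show ?thesis by (auto simp: indicator_def)
        qed
      qed
      also have "\<dots> = ennreal (2 * t * (\<bar>\<sigma>\<bar> * (t * B))) * ennreal (measure torus ?S)
          + (ennreal (2 * t * M i) * (\<integral>\<^sup>+\<phi>. u i j \<phi> \<partial>torus) + ennreal (2 * t * M j) * (\<integral>\<^sup>+\<phi>. u j i \<phi> \<partial>torus))"
        by (simp add: nn_integral_add nn_integral_cmult nn_integral_cmult_indicator torus.emeasure_eq_measure)
      also have "\<dots> \<le> ennreal (2 * t * (\<bar>\<sigma>\<bar> * (t * B))) * ennreal s
          + (ennreal (2 * t * M i) * ennreal (t * B * s) + ennreal (2 * t * M j) * ennreal (t * B * s))"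
        using t ij by (intro add_mono mult_left_mono uI ennreal_leI) auto
      also have "\<dots> = ennreal (2 * t * (\<bar>\<sigma>\<bar> * (t * B)) * s + (2 * t * M i * (t * B * s) + 2 * t * M j * (t * B * s)))"
      proof -
        have n: "0 \<le> 2 * t * (\<bar>\<sigma>\<bar> * (t * B))" "0 \<le> 2 * t * M i" "0 \<le> 2 * t * M j" "0 \<le> s" "0 \<le> t * B * s"
          using t M0 s by (auto intro!: mult_nonneg_nonneg)
        then show ?thesis by (simp only: ennreal_plus ennreal_mult mult_nonneg_nonneg add_nonneg_nonneg)
      qed
      also have "\<dots> \<le> ennreal (e * t\<^sup>2)"
      proof (rule ennreal_leI)
        have "2 * t * (\<bar>\<sigma>\<bar> * (t * B)) * s + (2 * t * M i * (t * B * s) + 2 * t * M j * (t * B * s)) = c * s * t\<^sup>2"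
          by (simp add: c_def power2_eq_square algebra_simps)
        also have "\<dots> \<le> e * t\<^sup>2" using s by (intro mult_right_mono) auto
        finally show "2 * t * (\<bar>\<sigma>\<bar> * (t * B)) * s + (2 * t * M i * (t * B * s) + 2 * t * M j * (t * B * s)) \<le> e * t\<^sup>2" .
      qed
      finally show ?case by (simp add: t_def)
    qed
  qed
qed

text \<open>For the largest amplitude the three cases are exhaustive.\<close>

lemma negligible_max:
  assumes r: "0 < radius P i" and max: "\<And>j. radius P j \<le> radius P i" and V: "V \<in> curv_dom i P"
  shows "negligible_near i P V"
proof (cases "(\<Sum>j\<in>UNIV - {i}. radius P j) < radius P i")
  case True
  then show ?thesis by (rule negligible_dominant)
next
  case False
  then have ge: "radius P i \<le> (\<Sum>j\<in>UNIV - {i}. radius P j)" by simp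
  have "\<exists>j\<in>UNIV - {i}. 0 < radius P j"
  proof (rule ccontr)
    assume "\<not> ?thesis"
    then have "(\<Sum>j\<in>UNIV - {i}. radius P j) \<le> 0" by (intro sum_nonpos) (auto simp: not_less)
    then show False using ge r by simp
  qed
  then obtain j where j: "j \<noteq> i" "0 < radius P j" by blast
  show ?thesis
  proof (cases "\<exists>k. k \<noteq> i \<and> k \<noteq> j \<and> 0 < radius P k")
    case True
    then obtain k where k: "k \<noteq> i" "k \<noteq> j" "0 < radius P k" by blast
    show ?thesis by (rule negligible_three[OF r j(2) k(3)]) (use j k in auto)
  next
    case no: False
    then have z: "radius P k = 0" if "k \<noteq> i" "k \<noteq> j" for k using that radius_nonneg[of P k] by (metis le_less)
    have "(\<Sum>k\<in>UNIV - {i}. radius P k) = radius P j + (\<Sum>k\<in>UNIV - {i} - {j}. radius P k)"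
      by (rule sum.remove) (use j in auto)
    also have "(\<Sum>k\<in>UNIV - {i} - {j}. radius P k) = 0" by (intro sum.neutral) (simp add: z)
    finally have rji: "radius P j = radius P i" using ge max[of j] by simp
    have Pk: "P $ k = 0" if "k \<noteq> i" "k \<noteq> j" for k using z[OF that] radius_pos_iff[of P k] by simp
    show ?thesis by (rule negligible_pair[OF j(1)[symmetric] rji r Pk V])
  qed
qed

text \<open>
  The rectangle of angles at which all waves are small lies in the set and has positive measure.
\<close>

lemma rest_small_positive:
  assumes r: "0 < radius P i"
  shows "0 < measure torus {\<phi>. (rest i P \<phi>)\<^sup>2 < (radius P i)\<^sup>2}"
proof -
  define s where "s = radius P i / real CARD('n)"
  have s: "s > 0" using r by (simp add: s_def)
  define A where "A j = {y. \<bar>wave 0 (eta P j) (zeta P j) y\<bar> < s}" for j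
  have Am: "A j \<in> sets borel" for j unfolding A_def by measurable
  have Apos: "emeasure circ (A j) \<noteq> 0" for j
  proof
    assume 0: "emeasure circ (A j) = 0"
    show False
    proof (cases "0 < radius P j")
      case False
      then have "radius P j = 0" using radius_nonneg[of P j] by simp
      then have "A j = UNIV" unfolding A_def using wave_le_radius[of P j] s by (auto intro: le_less_trans)
      then show False using 0 circ.emeasure_space_1 by simp
    next
      case True
      define F :: "real \<Rightarrow> real" where "F = indicator {u. \<bar>u\<bar> < s}"
      have Fm[measurable]: "F \<in> borel_measurable borel" unfolding F_def by measurable
      have "AE y in circ. y \<notin> A j" using 0 Am by (intro AE_not_in) (auto simp: null_sets_def)
      then have "(\<integral>\<^sup>+y. ennreal (F (eta P j * cos y + zeta P j * sin y)) * ennreal \<bar>eta P j * sin y - zeta P j * cos y\<bar> \<partial>circ) = (\<integral>\<^sup>+y. 0 \<partial>circ)"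
        by (intro nn_integral_cong_AE) (auto simp: A_def F_def wave_def elim!: eventually_mono)
      then have "ennreal (1 / pi) * (\<integral>\<^sup>+u. ennreal (F u) * indicator {- radius P j..radius P j} u \<partial>lborel) = 0"
        unfolding circ_substitution[OF Fm] radius_def by simp
      then have "(\<integral>\<^sup>+u. ennreal (F u) * indicator {- radius P j..radius P j} u \<partial>lborel) = 0" by simp
      moreover have "(\<integral>\<^sup>+u. indicator {0..min (radius P j) (s / 2)} u \<partial>lborel)
         \<le> (\<integral>\<^sup>+u. ennreal (F u) * indicator {- radius P j..radius P j} u \<partial>lborel)"
        using s True by (intro nn_integral_mono) (auto simp: F_def indicator_def)
      ultimately show False using s True by simp
    qed
  qed
  have "emeasure torus (Pi\<^sub>E UNIV A) = (\<Prod>j\<in>UNIV. emeasure circ (A j))"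
    unfolding torus_def by (rule circles.emeasure_PiM) (use Am in auto)
  then have pos: "emeasure torus (Pi\<^sub>E UNIV A) \<noteq> 0" using Apos by simp
  have sub: "Pi\<^sub>E UNIV A \<subseteq> {\<phi>. (rest i P \<phi>)\<^sup>2 < (radius P i)\<^sup>2}"
  proof
    fix \<phi> assume "\<phi> \<in> Pi\<^sub>E UNIV A"
    then have a: "\<bar>wave 0 (eta P j) (zeta P j) (\<phi> j)\<bar> < s" for j by (auto simp: A_def PiE_def Pi_def)
    have "\<bar>rest i P \<phi>\<bar> \<le> (\<Sum>j\<in>UNIV - {i}. \<bar>wave 0 (eta P j) (zeta P j) (\<phi> j)\<bar>)" unfolding rest_def by (rule sum_abs)
    also have "\<dots> \<le> (\<Sum>j\<in>UNIV - {i}. s)" using a by (intro sum_mono) (simp add: less_imp_le)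
    also have "\<dots> = real (CARD('n) - 1) * s" by simp
    also have "\<dots> < real CARD('n) * s" using s by (intro mult_strict_right_mono) auto
    also have "\<dots> = radius P i" by (simp add: s_def)
    finally have "\<bar>rest i P \<phi>\<bar>\<^sup>2 < (radius P i)\<^sup>2" by (intro power_strict_mono) auto
    then show "\<phi> \<in> {\<phi>. (rest i P \<phi>)\<^sup>2 < (radius P i)\<^sup>2}" by simp
  qed
  have m: "{\<phi>. (rest i P \<phi>)\<^sup>2 < (radius P i)\<^sup>2} \<in> sets torus"
  proof -
    have "{\<phi> \<in> space torus. (rest i P \<phi>)\<^sup>2 < (radius P i)\<^sup>2} \<in> sets torus" by measurable
    then show ?thesis by simp
  qed
  have "emeasure torus {\<phi>. (rest i P \<phi>)\<^sup>2 < (radius P i)\<^sup>2} \<noteq> 0"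
    using emeasure_mono[OF sub m] pos by (metis le_zero_eq)
  then show ?thesis by (simp add: torus.emeasure_eq_measure zero_less_measure_iff)
qed

text \<open>
  Vanishing of the form means that both parts vanish on a set of positive measure; a linear combination of
  the waves vanishes only on a null set unless all its coefficients are zero.
\<close>

lemma curvature_kernel:
  assumes r: "0 < radius P i" and V: "V \<in> curv_dom i P" "curv_form i P V V \<le> 0"
  shows "\<exists>c. V = c *\<^sub>R P"
proof -
  have int: "integrable torus (mform i P V V)" using V(1) by (simp add: curv_dom_def)
  have "curv_form i P V V \<ge> 0" unfolding curv_form_def by (intro integral_nonneg_AE) (simp add: mform_nonneg)
  then have "(\<integral>\<phi>. mform i P V V \<phi> \<partial>torus) = 0" using V(2) by (simp add: curv_form_def)
  then have ae: "AE \<phi> in torus. mform i P V V \<phi> = 0"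
    using integral_nonneg_eq_0_iff_AE[OF int] mform_nonneg by simp
  define G where "G = {\<phi>. (rest i P \<phi>)\<^sup>2 < (radius P i)\<^sup>2}"
  have no: False if "AE \<phi> in torus. \<phi> \<notin> G"
  proof -
    have "measure torus {\<phi> \<in> space torus. \<phi> \<in> G} = 0"
      by (rule torus.prob_eq_0_AE) (rule that)
    then show False using rest_small_positive[OF r] by (simp add: G_def)
  qed
  have key: "normal_part i P V \<phi> = 0 \<and> angular_part i P V = 0" if "mform i P V V \<phi> = 0" "\<phi> \<in> G" for \<phi>
  proof -
    have w: "normal_weight i P \<phi> > 0" "angular_weight i P \<phi> > 0" using that(2) r by (auto simp: normal_weight_def angular_weight_def G_def)
    have "normal_weight i P \<phi> * (normal_part i P V \<phi>)\<^sup>2 + angular_weight i P \<phi> * (angular_part i P V)\<^sup>2 = 0"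
      using that(1) by (simp add: mform_def power2_eq_square)
    then have "normal_weight i P \<phi> * (normal_part i P V \<phi>)\<^sup>2 = 0 \<and> angular_weight i P \<phi> * (angular_part i P V)\<^sup>2 = 0"
      using w by (subst add_nonneg_eq_0_iff[symmetric]) auto
    then show ?thesis using w by simp
  qed
  have k2: "angular_part i P V = 0"
  proof (rule ccontr)
    assume n: "angular_part i P V \<noteq> 0"
    have "AE \<phi> in torus. \<phi> \<notin> G" using ae by eventually_elim (use key n in blast)
    then show False by (rule no)
  qed
  define \<sigma> where "\<sigma> = tang i P V"
  define W' where "W' = (\<chi> k. if k = i then 0 else (V + (- \<sigma>) *\<^sub>R P) $ k)"
  have kW: "normal_part i P V \<phi> = W' \<bullet> phase_vec \<phi>" for \<phi>
  proof -
    have "normal_part i P V \<phi> = rest i (V + (- \<sigma>) *\<^sub>R P) \<phi>" unfolding normal_part_def \<sigma>_def rest_add by simp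
    also have "\<dots> = W' \<bullet> phase_vec \<phi>"
      unfolding inner_phase_sum rest_def
      by (rule sum.mono_neutral_cong_left) (auto simp: W'_def eta_def zeta_def wave_def)
    finally show ?thesis .
  qed
  have "W' = 0"
  proof (rule ccontr)
    assume "W' \<noteq> 0"
    from torus_AE_nonzero[OF this] ae have "AE \<phi> in torus. \<phi> \<notin> G"
      by eventually_elim (use key kW in auto)
    then show False by (rule no)
  qed
  have comp: "eta V i = \<sigma> * eta P i" "zeta V i = \<sigma> * zeta P i"
  proof -
    define R where "R = (eta P i)\<^sup>2 + (zeta P i)\<^sup>2"
    have R: "R > 0" using r by (simp add: radius_def R_def)
    have sig: "\<sigma> = (eta P i * eta V i + zeta P i * zeta V i) / R" by (simp add: \<sigma>_def tang_def radius_sq R_def)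
    have k: "eta P i * zeta V i = zeta P i * eta V i" using k2 by (simp add: angular_part_def)
    have "(eta P i * eta V i + zeta P i * zeta V i) * eta P i = eta V i * R"
      using k by (simp add: R_def power2_eq_square algebra_simps)
    then have "\<sigma> * eta P i = eta V i * R / R" unfolding sig by (simp only: times_divide_eq_left)
    then show "eta V i = \<sigma> * eta P i" using R by simp
    have "(eta P i * eta V i + zeta P i * zeta V i) * zeta P i = zeta V i * R"
      using k by (simp add: R_def power2_eq_square algebra_simps)
    then have "\<sigma> * zeta P i = zeta V i * R / R" unfolding sig by (simp only: times_divide_eq_left)
    then show "zeta V i = \<sigma> * zeta P i" using R by simp
  qed
  have "V $ k = (\<sigma> *\<^sub>R P) $ k" for k
  proof (cases "k = i")
    case True
    then show ?thesis using comp \<omega>_pos[of i] by (simp add: eta_def zeta_def prod_eq_iff)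
  next
    case False
    have "W' $ k = 0" using \<open>W' = 0\<close> by simp
    then show ?thesis using False by (simp add: W'_def)
  qed
  then have "V = \<sigma> *\<^sub>R P" by (simp add: vec_eq_iff)
  then show ?thesis by blast
qed

lemma phase_norm_second_order:
  assumes P: "P \<noteq> 0"
  shows "\<exists>S Q. second_order_form phase_norm phase_grad P S Q"
proof -
  obtain i where max: "\<And>j. radius P j \<le> radius P i"
  proof -
    have "\<exists>i. \<forall>j. radius P j \<le> radius P i"
      using Max_in[of "range (radius P)"] Max_ge[of "range (radius P)"] by fastforce
    then show ?thesis using that by blast
  qed
  obtain j where "0 < radius P j" using ex_radius_pos[OF P] by blast
  then have r: "0 < radius P i" using max[of j] by simp
  have "second_order_form phase_norm phase_grad P (curv_dom i P) (curv_form i P)"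
    unfolding second_order_form_def
  proof (intro conjI ballI allI impI)
    show "subspace (curv_dom i P)" by (rule subspace_curv_dom)
    show "curv_form i P v w = curv_form i P w v" for v w
      unfolding curv_form_def by (intro Bochner_Integration.integral_cong refl mform_sym)
    show "curv_form i P (u + v) w = curv_form i P u w + curv_form i P v w"
      if "u \<in> curv_dom i P" "v \<in> curv_dom i P" "w \<in> curv_dom i P" for u v w
    proof -
      have "mform i P (u + v) w \<phi> = mform i P u w \<phi> + mform i P v w \<phi>" for \<phi>
        using mform_linear[of i P 1 u 1 v w \<phi>] by simp
      then have "curv_form i P (u + v) w = (\<integral>\<phi>. mform i P u w \<phi> + mform i P v w \<phi> \<partial>torus)"
        by (simp only: curv_form_def)
      also have "\<dots> = curv_form i P u w + curv_form i P v w" unfolding curv_form_def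
        by (intro Bochner_Integration.integral_add mform_integrable that)
      finally show ?thesis .
    qed
    show "curv_form i P (c *\<^sub>R v) w = c * curv_form i P v w"
      if "v \<in> curv_dom i P" "w \<in> curv_dom i P" for c v w
    proof -
      have "mform i P (c *\<^sub>R v) w \<phi> = c * mform i P v w \<phi>" for \<phi>
        using mform_linear[of i P c v 0 0 w \<phi>] by simp
      then have "curv_form i P (c *\<^sub>R v) w = (\<integral>\<phi>. c * mform i P v w \<phi> \<partial>torus)" by (simp only: curv_form_def)
      then show ?thesis by (simp add: curv_form_def)
    qed
    show "\<exists>c. v = c *\<^sub>R P" if "v \<in> curv_dom i P" "curv_form i P v v \<le> 0" for v
      by (rule curvature_kernel[OF r that])
    show "v \<in> curv_dom i P" "curv_form i P v v \<le> 2 * k"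
      if "Pn \<longlonglongrightarrow> P" "T \<longlonglongrightarrow> 0" "\<forall>n. 0 < T n" "V \<longlonglongrightarrow> v" "K \<longlonglongrightarrow> k"
        "\<forall>n. bregman phase_norm phase_grad (Pn n) (T n *\<^sub>R V n) \<le> K n * (T n)\<^sup>2" for Pn T V K v k
      using curvature_lower[of Pn P T V v K k] that by auto
    show "(\<lambda>n. bregman phase_norm phase_grad P (T n *\<^sub>R v) / (T n)\<^sup>2) \<longlonglongrightarrow> curv_form i P v v / 2"
      if "v \<in> curv_dom i P" "T \<longlonglongrightarrow> 0" "\<forall>n. 0 < T n" for v T
      using curvature_upper[OF r that(1) negligible_max[OF r max that(1)] that(2)] that(3) by blast
  qed
  then show ?thesis by blast
qed

sublocale curved_norm phase_norm phase_grad
  by standard (use phase_norm_add phase_norm_scale phase_norm_pos phase_norm_GDERIV phase_norm_second_order in auto)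

end

section \<open>The averaged norm as an integral over the cube\<close>

interpretation lines: product_sigma_finite "\<lambda>_ :: 'i. lborel :: real measure"
  by standard

lemma vec_lambda_measurable [measurable]:
  "(\<lambda>f. (\<chi> j. f j) :: real ^ 'n) \<in> borel_measurable (Pi\<^sub>M UNIV (\<lambda>_ :: 'n::finite. lborel))"
proof (subst borel_measurable_euclidean_space, intro ballI)
  fix b :: "real ^ 'n" assume "b \<in> Basis"
  then obtain j where "b = axis j 1" by (auto simp: Basis_vec_def)
  then have "((\<chi> j. f j) :: real ^ 'n) \<bullet> b = f j" for f by (simp add: inner_axis)
  moreover have "(\<lambda>f. f j) \<in> borel_measurable (Pi\<^sub>M UNIV (\<lambda>_ :: 'n. lborel))"
    using measurable_component_singleton[of j UNIV "\<lambda>_. lborel :: real measure"] by (simp cong: measurable_cong_sets)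
  ultimately show "(\<lambda>f. ((\<chi> j. f j) :: real ^ 'n) \<bullet> b) \<in> borel_measurable (Pi\<^sub>M UNIV (\<lambda>_ :: 'n. lborel))"
    by simp
qed

lemma lborel_vec_eq:
  "(lborel :: (real ^ 'n::finite) measure) = distr (Pi\<^sub>M UNIV (\<lambda>_. lborel)) borel (\<lambda>f. \<chi> j. f j)"
proof (rule lborel_eqI)
  fix l u :: "real ^ 'n" assume le: "\<And>b. b \<in> Basis \<Longrightarrow> l \<bullet> b \<le> u \<bullet> b"
  have le': "l $ j \<le> u $ j" for j using le[of "axis j 1"] by (simp add: inner_axis)
  have "emeasure (distr (Pi\<^sub>M UNIV (\<lambda>_ :: 'n. lborel)) borel (\<lambda>f. \<chi> j. f j)) (box l u)
     = emeasure (Pi\<^sub>M UNIV (\<lambda>_. lborel)) ((\<lambda>f. \<chi> j. f j) -` box l u \<inter> space (Pi\<^sub>M UNIV (\<lambda>_ :: 'n. lborel :: real measure)))"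
    by (rule emeasure_distr) (auto intro: vec_lambda_measurable)
  also have "(\<lambda>f. \<chi> j. f j) -` box l u \<inter> space (Pi\<^sub>M UNIV (\<lambda>_ :: 'n. lborel :: real measure)) = Pi\<^sub>E UNIV (\<lambda>j. {l $ j<..<u $ j})"
    by (auto simp: mem_box_cart space_PiM PiE_def Pi_def)
  also have "emeasure (Pi\<^sub>M UNIV (\<lambda>_. lborel)) (Pi\<^sub>E UNIV (\<lambda>j. {l $ j<..<u $ j})) = (\<Prod>j\<in>UNIV. emeasure lborel {l $ j<..<u $ j})"
    by (rule lines.emeasure_PiM) auto
  also have "\<dots> = (\<Prod>j\<in>UNIV. ennreal (u $ j - l $ j))" using le' by simp
  also have "\<dots> = ennreal (\<Prod>j\<in>UNIV. u $ j - l $ j)" using le' by (intro prod_ennreal) auto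
  also have "(\<Prod>j\<in>UNIV. u $ j - l $ j) = (\<Prod>b\<in>Basis. (u - l) \<bullet> b)"
  proof -
    have B: "(Basis :: (real ^ 'n) set) = (\<lambda>j. axis j 1) ` UNIV" by (auto simp: Basis_vec_def)
    have "inj (\<lambda>j :: 'n. axis j (1 :: real))" by (auto simp: inj_def axis_eq_axis)
    then show ?thesis unfolding B by (subst prod.reindex) (auto simp: inner_axis)
  qed
  finally show "emeasure (distr (Pi\<^sub>M UNIV (\<lambda>_ :: 'n. lborel)) borel (\<lambda>f. \<chi> j. f j)) (box l u) = ennreal (\<Prod>b\<in>Basis. (u - l) \<bullet> b)" .
qed simp

lemma torus_density:
  "(torus :: ('n::finite \<Rightarrow> real) measure) = density (Pi\<^sub>M UNIV (\<lambda>_. lborel))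
     (\<lambda>\<phi>. ennreal (1 / (2 * pi) ^ CARD('n)) * indicator (Pi\<^sub>E UNIV (\<lambda>_. {0..2 * pi})) \<phi>)" (is "_ = ?D")
  unfolding torus_def
proof (rule circles.PiM_eqI[symmetric])
  let ?L = "Pi\<^sub>M UNIV (\<lambda>_ :: 'n. lborel :: real measure)"
  let ?Q = "Pi\<^sub>E UNIV (\<lambda>_ :: 'n. {0..2 * pi})"
  show "finite (UNIV :: 'n set)" by simp
  show "sets ?D = sets (Pi\<^sub>M UNIV (\<lambda>_ :: 'n. circ))" by (simp cong: sets_PiM_cong)
  fix A :: "'n \<Rightarrow> real set" assume A: "\<And>i. i \<in> UNIV \<Longrightarrow> A i \<in> sets circ"
  have Qm: "?Q \<in> sets ?L" by (rule sets_PiM_I_finite) auto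
  have Am: "Pi\<^sub>E UNIV A \<in> sets ?L" by (rule sets_PiM_I_finite) (use A in auto)
  have "emeasure ?D (Pi\<^sub>E UNIV A) = (\<integral>\<^sup>+\<phi>. ennreal (1 / (2 * pi) ^ CARD('n)) * indicator ?Q \<phi> * indicator (Pi\<^sub>E UNIV A) \<phi> \<partial>?L)"
    by (rule emeasure_density) (use Qm Am in auto)
  also have "\<dots> = (\<integral>\<^sup>+\<phi>. ennreal (1 / (2 * pi) ^ CARD('n)) * indicator (Pi\<^sub>E UNIV (\<lambda>j. {0..2 * pi} \<inter> A j)) \<phi> \<partial>?L)"
    by (intro nn_integral_cong) (auto simp: indicator_def PiE_def Pi_def)
  also have "\<dots> = ennreal (1 / (2 * pi) ^ CARD('n)) * emeasure ?L (Pi\<^sub>E UNIV (\<lambda>j. {0..2 * pi} \<inter> A j))"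
    by (rule nn_integral_cmult_indicator) (rule sets_PiM_I_finite, use A in auto)
  also have "emeasure ?L (Pi\<^sub>E UNIV (\<lambda>j. {0..2 * pi} \<inter> A j)) = (\<Prod>j\<in>UNIV. emeasure lborel ({0..2 * pi} \<inter> A j))"
    by (rule lines.emeasure_PiM) (use A in auto)
  also have "ennreal (1 / (2 * pi) ^ CARD('n)) * (\<Prod>j\<in>UNIV. emeasure lborel ({0..2 * pi} \<inter> A j))
     = (\<Prod>j\<in>UNIV. ennreal (1 / (2 * pi)) * emeasure lborel ({0..2 * pi} \<inter> A j))"
  proof -
    have "ennreal (1 / (2 * pi) ^ CARD('n)) = (\<Prod>j\<in>(UNIV :: 'n set). ennreal (1 / (2 * pi)))"
      by (simp add: ennreal_power power_one_over)
    then show ?thesis by (simp only: prod.distrib)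
  qed
  also have "\<dots> = (\<Prod>j\<in>UNIV. emeasure circ (A j))"
  proof (rule prod.cong[OF refl])
    fix j :: 'n
    have Aj: "A j \<in> sets borel" using A by simp
    have "emeasure circ (A j) = (\<integral>\<^sup>+y. indicator (A j) y \<partial>circ)" using A by simp
    also have "\<dots> = ennreal (1 / (2 * pi)) * (\<integral>\<^sup>+y. indicator (A j) y * indicator {0..2 * pi} y \<partial>lborel)"
      by (rule nn_integral_circ) (use Aj in simp)
    also have "(\<integral>\<^sup>+y. indicator (A j) y * indicator {0..2 * pi} y \<partial>lborel) = (\<integral>\<^sup>+y. indicator ({0..2 * pi} \<inter> A j) y \<partial>lborel)"
      by (intro nn_integral_cong) (auto simp: indicator_def)
    also have "\<dots> = emeasure lborel ({0..2 * pi} \<inter> A j)" using Aj by simp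
    finally show "ennreal (1 / (2 * pi)) * emeasure lborel ({0..2 * pi} \<inter> A j) = emeasure circ (A j)" by simp
  qed
  finally show "emeasure ?D (Pi\<^sub>E UNIV A) = (\<Prod>j\<in>UNIV. emeasure circ (A j))" .
qed

text \<open>Averages over the torus, written as integrals over the cube.\<close>

lemma cube_integral:
  fixes f :: "real ^ 'n::finite \<Rightarrow> real"
  assumes f: "continuous_on UNIV f" and nonneg: "\<And>x. 0 \<le> f x"
  shows "(\<integral>\<^sup>+\<phi>. ennreal (f (\<chi> j. \<phi> j)) \<partial>torus)
    = ennreal (1 / (2 * pi) ^ CARD('n) * integral (cbox 0 (\<chi> i. 2 * pi)) f)"
proof -
  let ?L = "Pi\<^sub>M UNIV (\<lambda>_ :: 'n. lborel :: real measure)"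
  let ?Q = "Pi\<^sub>E UNIV (\<lambda>_ :: 'n. {0..2 * pi})"
  let ?C = "cbox 0 (\<chi> i. 2 * pi) :: (real ^ 'n) set"
  let ?k = "ennreal (1 / (2 * pi) ^ CARD('n))"
  have fm[measurable]: "f \<in> borel_measurable borel" by (rule borel_measurable_continuous_onI[OF f])
  have Qm[measurable]: "?Q \<in> sets ?L" by (rule sets_PiM_I_finite) auto
  have fi: "(f has_integral integral ?C f) ?C"
    by (intro integrable_integral integrable_continuous continuous_on_subset[OF f]) simp
  have gm: "(\<lambda>\<phi>. ennreal (f (\<chi> j. \<phi> j))) \<in> borel_measurable ?L" by measurable
  have "(\<integral>\<^sup>+\<phi>. ennreal (f (\<chi> j. \<phi> j)) \<partial>torus) = (\<integral>\<^sup>+\<phi>. (?k * indicator ?Q \<phi>) * ennreal (f (\<chi> j. \<phi> j)) \<partial>?L)"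
    unfolding torus_density by (rule nn_integral_density) (use gm Qm in auto)
  also have "\<dots> = (\<integral>\<^sup>+\<phi>. ?k * (ennreal (indicator ?C (\<chi> j. \<phi> j) * f (\<chi> j. \<phi> j))) \<partial>?L)"
  proof (rule nn_integral_cong)
    fix \<phi> :: "'n \<Rightarrow> real"
    have "\<phi> \<in> ?Q \<longleftrightarrow> (\<chi> j. \<phi> j) \<in> ?C" by (auto simp: mem_box_cart PiE_def Pi_def)
    then show "(?k * indicator ?Q \<phi>) * ennreal (f (\<chi> j. \<phi> j)) = ?k * (ennreal (indicator ?C (\<chi> j. \<phi> j) * f (\<chi> j. \<phi> j)))"
      by (simp add: indicator_def)
  qed
  also have "\<dots> = ?k * (\<integral>\<^sup>+\<phi>. ennreal (indicator ?C (\<chi> j. \<phi> j) * f (\<chi> j. \<phi> j)) \<partial>?L)"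
    by (rule nn_integral_cmult) measurable
  also have "(\<integral>\<^sup>+\<phi>. ennreal (indicator ?C (\<chi> j. \<phi> j) * f (\<chi> j. \<phi> j)) \<partial>?L) = (\<integral>\<^sup>+x. ennreal (indicator ?C x * f x) \<partial>lborel)"
    unfolding lborel_vec_eq by (subst nn_integral_distr) (auto intro: vec_lambda_measurable)
  also have "\<dots> = ennreal (integral ?C f)"
    by (rule nn_integral_has_integral_lebesgue[OF _ fi]) (rule nonneg)
  also have "?k * ennreal (integral ?C f) = ennreal (1 / (2 * pi) ^ CARD('n) * integral ?C f)"
    using has_integral_nonneg[OF fi] nonneg by (intro ennreal_mult[symmetric]) auto
  finally show ?thesis .
qed

context oscillators
begin

lemma amplitude_radius: "amplitude \<omega> P j = radius P j"
  by (simp add: amplitude_def radius_def eta_def zeta_def power_divide)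

text \<open>Rotating the angles one after another turns \<open>radius P j * cos (\<phi> j)\<close> into the wave of the \<open>j\<close>-th component.\<close>

lemma rotate_angles:
  assumes "finite J"
  shows "(\<integral>\<^sup>+\<phi>. ennreal \<bar>\<Sum>j\<in>UNIV. if j \<in> J then wave 0 (eta P j) (zeta P j) (\<phi> j) else radius P j * cos (\<phi> j)\<bar> \<partial>torus)
     = (\<integral>\<^sup>+\<phi>. ennreal \<bar>\<Sum>j\<in>UNIV. radius P j * cos (\<phi> j)\<bar> \<partial>torus)"
  using assms
proof (induction J)
  case empty
  then show ?case by simp
next
  case (insert i J)
  define t where "t K j y = (if j \<in> K then wave 0 (eta P j) (zeta P j) y else radius P j * cos y)" for K j y
  define c where "c \<phi> = (\<Sum>j\<in>UNIV - {i}. t J j (\<phi> j))" for \<phi>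
  have [measurable]: "(\<lambda>y. t K j y) \<in> borel_measurable borel" for K j unfolding t_def by measurable
  have s: "(\<Sum>j\<in>UNIV. t K j ((\<phi>(i := y)) j)) = c \<phi> + t K i y" if "K = J \<or> K = insert i J" for K \<phi> y
  proof -
    have "(\<Sum>j\<in>UNIV. t K j ((\<phi>(i := y)) j)) = t K i y + (\<Sum>j\<in>UNIV - {i}. t K j ((\<phi>(i := y)) j))"
      by (subst sum.remove[of UNIV i]) auto
    also have "(\<Sum>j\<in>UNIV - {i}. t K j ((\<phi>(i := y)) j)) = c \<phi>"
      unfolding c_def by (intro sum.cong) (use that in \<open>auto simp: t_def\<close>)
    finally show ?thesis by simp
  qed
  have res: "(\<integral>\<^sup>+\<phi>. ennreal \<bar>\<Sum>j\<in>UNIV. t K j (\<phi> j)\<bar> \<partial>torus) = (\<integral>\<^sup>+\<phi>. \<integral>\<^sup>+y. ennreal \<bar>c \<phi> + t K i y\<bar> \<partial>circ \<partial>torus)"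
    if "K = J \<or> K = insert i J" for K
  proof -
    have "(\<integral>\<^sup>+\<phi>. ennreal \<bar>\<Sum>j\<in>UNIV. t K j (\<phi> j)\<bar> \<partial>torus)
       = (\<integral>\<^sup>+\<phi>. \<integral>\<^sup>+y. ennreal \<bar>\<Sum>j\<in>UNIV. t K j ((\<phi>(i := y)) j)\<bar> \<partial>circ \<partial>torus)"
      by (rule resample) measurable
    then show ?thesis unfolding s[OF that] .
  qed
  have "(\<integral>\<^sup>+y. ennreal \<bar>c \<phi> + t (insert i J) i y\<bar> \<partial>circ) = (\<integral>\<^sup>+y. ennreal \<bar>c \<phi> + t J i y\<bar> \<partial>circ)" for \<phi>
    using circ_rotate[of "\<lambda>a b. ennreal \<bar>c \<phi> + a\<bar>" "eta P i" "zeta P i"] insert(2)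
    by (simp add: t_def wave_def radius_def)
  then have "(\<integral>\<^sup>+\<phi>. ennreal \<bar>\<Sum>j\<in>UNIV. t (insert i J) j (\<phi> j)\<bar> \<partial>torus) = (\<integral>\<^sup>+\<phi>. ennreal \<bar>\<Sum>j\<in>UNIV. t J j (\<phi> j)\<bar> \<partial>torus)"
    by (simp add: res)
  then show ?case using insert.IH unfolding t_def by simp
qed

lemma osc_H_eq: "osc_H \<omega> = phase_norm"
proof
  fix P :: "'n phase"
  define f :: "real ^ 'n \<Rightarrow> real" where "f x = \<bar>\<Sum>j\<in>UNIV. radius P j * cos (x $ j)\<bar>" for x
  have H: "osc_H \<omega> P = 1 / (2 * pi) ^ CARD('n) * integral (cbox 0 (\<chi> i. 2 * pi)) f"
    by (simp add: osc_H_def f_def[abs_def] amplitude_radius)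
  have fc: "continuous_on UNIV f" unfolding f_def[abs_def] by (intro continuous_intros)
  have "0 \<le> integral (cbox 0 (\<chi> i. 2 * pi)) f" by (rule integral_nonneg) (auto simp: f_def intro!: integrable_continuous continuous_on_subset[OF fc])
  then have H0: "0 \<le> osc_H \<omega> P" unfolding H by simp
  have "ennreal (osc_H \<omega> P) = (\<integral>\<^sup>+\<phi>. ennreal (f (\<chi> j. \<phi> j)) \<partial>torus)"
    unfolding H by (rule cube_integral[symmetric, OF fc]) (simp add: f_def)
  also have "\<dots> = (\<integral>\<^sup>+\<phi>. ennreal \<bar>\<Sum>j\<in>UNIV. radius P j * cos (\<phi> j)\<bar> \<partial>torus)" by (simp add: f_def)
  also have "\<dots> = (\<integral>\<^sup>+\<phi>. ennreal \<bar>P \<bullet> phase_vec \<phi>\<bar> \<partial>torus)"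
    unfolding inner_phase_sum using rotate_angles[OF finite, of UNIV P] by simp
  also have "\<dots> = ennreal (phase_norm P)"
    unfolding phase_norm_def by (rule nn_integral_eq_integral[OF integrable_abs_phase]) simp
  finally show "osc_H \<omega> P = phase_norm P" using H0 H_nonneg[of P] by simp
qed

section \<open>The conjugate motion and the Hamiltonian\<close>

lemma osc_rho_eq: "osc_rho \<omega> = dual_norm phase_norm"
  unfolding osc_rho_def[abs_def] dual_norm_def[abs_def] osc_H_eq ..

lemma gradient_osc_rho: "y \<noteq> 0 \<Longrightarrow> gradient (osc_rho \<omega>) y = supp y"
  unfolding osc_rho_eq by (rule gradient_eq) (rule rho_GDERIV)

lemma hessian_osc_rho:
  assumes y: "y \<noteq> 0"
  shows "(gradient (osc_rho \<omega>) has_derivative hessian (osc_rho \<omega>) y) (at y)"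
    and "hessian (osc_rho \<omega>) y a \<bullet> b = a \<bullet> hessian (osc_rho \<omega>) y b"
proof -
  obtain L where L: "(supp has_derivative L) (at y)" "\<And>w w'. L w \<bullet> w' = w \<bullet> L w'"
    using supp_has_derivative[OF y] by blast
  have g: "(gradient (osc_rho \<omega>) has_derivative L) (at y)"
    by (rule has_derivative_transform_within_open[OF L(1), of "- {0}"]) (use y in \<open>auto simp: gradient_osc_rho\<close>)
  then have "L = hessian (osc_rho \<omega>) y" unfolding hessian_def by (rule frechet_derivative_at)
  then show "(gradient (osc_rho \<omega>) has_derivative hessian (osc_rho \<omega>) y) (at y)"
    "hessian (osc_rho \<omega>) y a \<bullet> b = a \<bullet> hessian (osc_rho \<omega>) y b" using g L by auto
qed

lemma hessian_linear: assumes "y \<noteq> 0" shows "linear (hessian (osc_rho \<omega>) y)"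
  by (rule has_derivative_linear[OF hessian_osc_rho(1)[OF assms]])

text \<open>
  The adjoint of \<open>osc_A \<omega>\<close>.
\<close>

definition osc_At :: "'n phase \<Rightarrow> 'n phase" where
  "osc_At q = (\<chi> i. (- (\<omega> i)\<^sup>2 * snd (q $ i), fst (q $ i)))"

lemma osc_At_inner: "osc_A \<omega> x \<bullet> q = x \<bullet> osc_At q"
  unfolding inner_vec_def by (intro sum.cong refl) (simp add: osc_A_def osc_At_def inner_prod_def algebra_simps)

lemma adjoint_osc_A: "adjoint (osc_A \<omega>) = osc_At"
  by (rule adjoint_unique) (simp add: osc_At_inner)

lemma linear_osc_A: "linear (osc_A \<omega>)"
  by (rule linearI) (simp_all add: osc_A_def vec_eq_iff prod_eq_iff algebra_simps)

lemma phase_norm_amplitude_cong: assumes "\<And>j. radius P j = radius Q j" shows "phase_norm P = phase_norm Q"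
  using assms by (simp add: osc_H_eq[symmetric] osc_H_def amplitude_radius)

text \<open>
  The norm is invariant under the free motion. Moving along \<open>osc_At p\<close> multiplies the \<open>i\<close>-th amplitude by
  \<open>sqrt (1 + s\<^sup>2 (\<omega> i)\<^sup>2)\<close>, which is a change of second order in \<open>s\<close>; so the gradient is orthogonal to \<open>osc_At p\<close>.
\<close>

lemma phase_grad_osc_At: assumes p: "p \<noteq> 0" shows "phase_grad p \<bullet> osc_At p = 0"
proof -
  obtain C where C: "C > 0" "\<And>x. phase_norm x \<le> C * norm x" using H_bounded by blast
  define D where "D = C * (\<Sum>i\<in>UNIV. (\<omega> i)\<^sup>2 * norm (p $ i))"
  have D0: "D \<ge> 0" using C by (auto simp: D_def intro!: mult_nonneg_nonneg sum_nonneg)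
  have key: "s * (phase_grad p \<bullet> osc_At p) \<le> D * s\<^sup>2" for s
  proof -
    define k where "k i = sqrt (1 + s\<^sup>2 * (\<omega> i)\<^sup>2)" for i
    \<comment> \<open>The vector \<open>q\<close> has the amplitudes of \<open>p + s *\<^sub>R osc_At p\<close> and differs from \<open>p\<close> by \<open>O(s\<^sup>2)\<close>.\<close>
    define q :: "'n phase" where "q = (\<chi> i. k i *\<^sub>R p $ i)"
    have k1: "1 \<le> k i" for i by (simp add: k_def)
    have k2: "k i - 1 \<le> s\<^sup>2 * (\<omega> i)\<^sup>2" for i
    proof -
      have "k i \<le> (k i)\<^sup>2" using k1[of i] by (simp add: power2_eq_square)
      also have "\<dots> = 1 + s\<^sup>2 * (\<omega> i)\<^sup>2" by (simp add: k_def)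
      finally show ?thesis by simp
    qed
    have "radius (p + s *\<^sub>R osc_At p) j = radius q j" for j
    proof -
      have w: "\<omega> j \<noteq> 0" using \<omega>_pos[of j] by simp
      have "(eta (p + s *\<^sub>R osc_At p) j)\<^sup>2 + (zeta (p + s *\<^sub>R osc_At p) j)\<^sup>2 = (1 + s\<^sup>2 * (\<omega> j)\<^sup>2) * ((eta p j)\<^sup>2 + (zeta p j)\<^sup>2)"
      proof -
        have "eta (osc_At p) j = \<omega> j * zeta p j" "zeta (osc_At p) j = - \<omega> j * eta p j"
          using w by (simp_all add: eta_def zeta_def osc_At_def power2_eq_square)
        then show ?thesis unfolding eta_add zeta_add by (simp add: power2_eq_square algebra_simps)
      qed
      also have "\<dots> = (eta q j)\<^sup>2 + (zeta q j)\<^sup>2"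
        by (simp add: q_def eta_def zeta_def k_def power_mult_distrib power_divide distrib_left)
      finally show ?thesis by (simp add: radius_def)
    qed
    then have "phase_norm (p + s *\<^sub>R osc_At p) = phase_norm q" by (rule phase_norm_amplitude_cong)
    moreover have "phase_norm q \<le> phase_norm p + phase_norm (q - p)" using phase_norm_add[of p "q - p"] by simp
    moreover have "phase_norm (q - p) \<le> D * s\<^sup>2"
    proof -
      have "norm (q - p) \<le> (\<Sum>i\<in>UNIV. norm ((q - p) $ i))" unfolding norm_vec_def by (rule L2_set_le_sum) simp
      also have "\<dots> \<le> (\<Sum>i\<in>UNIV. s\<^sup>2 * ((\<omega> i)\<^sup>2 * norm (p $ i)))"
      proof (rule sum_mono)
        fix i :: 'n
        have "(q - p) $ i = (k i - 1) *\<^sub>R p $ i" by (simp add: q_def scaleR_left_diff_distrib)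
        then have "norm ((q - p) $ i) = (k i - 1) * norm (p $ i)" using k1[of i] by simp
        also have "\<dots> \<le> s\<^sup>2 * (\<omega> i)\<^sup>2 * norm (p $ i)" by (intro mult_right_mono k2) simp
        finally show "norm ((q - p) $ i) \<le> s\<^sup>2 * ((\<omega> i)\<^sup>2 * norm (p $ i))" by (simp add: mult.assoc)
      qed
      also have "\<dots> = s\<^sup>2 * (\<Sum>i\<in>UNIV. (\<omega> i)\<^sup>2 * norm (p $ i))" by (simp add: sum_distrib_left)
      finally have "C * norm (q - p) \<le> C * (s\<^sup>2 * (\<Sum>i\<in>UNIV. (\<omega> i)\<^sup>2 * norm (p $ i)))" using C by (intro mult_left_mono) auto
      then show ?thesis using C(2)[of "q - p"] by (simp add: D_def mult_ac)
    qed
    moreover have "phase_norm p + s * (phase_grad p \<bullet> osc_At p) \<le> phase_norm (p + s *\<^sub>R osc_At p)"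
      using bregman_nonneg[of p "s *\<^sub>R osc_At p"] by (simp add: bregman_def)
    ultimately show ?thesis by linarith
  qed
  define G where "G = phase_grad p \<bullet> osc_At p"
  have "\<bar>G\<bar> \<le> D * s" if "s > 0" for s
  proof -
    have "s * G \<le> s * (D * s)" "s * (- G) \<le> s * (D * s)"
      using key[of s] key[of "- s"] by (simp_all add: G_def power2_eq_square mult_ac)
    then have "G \<le> D * s" "- G \<le> D * s" using that by (simp_all only: mult_le_cancel_left_pos)
    then show ?thesis by simp
  qed
  then have "\<bar>G\<bar> \<le> 0 + e" if "e > 0" for e
  proof -
    have "\<bar>G\<bar> \<le> D * (e / (D + 1))" using that D0 by (intro \<open>\<And>s. s > 0 \<Longrightarrow> \<bar>G\<bar> \<le> D * s\<close>) simp
    also have "\<dots> \<le> e" using that D0 by (simp add: field_simps)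
    finally show ?thesis by simp
  qed
  then have "\<bar>G\<bar> \<le> 0" by (rule field_le_epsilon)
  then show ?thesis by (simp add: G_def)
qed

lemma osc_A_supp: assumes y: "y \<noteq> 0" shows "osc_A \<omega> y \<bullet> supp y = 0"
proof -
  have "osc_A \<omega> y \<bullet> supp y = y \<bullet> osc_At (supp y)" by (rule osc_At_inner)
  also have "\<dots> = (rho y *\<^sub>R phase_grad (supp y)) \<bullet> osc_At (supp y)" using supp_facts(3)[OF y] by simp
  also have "\<dots> = 0" using phase_grad_osc_At[OF supp_facts(2)[OF y]] by simp
  finally show ?thesis .
qed

text \<open>
  Differentiate the identity \<open>osc_A \<omega> y \<bullet> gradient (osc_rho \<omega>) y = 0\<close> and use the symmetry of the second derivative.
\<close>

lemma hessian_osc_A: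
  assumes y: "y \<noteq> 0"
  shows "hessian (osc_rho \<omega>) y (osc_A \<omega> y) = - osc_At (gradient (osc_rho \<omega>) y)"
proof -
  let ?g = "gradient (osc_rho \<omega>)" and ?L = "hessian (osc_rho \<omega>) y"
  have dA: "(osc_A \<omega> has_derivative osc_A \<omega>) (at y)"
    using linear_osc_A linear_conv_bounded_linear bounded_linear_imp_has_derivative by blast
  have d1: "((\<lambda>z. osc_A \<omega> z \<bullet> ?g z) has_derivative (\<lambda>h. osc_A \<omega> y \<bullet> ?L h + osc_A \<omega> h \<bullet> ?g y)) (at y)"
    by (rule has_derivative_inner[OF dA hessian_osc_rho(1)[OF y]])
  have d2: "((\<lambda>z. osc_A \<omega> z \<bullet> ?g z) has_derivative (\<lambda>h. 0)) (at y)"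
    by (rule has_derivative_transform_within_open[of "\<lambda>z. 0" _ _ _ "- {0}"])
      (use y in \<open>auto simp: gradient_osc_rho osc_A_supp\<close>)
  have "(\<lambda>h. osc_A \<omega> y \<bullet> ?L h + osc_A \<omega> h \<bullet> ?g y) = (\<lambda>h. 0)" using d1 d2 by (rule has_derivative_unique)
  then have "osc_A \<omega> y \<bullet> ?L h + osc_A \<omega> h \<bullet> ?g y = 0" for h by metis
  then have "h \<bullet> (?L (osc_A \<omega> y) + osc_At (?g y)) = 0" for h
    using hessian_osc_rho(2)[OF y, of "osc_A \<omega> y" h]
    by (simp add: inner_add_right osc_At_inner[symmetric] inner_commute)
  then have "?L (osc_A \<omega> y) + osc_At (?g y) = 0" using inner_eq_zero_iff by blast
  then show ?thesis by (simp add: eq_neg_iff_add_eq_0)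
qed

lemma hessian_bounded_on:
  fixes x :: "real \<Rightarrow> 'n phase"
  assumes x: "continuous_on {a..b} x" and nz: "\<And>t. t \<in> {a..b} \<Longrightarrow> x t \<noteq> 0"
  shows "\<exists>L. \<forall>t\<in>{a..b}. \<forall>h. norm (hessian (osc_rho \<omega>) (x t) h) \<le> L * norm h"
proof -
  define S where "S = x ` {a..b}"
  have S: "compact S" "0 \<notin> S" unfolding S_def using compact_continuous_image[OF x] nz by auto
  have loc: "\<exists>r>0. \<exists>L. \<forall>z\<in>ball y r. \<forall>h. norm (hessian (osc_rho \<omega>) z h) \<le> L * norm h" if y: "y \<noteq> 0" for y
  proof -
    obtain r L where r: "r > 0" and L: "\<And>u v. u \<in> ball y r \<Longrightarrow> v \<in> ball y r \<Longrightarrow> norm (supp u - supp v) \<le> L * norm (u - v)"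
      using supp_local_lipschitz[OF y] by blast
    define r' where "r' = min r (norm y)"
    have r': "r' > 0" using r y by (simp add: r'_def)
    have nz: "z \<noteq> 0" if "z \<in> ball y r'" for z using that by (auto simp: r'_def)
    have "norm (hessian (osc_rho \<omega>) z h) \<le> L * norm h" if z: "z \<in> ball y r'" for z h
    proof (rule lipschitz_derivative_bound[OF hessian_osc_rho(1)[OF nz[OF z]]])
      define d where "d = r' - dist y z"
      show "0 < d" using z by (simp add: d_def)
      fix w assume "w \<in> ball z d"
      then have w: "w \<in> ball y r'" using dist_triangle[of y w z] by (simp add: d_def)
      show "norm (gradient (osc_rho \<omega>) w - gradient (osc_rho \<omega>) z) \<le> L * norm (w - z)"
        using L[of w z] w z nz by (simp add: gradient_osc_rho r'_def)
    qed
    then show ?thesis using r' by blast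
  qed
  have "\<forall>y\<in>S. \<exists>p. fst p > 0 \<and> (\<forall>z\<in>ball y (fst p). \<forall>h. norm (hessian (osc_rho \<omega>) z h) \<le> snd p * norm h)"
  proof
    fix y assume "y \<in> S"
    then have "y \<noteq> 0" using S(2) by blast
    from loc[OF this] show "\<exists>p. fst p > 0 \<and> (\<forall>z\<in>ball y (fst p). \<forall>h. norm (hessian (osc_rho \<omega>) z h) \<le> snd p * norm h)"
      by (metis fst_conv snd_conv)
  qed
  from bchoice[OF this] obtain p where p: "\<forall>y\<in>S. fst (p y) > 0 \<and>
      (\<forall>z\<in>ball y (fst (p y)). \<forall>h. norm (hessian (osc_rho \<omega>) z h) \<le> snd (p y) * norm h)" by blast
  define r where "r y = fst (p y)" for y
  define L where "L y = snd (p y)" for y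
  have rL: "\<And>y. y \<in> S \<Longrightarrow> r y > 0"
     "\<And>y z h. y \<in> S \<Longrightarrow> z \<in> ball y (r y) \<Longrightarrow> norm (hessian (osc_rho \<omega>) z h) \<le> L y * norm h"
    using p unfolding r_def L_def by blast+
  obtain F where F: "F \<subseteq> S" "finite F" "S \<subseteq> (\<Union>y\<in>F. ball y (r y))"
    using S(1) by (rule compactE_image[where f = "\<lambda>y. ball y (r y)" and C = S]) (use rL(1) in auto)
  have "norm (hessian (osc_rho \<omega>) (x t) h) \<le> (\<Sum>y\<in>F. \<bar>L y\<bar>) * norm h" if t: "t \<in> {a..b}" for t h
  proof -
    have "x t \<in> S" using t by (simp add: S_def)
    then obtain y where y: "y \<in> F" "x t \<in> ball y (r y)" using F(3) by blast
    have "norm (hessian (osc_rho \<omega>) (x t) h) \<le> L y * norm h" using rL(2)[of y] y F(1) by blast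
    also have "\<dots> \<le> (\<Sum>y\<in>F. \<bar>L y\<bar>) * norm h"
    proof (rule mult_right_mono)
      have "L y \<le> \<bar>L y\<bar>" by simp
      also have "\<dots> \<le> (\<Sum>y\<in>F. \<bar>L y\<bar>)" using y F(2) by (intro member_le_sum) auto
      finally show "L y \<le> (\<Sum>y\<in>F. \<bar>L y\<bar>)" .
    qed simp
    finally show ?thesis .
  qed
  then show ?thesis by blast
qed

text \<open>
  The chain rule gives \<open>- hessian (osc_A x + u *\<^sub>R osc_B)\<close> for the velocity of the conjugate vector; the first
  term is rewritten by \<open>hessian_osc_A\<close>.
\<close>

lemma conjugate_motion:
  assumes I: "is_interval I" and m: "basic_motion \<omega> I x u"
  shows "moves_with_velocity I (\<lambda>t. - gradient (osc_rho \<omega>) (x t))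
     (\<lambda>t. osc_At (gradient (osc_rho \<omega>) (x t)) + hessian (osc_rho \<omega>) (x t) ((- u t) *\<^sub>R osc_B))"
proof -
  let ?v = "\<lambda>t. osc_A \<omega> (x t) + u t *\<^sub>R osc_B"
  have nz: "x t \<noteq> 0" and u1: "\<bar>u t\<bar> \<le> 1" if "t \<in> I" for t
    using m that unfolding basic_motion_def Sign_def by (auto simp: sgn_if abs_le_iff split: if_splits)
  have mv: "moves_with_velocity I x ?v" using m by (simp add: basic_motion_def)
  have sub: "{a..b} \<subseteq> I" if "a \<in> I" "b \<in> I" for a b
    using I that unfolding is_interval_1 by (meson atLeastAtMost_iff subsetI)
  have cont: "continuous_on {a..b} x" if "a \<in> I" "b \<in> I" "a \<le> b" for a b
    by (rule moves_with_velocity_continuous[OF mv that sub[OF that(1,2)]])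
  have "moves_with_velocity I (\<lambda>t. - gradient (osc_rho \<omega>) (x t)) (\<lambda>t. - hessian (osc_rho \<omega>) (x t) (?v t))"
  proof (rule moves_with_velocity_chain[OF I mv, where f = "\<lambda>y. - gradient (osc_rho \<omega>) y" and D = "\<lambda>y h. - hessian (osc_rho \<omega>) y h"])
    show "((\<lambda>y. - gradient (osc_rho \<omega>) y) has_derivative (\<lambda>h. - hessian (osc_rho \<omega>) (x t) h)) (at (x t))"
      if "t \<in> I" for t by (rule has_derivative_minus[OF hessian_osc_rho(1)[OF nz[OF that]]])
    fix a b assume ab: "a \<in> I" "b \<in> I" "a \<le> b"
    show "\<exists>L. \<forall>t\<in>{a..b}. \<forall>h. norm (- hessian (osc_rho \<omega>) (x t) h) \<le> L * norm h"
      using hessian_bounded_on[OF cont[OF ab]] nz sub[OF ab(1,2)] by (simp add: subset_iff)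
    have "compact ((\<lambda>t. osc_A \<omega> (x t)) ` {a..b})"
    proof (rule compact_continuous_image)
      have "continuous_on UNIV (osc_A \<omega>)" using linear_osc_A linear_continuous_on linear_conv_bounded_linear by blast
      then show "continuous_on {a..b} (\<lambda>t. osc_A \<omega> (x t))"
        by (rule continuous_on_compose2[OF _ cont[OF ab]]) simp
    qed simp
    then have "bounded ((\<lambda>t. osc_A \<omega> (x t)) ` {a..b})" by (rule compact_imp_bounded)
    then obtain C where C: "\<And>t. t \<in> {a..b} \<Longrightarrow> norm (osc_A \<omega> (x t)) \<le> C"
      unfolding bounded_iff by blast
    have "norm (?v t) \<le> C + norm (osc_B :: 'n phase)" if t: "t \<in> {a..b}" for t
    proof -
      have "norm (?v t) \<le> norm (osc_A \<omega> (x t)) + \<bar>u t\<bar> * norm (osc_B :: 'n phase)"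
        by (rule order_trans[OF norm_triangle_ineq]) simp
      also have "\<dots> \<le> C + 1 * norm (osc_B :: 'n phase)"
        using C[OF t] u1[of t] t sub[OF ab(1,2)] by (intro add_mono mult_right_mono) auto
      finally show ?thesis by simp
    qed
    then show "\<exists>C. \<forall>t\<in>{a..b}. norm (?v t) \<le> C" by blast
  qed
  then show ?thesis
  proof (rule moves_with_velocity_cong[OF _ I refl])
    fix t assume "t \<in> I"
    then have y: "x t \<noteq> 0" by (rule nz)
    show "- hessian (osc_rho \<omega>) (x t) (?v t) = osc_At (gradient (osc_rho \<omega>) (x t)) + hessian (osc_rho \<omega>) (x t) ((- u t) *\<^sub>R osc_B)"
      by (simp only: linear_add[OF hessian_linear[OF y]] linear_scale[OF hessian_linear[OF y]] hessian_osc_A[OF y]) simp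
  qed
qed

lemma osc_At_minus: "osc_At (- q) = - osc_At q"
  by (simp add: osc_At_def vec_eq_iff prod_eq_iff)

lemma hamilton_velocity_eq:
  "hamilton_velocity (osc_Hamiltonian \<omega>) y q = {osc_A \<omega> y + s *\<^sub>R osc_B | s. s \<in> Sign (osc_B \<bullet> q)}"
proof -
  have k: "GDERIV (\<lambda>q. osc_A \<omega> y \<bullet> q - \<bar>osc_B \<bullet> gradient (osc_rho \<omega>) y\<bar>) q :> osc_A \<omega> y"
    unfolding gderiv_def by (auto intro!: derivative_eq_intros simp: inner_commute)
  have b: "GDERIV (\<lambda>q. osc_B \<bullet> q) q :> osc_B" for q :: "'n phase"
    unfolding gderiv_def by (auto intro!: derivative_eq_intros simp: inner_commute)
  show ?thesis using subdiff_abs[OF k b]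
    by (simp add: hamilton_velocity_def osc_Hamiltonian_def algebra_simps)
qed

lemma hamilton_velocity_GDERIV:
  assumes "osc_B \<bullet> q \<noteq> 0"
  shows "GDERIV (\<lambda>q'. osc_Hamiltonian \<omega> y q') q :> osc_A \<omega> y + sgn (osc_B \<bullet> q) *\<^sub>R osc_B"
proof -
  have k: "GDERIV (\<lambda>q. osc_A \<omega> y \<bullet> q) q :> osc_A \<omega> y"
    unfolding gderiv_def by (auto intro!: derivative_eq_intros simp: inner_commute)
  have b: "GDERIV (\<lambda>q. osc_B \<bullet> q) q :> osc_B"
    unfolding gderiv_def by (auto intro!: derivative_eq_intros simp: inner_commute)
  have "GDERIV (\<lambda>q. osc_A \<omega> y \<bullet> q + \<bar>osc_B \<bullet> q\<bar> - \<bar>osc_B \<bullet> gradient (osc_rho \<omega>) y\<bar>) q :>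
     osc_A \<omega> y + sgn (osc_B \<bullet> q) *\<^sub>R osc_B - 0"
    by (intro GDERIV_diff GDERIV_add k GDERIV_abs[OF b assms] GDERIV_const)
  then show ?thesis by (simp add: osc_Hamiltonian_def)
qed

lemma GDERIV_osc_B_gradient:
  assumes y: "y \<noteq> 0"
  shows "GDERIV (\<lambda>y. osc_B \<bullet> gradient (osc_rho \<omega>) y) y :> hessian (osc_rho \<omega>) y osc_B"
proof -
  have "((\<lambda>y. osc_B \<bullet> gradient (osc_rho \<omega>) y) has_derivative (\<lambda>h. osc_B \<bullet> hessian (osc_rho \<omega>) y h)) (at y)"
    by (rule has_derivative_inner_right[OF hessian_osc_rho(1)[OF y]])
  then show ?thesis
    unfolding gderiv_def using hessian_osc_rho(2)[OF y, of osc_B] by (simp add: inner_commute)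
qed

lemma GDERIV_osc_A: "GDERIV (\<lambda>y. osc_A \<omega> y \<bullet> q) y :> osc_At q"
  unfolding gderiv_def osc_At_inner by (auto intro!: derivative_eq_intros)

lemma hamilton_force_eq:
  assumes y: "y \<noteq> 0"
  shows "hamilton_force (osc_Hamiltonian \<omega>) y q =
    {- osc_At q + hessian (osc_rho \<omega>) y (s *\<^sub>R osc_B) | s. s \<in> Sign (osc_B \<bullet> gradient (osc_rho \<omega>) y)}"
proof -
  have "GDERIV (\<lambda>y. - (osc_A \<omega> y \<bullet> q) - \<bar>osc_B \<bullet> q\<bar>) y :> - osc_At q - 0"
    by (intro GDERIV_diff GDERIV_minus GDERIV_osc_A GDERIV_const)
  then have k: "GDERIV (\<lambda>y. - (osc_A \<omega> y \<bullet> q) - \<bar>osc_B \<bullet> q\<bar>) y :> - osc_At q" by simp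
  have "(\<lambda>y. - osc_Hamiltonian \<omega> y q) = (\<lambda>y. - (osc_A \<omega> y \<bullet> q) - \<bar>osc_B \<bullet> q\<bar> + \<bar>osc_B \<bullet> gradient (osc_rho \<omega>) y\<bar>)"
    by (simp add: osc_Hamiltonian_def algebra_simps)
  then show ?thesis
    using subdiff_abs[OF k GDERIV_osc_B_gradient[OF y]]
    by (simp add: hamilton_force_def linear_scale[OF hessian_linear[OF y]])
qed

lemma hamilton_force_GDERIV:
  assumes y: "y \<noteq> 0" and nz: "osc_B \<bullet> gradient (osc_rho \<omega>) y \<noteq> 0"
  shows "GDERIV (\<lambda>y'. osc_Hamiltonian \<omega> y' q) y :>
     - (- osc_At q + hessian (osc_rho \<omega>) y (sgn (osc_B \<bullet> gradient (osc_rho \<omega>) y) *\<^sub>R osc_B))"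
proof -
  have "GDERIV (\<lambda>y'. osc_A \<omega> y' \<bullet> q + \<bar>osc_B \<bullet> q\<bar> - \<bar>osc_B \<bullet> gradient (osc_rho \<omega>) y'\<bar>) y :>
     osc_At q + 0 - sgn (osc_B \<bullet> gradient (osc_rho \<omega>) y) *\<^sub>R hessian (osc_rho \<omega>) y osc_B"
    by (intro GDERIV_diff GDERIV_add GDERIV_osc_A GDERIV_const GDERIV_abs[OF GDERIV_osc_B_gradient[OF y] nz])
  then show ?thesis by (simp add: osc_Hamiltonian_def linear_scale[OF hessian_linear[OF y]])
qed

end

lemma Sign_minus: "s \<in> Sign (- a) \<longleftrightarrow> - s \<in> Sign a"
  by (auto simp: Sign_def sgn_if split: if_splits)

theorem theorem2:
  fixes \<omega> :: "'n::finite \<Rightarrow> real"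
    and I :: "real set"
    and x \<psi> :: "real \<Rightarrow> 'n phase"
    and u :: "real \<Rightarrow> real"
  assumes "\<And>i. \<omega> i > 0" and "inj \<omega>"
    and "is_interval I"
    and "basic_motion \<omega> I x u"
    and "\<And>t. t \<in> I \<Longrightarrow> \<psi> t = - gradient (osc_rho \<omega>) (x t)"
  shows
    "(\<forall>t\<in>I. u t \<in> Sign (osc_B \<bullet> \<psi> t) \<and> - u t \<in> Sign (osc_B \<bullet> gradient (osc_rho \<omega>) (x t))) \<and>
     moves_with_velocity I x (\<lambda>t. osc_A \<omega> (x t) + u t *\<^sub>R osc_B) \<and>
     moves_with_velocity I \<psi>
       (\<lambda>t. - adjoint (osc_A \<omega>) (\<psi> t) + hessian (osc_rho \<omega>) (x t) ((- u t) *\<^sub>R osc_B)) \<and>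
     (\<forall>y q. y \<noteq> 0 \<longrightarrow>
        hamilton_velocity (osc_Hamiltonian \<omega>) y q =
          {osc_A \<omega> y + s *\<^sub>R osc_B | s. s \<in> Sign (osc_B \<bullet> q)} \<and>
        hamilton_force (osc_Hamiltonian \<omega>) y q =
          {- adjoint (osc_A \<omega>) q + hessian (osc_rho \<omega>) y (s *\<^sub>R osc_B) | s.
             s \<in> Sign (osc_B \<bullet> gradient (osc_rho \<omega>) y)} \<and>
        (osc_B \<bullet> q \<noteq> 0 \<longrightarrow>
           GDERIV (\<lambda>q'. osc_Hamiltonian \<omega> y q') q :>
             osc_A \<omega> y + sgn (osc_B \<bullet> q) *\<^sub>R osc_B) \<and>
        (osc_B \<bullet> gradient (osc_rho \<omega>) y \<noteq> 0 \<longrightarrow>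
           GDERIV (\<lambda>y'. osc_Hamiltonian \<omega> y' q) y :>
             - (- adjoint (osc_A \<omega>) q +
                hessian (osc_rho \<omega>) y (sgn (osc_B \<bullet> gradient (osc_rho \<omega>) y) *\<^sub>R osc_B))))"
proof -
  interpret oscillators \<omega> by standard (rule assms(1))
  have u: "- u t \<in> Sign (osc_B \<bullet> gradient (osc_rho \<omega>) (x t))" if "t \<in> I" for t
    using assms(4) that by (auto simp: basic_motion_def)
  then have "u t \<in> Sign (osc_B \<bullet> \<psi> t)" if "t \<in> I" for t
    using that by (simp add: assms(5) inner_minus_right Sign_minus)
  moreover have "moves_with_velocity I x (\<lambda>t. osc_A \<omega> (x t) + u t *\<^sub>R osc_B)"
    using assms(4) by (simp add: basic_motion_def)
  moreover have "moves_with_velocity I \<psi>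
       (\<lambda>t. - adjoint (osc_A \<omega>) (\<psi> t) + hessian (osc_rho \<omega>) (x t) ((- u t) *\<^sub>R osc_B))"
    by (rule moves_with_velocity_cong[OF conjugate_motion[OF assms(3,4)] assms(3)])
      (simp_all add: assms(5) adjoint_osc_A osc_At_minus)
  ultimately show ?thesis
    using u hamilton_velocity_eq hamilton_velocity_GDERIV hamilton_force_eq hamilton_force_GDERIV
    unfolding adjoint_osc_A by simp
qed

end
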